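(* In each of the two cases (L) and (H): let $\Delta\ge 84\,C_\varphi$ and $\kappa\ge1$, and let $\widehat f_w=\sum_{k=1}^{M_n}w_k\widehat f_k$ be the aggregated estimator using either the Bayesian weights $w=\widetilde w$ or the model selection weights $w=\widehat w$. Suppose the density $f\in L^2(A)$ satisfies $\|f\|_\infty<\infty$ and $\mathbb{E}_f(|X_1|^{2\alpha})<\infty$. (p) Assume there is $K\in\mathbb{N}$ with $1\ge b_{K-1}(f)>0$ and $b_K(f)=0$. Then there is a finite constant $C_f$ depending only on $f$ such that for all $n\ge3$ (with $M_n\ge 1$) $$\mathbb{E}^n_f\|\widehat f_w-f\|_A^2\le C_f\,n^{-1}.$$ (np) If $b_k(f)>0$ for all $k\in\mathbb{N}$, then there is a numerical constant $C$ such that for all $n\ge3$ (with $M_n\ge 1$) $$\mathbb{E}^n_f\|\widehat f_w-f\|_A^2\le C\Big((\|f\|_A^2+v_f)\,\mathcal{R}_n(f)+\big([\|f\|_\infty^3\vee1]\,v_f+[\|f\|_A^2\vee1]\,\mathbb{E}_f(|X_1|^{2\alpha})\big)n^{-1}\Big),$$ where $$\mathcal{R}_n(f):=\min_{1\le k\le M_n}\Big\{R_n^k(f)\vee\exp\Big(-\frac{C_\varphi v_f}{1\vee400\|f\|_\infty}k^{1/2}\Big)\Big\}.$$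
   Context: Two cases are considered. Case (L): $A=(0,\infty)$, $\varphi_j=\ell_j$ are the Laguerre functions $\ell_j(x)=\sqrt2\,L_j(2x)e^{-x}\mathbf 1_{(0,\infty)}(x)$, $L_j(x)=\sum_{k=0}^j(-1)^k\binom jk\frac{x^k}{k!}$; $\alpha=-1/2$, $d=1$, $M_n=\lfloor n^2(600\log n)^{-4}\rfloor$. Case (H): $A=\mathbb{R}$, $\varphi_j=h_j$ are the Hermite functions $h_j(x)=(2^jj!\sqrt\pi)^{-1/2}H_j(x)e^{-x^2/2}$, $H_j(x)=(-1)^je^{x^2}\frac{d^j}{dx^j}e^{-x^2}$; $\alpha=2/3$, $d=10/12$, $M_n=n^2$. In each case $(\varphi_j)_{j\ge0}$ is an orthonormal basis of $L^2(A)$ with usual inner product $\langle\cdot,\cdot\rangle_A$ and norm $\|\cdot\|_A$; $\|\cdot\|_\infty$ is the sup norm; $a\vee b=\max(a,b)$. $X_1,\dots,X_n$ are i.i.d. with probability density $f\in L^2(A)$ supported in $A$; $\mathbb{E}_f$, $\mathbb{E}_f^n$ denote expectation under the marginal and joint law. Put $a_j(f)=\langle f,\varphi_j\rangle_A$ and define $b_k(f)\in[0,1]$ by $\|f\|_A^2b_k^2(f)=\sum_{j\ge k}|a_j(f)|^2$, $k\in\mathbb{N}_0$ (so $b_0(f)=1$). Put $v_f=\mathbb{E}_f(|X_1|^{\alpha})+1$, $\widehat v=1+\frac1n\sum_{i=1}^n|X_i|^\alpha$, $R_n^k(f)=b_k^2(f)\vee n^{-1}k^{1/2}$. $C_\varphi\ge1$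 is a fixed numerical constant such that for all $k\in\mathbb{N}$ (and all densities $f$): $\|\sum_{j=0}^{k-1}\varphi_j^2\|_\infty\le C_\varphi k^{d}$ and $\sum_{j=0}^{k-1}\mathbb{E}_f(\varphi_j^2(X_1))\le C_\varphi v_fk^{1/2}$. Orthogonal series estimators: $\widehat f_k=\sum_{j=0}^{k-1}\widehat a_j\varphi_j$, $\widehat a_j=\frac1n\sum_{i=1}^n\varphi_j(X_i)$. Penalties: $\widehat{\mathrm{pen}}_k=\Delta\,\widehat v\,k^{1/2}n^{-1}$. Bayesian weights: $$\widetilde w_k=\frac{\exp(-\kappa n\{-\|\widehat f_k\|_A^2+\widehat{\mathrm{pen}}_k\})}{\sum_{l=1}^{M_n}\exp(-\kappa n\{-\|\widehat f_l\|_A^2+\widehat{\mathrm{pen}}_l\})},\quad 1\le k\le M_n.$$ Model selection weights: $\widehat w_k=\mathbf 1\{k=\widehat k\}$, where $\widehat k$ is the smallest minimiser of $k\mapsto-\|\widehat f_k\|_A^2+\widehat{\mathrm{pen}}_k$ over $\{1,\dots,M_n\}$. $\Delta$ and $\kappa$ are fixed numerical constants; a "numerical constant" is one that depends neither on $f$ nor on $n$. *)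

theory Defs
  imports "HOL-Probability.Probability"
begin

datatype setting = Laguerre | Hermite

definition laguerre_poly :: "nat \<Rightarrow> real \<Rightarrow> real" where
  "laguerre_poly j x = (\<Sum>k\<le>j. (-1) ^ k * real (j choose k) * x ^ k / fact k)"

definition laguerre_fun :: "nat \<Rightarrow> real \<Rightarrow> real" where
  "laguerre_fun j x = sqrt 2 * laguerre_poly j (2 * x) * exp (- x) * indicator {0<..} x"

definition hermite_poly :: "nat \<Rightarrow> real \<Rightarrow> real" where
  "hermite_poly j x = (-1) ^ j * exp (x\<^sup>2) * (deriv ^^ j) (\<lambda>t. exp (- t\<^sup>2)) x"

definition hermite_fun :: "nat \<Rightarrow> real \<Rightarrow> real" where
  "hermite_fun j x = (2 ^ j * fact j * sqrt pi) powr (-1/2) * hermite_poly j x * exp (- x\<^sup>2 / 2)"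

fun dom_A :: "setting \<Rightarrow> real set" where
  "dom_A Laguerre = {0<..}"
| "dom_A Hermite = UNIV"

fun phi :: "setting \<Rightarrow> nat \<Rightarrow> real \<Rightarrow> real" where
  "phi Laguerre = laguerre_fun"
| "phi Hermite = hermite_fun"

fun alpha :: "setting \<Rightarrow> real" where
  "alpha Laguerre = -1/2"
| "alpha Hermite = 2/3"

fun dexp :: "setting \<Rightarrow> real" where
  "dexp Laguerre = 1"
| "dexp Hermite = 10/12"

fun max_dim :: "setting \<Rightarrow> nat \<Rightarrow> nat" where
  "max_dim Laguerre n = nat \<lfloor>(real n)\<^sup>2 * (600 * ln (real n)) powr (-4)\<rfloor>"
| "max_dim Hermite n = n\<^sup>2"

definition L2_inner :: "setting \<Rightarrow> (real \<Rightarrow> real) \<Rightarrow> (real \<Rightarrow> real) \<Rightarrow> real" where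
  "L2_inner c g h = set_lebesgue_integral lborel (dom_A c) (\<lambda>x. g x * h x)"

definition L2_norm :: "setting \<Rightarrow> (real \<Rightarrow> real) \<Rightarrow> real" where
  "L2_norm c g = sqrt (L2_inner c g g)"

definition sup_norm :: "(real \<Rightarrow> real) \<Rightarrow> ennreal" where
  "sup_norm g = (SUP x. ennreal \<bar>g x\<bar>)"

definition L2_density :: "setting \<Rightarrow> (real \<Rightarrow> real) \<Rightarrow> bool" where
  "L2_density c f \<longleftrightarrow>
     f \<in> borel_measurable borel \<and> (\<forall>x. 0 \<le> f x) \<and> (\<forall>x. x \<notin> dom_A c \<longrightarrow> f x = 0) \<and>
     (\<integral>\<^sup>+ x. ennreal (f x) \<partial>lborel) = 1 \<and>
     set_integrable lborel (dom_A c) (\<lambda>x. (f x)\<^sup>2)"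

definition law :: "(real \<Rightarrow> real) \<Rightarrow> real measure" where
  "law f = density lborel (\<lambda>x. ennreal (f x))"

definition sample_law :: "nat \<Rightarrow> (real \<Rightarrow> real) \<Rightarrow> (nat \<Rightarrow> real) measure" where
  "sample_law n f = PiM {1..n} (\<lambda>_. law f)"

definition coeff_a :: "setting \<Rightarrow> (real \<Rightarrow> real) \<Rightarrow> nat \<Rightarrow> real" where
  "coeff_a c f j = L2_inner c f (phi c j)"

definition bias_b :: "setting \<Rightarrow> (real \<Rightarrow> real) \<Rightarrow> nat \<Rightarrow> real" where
  "bias_b c f k = sqrt ((\<Sum>j. \<bar>coeff_a c f (j + k)\<bar>\<^sup>2) / (L2_norm c f)\<^sup>2)"

definition v_mom :: "setting \<Rightarrow> (real \<Rightarrow> real) \<Rightarrow> real" where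
  "v_mom c f = (\<integral>x. \<bar>x\<bar> powr alpha c \<partial>law f) + 1"

text \<open>In the second bound, densities with \<open>|x| powr \<alpha>\<close> not integrable are left out: there
  \<open>v\<^sub>f\<close> is infinite and the bound holds trivially, whereas the real-valued integral in
  \<^const>\<open>v_mom\<close> would take the value 0.\<close>

definition admissible_const :: "setting \<Rightarrow> real \<Rightarrow> bool" where
  "admissible_const c C\<phi> \<longleftrightarrow>
     1 \<le> C\<phi> \<and>
     (\<forall>k\<ge>1. sup_norm (\<lambda>x. \<Sum>j<k. (phi c j x)\<^sup>2) \<le> ennreal (C\<phi> * real k powr dexp c)) \<and>
     (\<forall>k\<ge>1. \<forall>f. L2_density c f \<and> integrable (law f) (\<lambda>x. \<bar>x\<bar> powr alpha c) \<longrightarrow>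
        (\<Sum>j<k. \<integral>x. (phi c j x)\<^sup>2 \<partial>law f) \<le> C\<phi> * v_mom c f * sqrt (real k))"

definition v_hat :: "setting \<Rightarrow> nat \<Rightarrow> (nat \<Rightarrow> real) \<Rightarrow> real" where
  "v_hat c n X = 1 + (1 / real n) * (\<Sum>i=1..n. \<bar>X i\<bar> powr alpha c)"

definition a_hat :: "setting \<Rightarrow> nat \<Rightarrow> (nat \<Rightarrow> real) \<Rightarrow> nat \<Rightarrow> real" where
  "a_hat c n X j = (1 / real n) * (\<Sum>i=1..n. phi c j (X i))"

definition f_hat :: "setting \<Rightarrow> nat \<Rightarrow> (nat \<Rightarrow> real) \<Rightarrow> nat \<Rightarrow> real \<Rightarrow> real" where
  "f_hat c n X k x = (\<Sum>j<k. a_hat c n X j * phi c j x)"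

definition pen_hat :: "setting \<Rightarrow> real \<Rightarrow> nat \<Rightarrow> (nat \<Rightarrow> real) \<Rightarrow> nat \<Rightarrow> real" where
  "pen_hat c \<Delta> n X k = \<Delta> * v_hat c n X * sqrt (real k) / real n"

definition crit :: "setting \<Rightarrow> real \<Rightarrow> nat \<Rightarrow> (nat \<Rightarrow> real) \<Rightarrow> nat \<Rightarrow> real" where
  "crit c \<Delta> n X k = - (L2_norm c (f_hat c n X k))\<^sup>2 + pen_hat c \<Delta> n X k"

definition bayes_weights ::
    "setting \<Rightarrow> real \<Rightarrow> real \<Rightarrow> nat \<Rightarrow> (nat \<Rightarrow> real) \<Rightarrow> nat \<Rightarrow> real" where
  "bayes_weights c \<Delta> \<kappa> n X k =
     exp (- \<kappa> * real n * crit c \<Delta> n X k) /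
     (\<Sum>l=1..max_dim c n. exp (- \<kappa> * real n * crit c \<Delta> n X l))"

definition k_hat :: "setting \<Rightarrow> real \<Rightarrow> nat \<Rightarrow> (nat \<Rightarrow> real) \<Rightarrow> nat" where
  "k_hat c \<Delta> n X =
     (LEAST k. k \<in> {1..max_dim c n} \<and> (\<forall>l\<in>{1..max_dim c n}. crit c \<Delta> n X k \<le> crit c \<Delta> n X l))"

definition ms_weights ::
    "setting \<Rightarrow> real \<Rightarrow> nat \<Rightarrow> (nat \<Rightarrow> real) \<Rightarrow> nat \<Rightarrow> real" where
  "ms_weights c \<Delta> n X k = (if k = k_hat c \<Delta> n X then 1 else 0)"

definition agg_est ::
    "setting \<Rightarrow> (nat \<Rightarrow> (nat \<Rightarrow> real) \<Rightarrow> nat \<Rightarrow> real) \<Rightarrow> nat \<Rightarrow> (nat \<Rightarrow> real) \<Rightarrow> real \<Rightarrow> real" where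
  "agg_est c w n X x = (\<Sum>k=1..max_dim c n. w n X k * f_hat c n X k x)"

definition risk ::
    "setting \<Rightarrow> (nat \<Rightarrow> (nat \<Rightarrow> real) \<Rightarrow> nat \<Rightarrow> real) \<Rightarrow> nat \<Rightarrow> (real \<Rightarrow> real) \<Rightarrow> ennreal" where
  "risk c w n f =
     (\<integral>\<^sup>+ X. ennreal ((L2_norm c (\<lambda>x. agg_est c w n X x - f x))\<^sup>2) \<partial>sample_law n f)"

definition rate_k :: "setting \<Rightarrow> nat \<Rightarrow> (real \<Rightarrow> real) \<Rightarrow> nat \<Rightarrow> real" where
  "rate_k c n f k = max ((bias_b c f k)\<^sup>2) (sqrt (real k) / real n)"

definition rate_min :: "setting \<Rightarrow> real \<Rightarrow> nat \<Rightarrow> (real \<Rightarrow> real) \<Rightarrow> real" where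
  "rate_min c C\<phi> n f =
     Min ((\<lambda>k. max (rate_k c n f k)
                 (exp (- (C\<phi> * v_mom c f / max 1 (400 * enn2real (sup_norm f))) * sqrt (real k))))
          ` {1..max_dim c n})"

end

theory Submission
  imports Defs "HOL-Real_Asymp.Real_Asymp"
begin

text \<open>Let \<open>S\<^sub>k\<close> be the sum over \<open>j < k\<close> of the squared errors of the empirical coefficients. Expanding
  \<open>n\<^sup>2 S\<^sub>k\<close> over pairs of observations separates a diagonal, which the admissibility condition bounds
  sample by sample by a multiple of \<open>n \<surd>k (v\<^sub>n + v\<^sub>f)\<close> with \<open>v\<^sub>n\<close> the empirical version of \<open>v\<^sub>f\<close>,
  from a degenerate U-statistic. The latter is a martingale, and a recursion in the sample size
  bounds its fourth moment. As \<open>S\<^sub>k\<close> is increasing in \<open>k\<close>, it suffices to control it along the powers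
  of 4; there fourth moments are summable, so that no exponential concentration inequality is
  needed and all \<open>S\<^sub>k\<close> are at most the penalty up to a remainder of expectation \<open>O(1/n)\<close>. The event
  that \<open>v\<^sub>n\<close> is below half of \<open>v\<^sub>f\<close> is handled by Chebyshev's inequality. The rest is a deterministic
  oracle inequality in terms of \<open>\<parallel>f\<parallel>\<^sup>2\<close> minus the sum of the squares of the first \<open>k\<close> coefficients; this is the bias
  of the theorem because the bases are complete: a function whose product with the weight
  has vanishing moments has zero Fourier transform.\<close>

subsection \<open>Fourth moment of a degenerate U-statistic\<close>

text \<open>Why fourth moments: put k = 4^m, H = C v 2^m, and let u be the U-statistic. The part of
  u / n^2 above H / n is the remainder. Bounding it through u^2 and the second moment 2 F n^2 H
  leaves 2 F / n at every level, a total of order log n / n. Through u^4 / (n H)^3, level m costs a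
  multiple of 1 / (n 2^m) + 2^m / n^2, and both geometric sums are O(1/n) as long as 2^m <= 2 n,
  which is enough because dimensions never exceed n^2. The cube of the sup norm in the remainder is
  F^2 from one step of the fourth moment recursion times F from the second moment of the squared
  norm. Why 84: the error at k is at most sqrt k / n * C (4 \<open>v_hat\<close> + 6 v) plus
  remainder. The oracle inequality charges it four times, and the weights cost one further sqrt k /
  n. If v <= 2 \<open>v_hat\<close>, this makes at most 16 + 48 + 1 = 65 multiples of C
  \<open>v_hat\<close>, which the penalty covers.\<close>

definition bmeas :: "'a measure \<Rightarrow> ('a \<Rightarrow> real) \<Rightarrow> bool" where
  "bmeas N g \<longleftrightarrow> g \<in> borel_measurable N \<and> (\<exists>B. \<forall>x\<in>space N. \<bar>g x\<bar> \<le> B)"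

lemma bmeas_const: "bmeas N (\<lambda>_. a)"
  unfolding bmeas_def by auto

lemma bmeas_add:
  assumes "bmeas N g" "bmeas N h" shows "bmeas N (\<lambda>x. g x + h x)"
proof -
  obtain A B where AB: "\<forall>x\<in>space N. \<bar>g x\<bar> \<le> A" "\<forall>x\<in>space N. \<bar>h x\<bar> \<le> B"
    using assms unfolding bmeas_def by auto
  have "\<forall>x\<in>space N. \<bar>g x + h x\<bar> \<le> A + B"
  proof
    fix x assume "x \<in> space N"
    then have "\<bar>g x\<bar> \<le> A" "\<bar>h x\<bar> \<le> B" using AB by auto
    then show "\<bar>g x + h x\<bar> \<le> A + B" by linarith
  qed
  then show ?thesis using assms unfolding bmeas_def by auto
qed

lemma bmeas_mult:
  assumes "bmeas N g" "bmeas N h" shows "bmeas N (\<lambda>x. g x * h x)"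
proof -
  obtain A B where AB: "\<forall>x\<in>space N. \<bar>g x\<bar> \<le> A" "\<forall>x\<in>space N. \<bar>h x\<bar> \<le> B"
    using assms unfolding bmeas_def by auto
  have "\<forall>x\<in>space N. \<bar>g x * h x\<bar> \<le> \<bar>A\<bar> * \<bar>B\<bar>"
  proof
    fix x assume "x \<in> space N"
    then have "\<bar>g x\<bar> \<le> \<bar>A\<bar>" "\<bar>h x\<bar> \<le> \<bar>B\<bar>" using AB by force+
    then show "\<bar>g x * h x\<bar> \<le> \<bar>A\<bar> * \<bar>B\<bar>" unfolding abs_mult by (intro mult_mono) auto
  qed
  then show ?thesis using assms unfolding bmeas_def by auto
qed

lemma bmeas_uminus: "bmeas N g \<Longrightarrow> bmeas N (\<lambda>x. - g x)"
  using bmeas_mult[OF bmeas_const[of N "-1"]] by simp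

lemma bmeas_diff: "bmeas N g \<Longrightarrow> bmeas N h \<Longrightarrow> bmeas N (\<lambda>x. g x - h x)"
  using bmeas_add[OF _ bmeas_uminus, of N g h] by simp

lemma bmeas_power: "bmeas N g \<Longrightarrow> bmeas N (\<lambda>x. g x ^ p)"
  by (induction p) (auto intro: bmeas_const bmeas_mult)

lemma bmeas_sum: "(\<And>i. i \<in> I \<Longrightarrow> bmeas N (g i)) \<Longrightarrow> bmeas N (\<lambda>x. \<Sum>i\<in>I. g i x)"
  by (induction I rule: infinite_finite_induct) (auto intro: bmeas_const bmeas_add)

lemmas bmeas_intros = bmeas_const bmeas_add bmeas_mult bmeas_uminus bmeas_diff bmeas_power bmeas_sum

lemma bmeas_comp: "bmeas N g \<Longrightarrow> h \<in> measurable N' N \<Longrightarrow> bmeas N' (\<lambda>x. g (h x))"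
  unfolding bmeas_def by (auto dest: measurable_space)

text \<open>The moment recursions involve only polynomial expressions in bounded quantities, so each
  integrability obligation reduces to closure of boundedness under algebraic operations.\<close>

lemma (in prob_space) bmeas_integrable: "bmeas M g \<Longrightarrow> integrable M g"
  unfolding bmeas_def using integrable_const_bound[of g] by auto

text \<open>Three scales of a centred random vector: \<open>b\<close> bounds the squared length,
  \<open>H\<close> the trace of the covariance and \<open>F\<close> its operator norm. For the first
  k basis functions they are of order k, sqrt k and 1; this separation is what makes the fourth
  moment small.\<close>

locale bounded_vector_sample = prob_space Q for Q :: "'a measure" +
  fixes Y :: "'a \<Rightarrow> 'j \<Rightarrow> real" and J :: "'j set" and b H F :: real
  assumes finite_J: "finite J"
    and Y_measurable: "\<And>j. j \<in> J \<Longrightarrow> (\<lambda>x. Y x j) \<in> borel_measurable Q"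
    and Y_bound: "\<And>x. x \<in> space Q \<Longrightarrow> (\<Sum>j\<in>J. (Y x j)\<^sup>2) \<le> b"
    and Y_mean: "\<And>j. j \<in> J \<Longrightarrow> (\<integral>x. Y x j \<partial>Q) = 0"
    and Y_trace: "(\<integral>x. (\<Sum>j\<in>J. (Y x j)\<^sup>2) \<partial>Q) \<le> H"
    and Y_weak: "\<And>u. (\<integral>x. (\<Sum>j\<in>J. u j * Y x j)\<^sup>2 \<partial>Q) \<le> F * (\<Sum>j\<in>J. (u j)\<^sup>2)"
    and F_nonneg: "0 \<le> F"
begin

definition PS :: "nat \<Rightarrow> (nat \<Rightarrow> 'a) measure" where "PS i = PiM {1..i} (\<lambda>_. Q)"

definition part :: "nat \<Rightarrow> (nat \<Rightarrow> 'a) \<Rightarrow> 'j \<Rightarrow> real" where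
  "part i X j = (\<Sum>l=1..i. Y (X l) j)"

definition normsq :: "nat \<Rightarrow> (nat \<Rightarrow> 'a) \<Rightarrow> real" where
  "normsq i X = (\<Sum>j\<in>J. (part i X j)\<^sup>2)"

definition diag :: "nat \<Rightarrow> (nat \<Rightarrow> 'a) \<Rightarrow> real" where
  "diag i X = (\<Sum>l=1..i. \<Sum>j\<in>J. (Y (X l) j)\<^sup>2)"

definition offdiag :: "nat \<Rightarrow> (nat \<Rightarrow> 'a) \<Rightarrow> real" where
  "offdiag i X = normsq i X - diag i X"

lemma prob_space_PS: "prob_space (PS i)"
  unfolding PS_def by (intro prob_space_PiM prob_space_axioms)

lemma integrable_PS: "bmeas (PS i) g \<Longrightarrow> integrable (PS i) g"
  by (rule prob_space.bmeas_integrable[OF prob_space_PS])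

lemma bmeas_Y: assumes "j \<in> J" shows "bmeas Q (\<lambda>x. Y x j)"
proof -
  have "\<bar>Y x j\<bar> \<le> sqrt b" if "x \<in> space Q" for x
  proof -
    have "(Y x j)\<^sup>2 \<le> (\<Sum>j\<in>J. (Y x j)\<^sup>2)"
      using finite_J assms by (intro member_le_sum) auto
    then have "(Y x j)\<^sup>2 \<le> b" using Y_bound[OF that] by linarith
    then show ?thesis by (simp add: real_le_rsqrt)
  qed
  then show ?thesis unfolding bmeas_def using Y_measurable[OF assms] by blast
qed

lemma bmeas_YX: "j \<in> J \<Longrightarrow> l \<in> {1..i} \<Longrightarrow> bmeas (PS i) (\<lambda>X. Y (X l) j)"
  unfolding PS_def by (rule bmeas_comp[OF bmeas_Y]) auto

lemma bmeas_part: "j \<in> J \<Longrightarrow> bmeas (PS i) (\<lambda>X. part i X j)"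
  unfolding part_def by (intro bmeas_intros bmeas_YX)

lemma bmeas_normsq: "bmeas (PS i) (normsq i)"
  unfolding normsq_def[abs_def] by (intro bmeas_intros bmeas_part)

lemma bmeas_diag: "bmeas (PS i) (diag i)"
  unfolding diag_def[abs_def] by (intro bmeas_intros bmeas_YX)

lemma bmeas_offdiag: "bmeas (PS i) (offdiag i)"
  unfolding offdiag_def[abs_def] by (intro bmeas_intros bmeas_normsq bmeas_diag)

lemmas bmeas_stats = bmeas_intros bmeas_YX bmeas_part bmeas_normsq bmeas_diag bmeas_offdiag bmeas_Y

text \<open>Fubini in the form of conditioning on the first \<open>i\<close> observations; every
  recursion below rests on it.\<close>

lemma integral_PS_Suc:
  assumes "bmeas (PS (Suc i)) g"
  shows "(\<integral>X. g X \<partial>PS (Suc i)) = (\<integral>X. (\<integral>y. g (X(Suc i := y)) \<partial>Q) \<partial>PS i)"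
proof -
  interpret P: product_sigma_finite "\<lambda>_::nat. Q"
    by (simp add: product_sigma_finite_def sigma_finite_measure_axioms)
  have eq: "{1..Suc i} = insert (Suc i) {1..i}" by auto
  have "integrable (PiM (insert (Suc i) {1..i}) (\<lambda>_. Q)) g"
    using integrable_PS[OF assms] unfolding PS_def eq .
  then show ?thesis unfolding PS_def
    by (subst eq, subst P.product_integral_insert) auto
qed

lemma part_upd: "part (Suc i) (X(Suc i := y)) j = part i X j + Y y j"
  unfolding part_def by simp

definition cross :: "nat \<Rightarrow> (nat \<Rightarrow> 'a) \<Rightarrow> 'a \<Rightarrow> real" where
  "cross i X y = (\<Sum>j\<in>J. part i X j * Y y j)"

lemma diag_upd: "diag (Suc i) (X(Suc i := y)) = diag i X + (\<Sum>j\<in>J. (Y y j)\<^sup>2)"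
  unfolding diag_def by simp

lemma normsq_upd:
  "normsq (Suc i) (X(Suc i := y)) = normsq i X + 2 * cross i X y + (\<Sum>j\<in>J. (Y y j)\<^sup>2)"
  unfolding normsq_def part_upd cross_def
  by (simp add: power2_sum sum.distrib sum_distrib_left mult_ac)

text \<open>The squared length of the new vector goes into \<open>diag\<close>, so what remains is
  linear in the new observation and conditionally centred by \<open>cross_mean\<close>. This is the
  martingale property.\<close>

lemma offdiag_upd: "offdiag (Suc i) (X(Suc i := y)) = offdiag i X + 2 * cross i X y"
  unfolding offdiag_def normsq_upd diag_upd by simp

lemma bmeas_cross: "bmeas Q (cross i X)"
  unfolding cross_def[abs_def] by (intro bmeas_intros bmeas_Y)

lemma bmeas_Ysq: "bmeas Q (\<lambda>y. \<Sum>j\<in>J. (Y y j)\<^sup>2)"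
  by (intro bmeas_intros bmeas_Y)

lemma cross_mean: "(\<integral>y. cross i X y \<partial>Q) = 0"
proof -
  have "(\<integral>y. cross i X y \<partial>Q) = (\<Sum>j\<in>J. part i X j * (\<integral>y. Y y j \<partial>Q))"
    unfolding cross_def
    by (subst Bochner_Integration.integral_sum) (auto intro!: bmeas_integrable bmeas_stats)
  then show ?thesis using Y_mean by simp
qed

lemma cross_sq: "(\<integral>y. (cross i X y)\<^sup>2 \<partial>Q) \<le> F * normsq i X"
  unfolding cross_def normsq_def by (rule Y_weak)

lemma normsq_nonneg: "0 \<le> normsq i X"
  unfolding normsq_def by (simp add: sum_nonneg)

lemma H_nonneg: "0 \<le> H"
  using Y_trace by (rule order_trans[rotated]) (simp add: sum_nonneg)

lemma b_nonneg: "0 \<le> b"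
proof -
  obtain x where "x \<in> space Q" using not_empty by auto
  have "0 \<le> (\<Sum>j\<in>J. (Y x j)\<^sup>2)" by (simp add: sum_nonneg)
  also have "\<dots> \<le> b" by (rule Y_bound) fact
  finally show ?thesis .
qed

text \<open>Reduces a moment recursion to a pointwise conditional bound; measurability and
  boundedness of the inner integral are settled here once for all recursions.\<close>

lemma integral_PS_Suc_le:
  assumes "bmeas (PS (Suc i)) g" "bmeas (PS i) h"
    and "\<And>X. X \<in> space (PS i) \<Longrightarrow> (\<integral>y. g (X(Suc i := y)) \<partial>Q) \<le> h X"
  shows "(\<integral>X. g X \<partial>PS (Suc i)) \<le> (\<integral>X. h X \<partial>PS i)"
proof -
  interpret P: product_sigma_finite "\<lambda>_::nat. Q"
    by (simp add: product_sigma_finite_def sigma_finite_measure_axioms)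
  interpret Pi: prob_space "PS i" by (rule prob_space_PS)
  obtain B where B: "\<forall>x\<in>space (PS (Suc i)). \<bar>g x\<bar> \<le> B" and m: "g \<in> borel_measurable (PS (Suc i))"
    using assms(1) unfolding bmeas_def by auto
  have eq: "{1..Suc i} = insert (Suc i) {1..i}" by auto
  have m2: "(\<lambda>(X, y). g (X(Suc i := y))) \<in> borel_measurable (PS i \<Otimes>\<^sub>M Q)"
    using m unfolding PS_def eq by (simp add: split_beta') measurable
  have m3: "(\<lambda>X. \<integral>y. g (X(Suc i := y)) \<partial>Q) \<in> borel_measurable (PS i)"
    using borel_measurable_lebesgue_integral[OF m2] by simp
  have "\<bar>\<integral>y. g (X(Suc i := y)) \<partial>Q\<bar> \<le> \<bar>B\<bar>" if X: "X \<in> space (PS i)" for X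
  proof -
    have *: "\<bar>g (X(Suc i := y))\<bar> \<le> \<bar>B\<bar>" if y: "y \<in> space Q" for y
    proof -
      have "X(Suc i := y) \<in> space (PS (Suc i))"
        using X y unfolding PS_def eq space_PiM by (intro PiE_fun_upd) auto
      then show ?thesis using B by force
    qed
    have "\<bar>\<integral>y. g (X(Suc i := y)) \<partial>Q\<bar> \<le> (\<integral>y. \<bar>B\<bar> \<partial>Q)"
      by (rule order_trans[OF integral_abs_bound integral_mono_AE'])  (use * in auto)
    then show ?thesis by (simp add: prob_space)
  qed
  then have "bmeas (PS i) (\<lambda>X. \<integral>y. g (X(Suc i := y)) \<partial>Q)"
    using m3 unfolding bmeas_def by blast
  then show ?thesis unfolding integral_PS_Suc[OF assms(1)]
    by (intro integral_mono integrable_PS assms)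
qed

lemma normsq_moment: "(\<integral>X. normsq i X \<partial>PS i) \<le> i * H"
proof (induction i)
  case 0
  then show ?case by (simp add: normsq_def part_def)
next
  case (Suc i)
  interpret Pi: prob_space "PS i" by (rule prob_space_PS)
  have "(\<integral>X. normsq (Suc i) X \<partial>PS (Suc i)) \<le> (\<integral>X. normsq i X + H \<partial>PS i)"
  proof (rule integral_PS_Suc_le)
    show "(\<integral>y. normsq (Suc i) (X(Suc i := y)) \<partial>Q) \<le> normsq i X + H" for X
      unfolding normsq_upd using cross_mean[of i X] Y_trace bmeas_integrable[OF bmeas_cross]
        bmeas_integrable[OF bmeas_Ysq] by (simp add: prob_space)
  qed (intro bmeas_stats)+
  also have "\<dots> = (\<integral>X. normsq i X \<partial>PS i) + H"
    using integrable_PS[OF bmeas_normsq] by (simp add: Pi.prob_space)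
  finally show ?case using Suc by (simp add: algebra_simps)
qed

lemma diag_moment: "(\<integral>X. diag i X \<partial>PS i) \<le> i * H"
proof (induction i)
  case 0
  then show ?case by (simp add: diag_def)
next
  case (Suc i)
  interpret Pi: prob_space "PS i" by (rule prob_space_PS)
  have "(\<integral>X. diag (Suc i) X \<partial>PS (Suc i)) \<le> (\<integral>X. diag i X + H \<partial>PS i)"
  proof (rule integral_PS_Suc_le)
    show "(\<integral>y. diag (Suc i) (X(Suc i := y)) \<partial>Q) \<le> diag i X + H" for X
      unfolding diag_upd using Y_trace
        bmeas_integrable[OF bmeas_Ysq] by (simp add: prob_space)
  qed (intro bmeas_stats)+
  also have "\<dots> = (\<integral>X. diag i X \<partial>PS i) + H"
    using integrable_PS[OF bmeas_diag] by (simp add: Pi.prob_space)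
  finally show ?case using Suc by (simp add: algebra_simps)
qed

lemma diag_nonneg: "0 \<le> diag i X"
  unfolding diag_def by (simp add: sum_nonneg)

lemma diag_sq_moment: "(\<integral>X. (diag i X)\<^sup>2 \<partial>PS i) \<le> (real i)\<^sup>2 * H\<^sup>2 + real i * b * H"
proof (induction i)
  case 0
  then show ?case by (simp add: diag_def)
next
  case (Suc i)
  interpret Pi: prob_space "PS i" by (rule prob_space_PS)
  have "(\<integral>X. (diag (Suc i) X)\<^sup>2 \<partial>PS (Suc i)) \<le> (\<integral>X. (diag i X)\<^sup>2 + 2 * H * diag i X + b * H \<partial>PS i)"
  proof (rule integral_PS_Suc_le)
    fix X
    let ?N = "\<lambda>y. \<Sum>j\<in>J. (Y y j)\<^sup>2"
    have "(\<integral>y. (diag (Suc i) (X(Suc i := y)))\<^sup>2 \<partial>Q) \<le> (\<integral>y. (diag i X)\<^sup>2 + (2 * diag i X + b) * ?N y \<partial>Q)"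
      unfolding diag_upd
    proof (intro integral_mono bmeas_integrable bmeas_stats)
      fix y assume "y \<in> space Q"
      \<comment> \<open>The fourth power of the length is traded for \<open>b\<close> times its
        square, so that only the trace bound is needed afterwards.\<close>
      then have "?N y * ?N y \<le> b * ?N y" using Y_bound by (intro mult_right_mono) (auto simp: sum_nonneg)
      then show "(diag i X + ?N y)\<^sup>2 \<le> (diag i X)\<^sup>2 + (2 * diag i X + b) * ?N y"
        by (simp add: power2_eq_square algebra_simps)
    qed
    also have "\<dots> = (diag i X)\<^sup>2 + (2 * diag i X + b) * (\<integral>y. ?N y \<partial>Q)"
      using bmeas_integrable[OF bmeas_Ysq] by (simp add: prob_space)
    also have "\<dots> \<le> (diag i X)\<^sup>2 + (2 * diag i X + b) * H"
      using H_nonneg Y_trace diag_nonneg[of i X] b_nonneg by (intro add_left_mono mult_left_mono) auto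
    finally show "(\<integral>y. (diag (Suc i) (X(Suc i := y)))\<^sup>2 \<partial>Q) \<le> (diag i X)\<^sup>2 + 2 * H * diag i X + b * H"
      by (simp add: algebra_simps)
  qed (intro bmeas_stats)+
  also have "\<dots> = (\<integral>X. (diag i X)\<^sup>2 \<partial>PS i) + 2 * H * (\<integral>X. diag i X \<partial>PS i) + b * H"
    using integrable_PS[OF bmeas_diag] integrable_PS[OF bmeas_power[OF bmeas_diag]]
    by (simp add: Pi.prob_space)
  also have "\<dots> \<le> ((real i)\<^sup>2 * H\<^sup>2 + real i * b * H) + 2 * H * (i * H) + b * H"
    using H_nonneg b_nonneg by (intro add_mono Suc mult_left_mono diag_moment) auto
  also have "\<dots> \<le> (real (Suc i))\<^sup>2 * H\<^sup>2 + real (Suc i) * b * H"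
    by (simp add: power2_eq_square algebra_simps)
  finally show ?case .
qed

text \<open>Martingale increments are orthogonal: step i adds 4 F times the mean of
  \<open>normsq\<close>, at most 4 F i H, and 4 (0 + ... + (i - 1)) <= 2 i^2.\<close>

lemma offdiag_sq_moment: "(\<integral>X. (offdiag i X)\<^sup>2 \<partial>PS i) \<le> 2 * F * (real i)\<^sup>2 * H"
proof (induction i)
  case 0
  then show ?case by (simp add: offdiag_def normsq_def part_def diag_def)
next
  case (Suc i)
  interpret Pi: prob_space "PS i" by (rule prob_space_PS)
  have "(\<integral>X. (offdiag (Suc i) X)\<^sup>2 \<partial>PS (Suc i)) \<le> (\<integral>X. (offdiag i X)\<^sup>2 + 4 * F * normsq i X \<partial>PS i)"
  proof (rule integral_PS_Suc_le)
    fix X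
    have "(\<integral>y. (offdiag (Suc i) (X(Suc i := y)))\<^sup>2 \<partial>Q)
        = (\<integral>y. (offdiag i X)\<^sup>2 + 4 * offdiag i X * cross i X y + 4 * (cross i X y)\<^sup>2 \<partial>Q)"
      unfolding offdiag_upd by (simp add: power2_eq_square algebra_simps)
    also have "\<dots> = (offdiag i X)\<^sup>2 + 4 * (\<integral>y. (cross i X y)\<^sup>2 \<partial>Q)"
      using cross_mean[of i X] bmeas_integrable[OF bmeas_cross] bmeas_integrable[OF bmeas_power[OF bmeas_cross]]
      by (simp add: prob_space)
    finally show "(\<integral>y. (offdiag (Suc i) (X(Suc i := y)))\<^sup>2 \<partial>Q) \<le> (offdiag i X)\<^sup>2 + 4 * F * normsq i X"
      using cross_sq[of i X] by simp
  qed (intro bmeas_stats)+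
  also have "\<dots> = (\<integral>X. (offdiag i X)\<^sup>2 \<partial>PS i) + 4 * F * (\<integral>X. normsq i X \<partial>PS i)"
    using integrable_PS[OF bmeas_normsq] integrable_PS[OF bmeas_power[OF bmeas_offdiag]]
    by (simp add: Pi.prob_space)
  also have "\<dots> \<le> 2 * F * (real i)\<^sup>2 * H + 4 * F * (i * H)"
    using F_nonneg by (intro add_mono Suc mult_left_mono normsq_moment) auto
  also have "\<dots> \<le> 2 * F * (real (Suc i))\<^sup>2 * H"
    using F_nonneg H_nonneg by (simp add: power2_eq_square algebra_simps)
  finally show ?case .
qed

lemma normsq_sq_moment:
  "(\<integral>X. (normsq i X)\<^sup>2 \<partial>PS i) \<le> 2 * (real i)\<^sup>2 * H\<^sup>2 + 2 * real i * b * H + 4 * F * (real i)\<^sup>2 * H"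
proof -
  have "(\<integral>X. (normsq i X)\<^sup>2 \<partial>PS i) \<le> (\<integral>X. 2 * (diag i X)\<^sup>2 + 2 * (offdiag i X)\<^sup>2 \<partial>PS i)"
  proof (intro integral_mono integrable_PS bmeas_stats)
    fix X
    have "normsq i X = diag i X + offdiag i X" unfolding offdiag_def by simp
    then show "(normsq i X)\<^sup>2 \<le> 2 * (diag i X)\<^sup>2 + 2 * (offdiag i X)\<^sup>2"
      using sum_squares_bound[of "diag i X" "offdiag i X"] by (simp add: power2_sum)
  qed
  also have "\<dots> = 2 * (\<integral>X. (diag i X)\<^sup>2 \<partial>PS i) + 2 * (\<integral>X. (offdiag i X)\<^sup>2 \<partial>PS i)"
    using integrable_PS[OF bmeas_power[OF bmeas_diag]] integrable_PS[OF bmeas_power[OF bmeas_offdiag]]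
    by simp
  finally show ?thesis using diag_sq_moment[of i] offdiag_sq_moment[of i] by simp
qed

text \<open>Here \<open>n\<close> is the horizon, not tied to the current \<open>i\<close>: giving
  weight 1/n to the fourth power in Young's inequality keeps the growth over n steps below
  e.\<close>

lemma offdiag_fourth_step:
  assumes n: "n > 0"
  shows "(\<integral>X. (offdiag (Suc i) X) ^ 4 \<partial>PS (Suc i)) \<le>
    (1 + 1 / real n) * (\<integral>X. (offdiag i X) ^ 4 \<partial>PS i) +
    (256 * real n * F\<^sup>2 + 48 * F * b) * (\<integral>X. (normsq i X)\<^sup>2 \<partial>PS i)"
proof -
  interpret Pi: prob_space "PS i" by (rule prob_space_PS)
  have "(\<integral>X. (offdiag (Suc i) X) ^ 4 \<partial>PS (Suc i)) \<le>
     (\<integral>X. (1 + 1 / real n) * (offdiag i X) ^ 4 + (256 * real n * F\<^sup>2 + 48 * F * b) * (normsq i X)\<^sup>2 \<partial>PS i)"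
  proof (rule integral_PS_Suc_le)
    fix X
    let ?u = "offdiag i X" and ?s = "normsq i X"
    have "(\<integral>y. (offdiag (Suc i) (X(Suc i := y))) ^ 4 \<partial>Q)
       \<le> (\<integral>y. ?u ^ 4 + 8 * ?u ^ 3 * cross i X y + (32 * ?u\<^sup>2 + 48 * ?s * b) * (cross i X y)\<^sup>2 \<partial>Q)"
      unfolding offdiag_upd
    proof (intro integral_mono bmeas_integrable bmeas_stats bmeas_cross)
      fix y assume y: "y \<in> space Q"
      define p where "p = cross i X y"
      have "p\<^sup>2 \<le> ?s * (\<Sum>j\<in>J. (Y y j)\<^sup>2)"
        unfolding p_def cross_def normsq_def by (rule Cauchy_Schwarz_ineq_sum)
      also have "\<dots> \<le> ?s * b" using Y_bound[OF y] normsq_nonneg by (intro mult_left_mono)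
      finally have "p\<^sup>2 * p\<^sup>2 \<le> ?s * b * p\<^sup>2" by (intro mult_right_mono) auto
      then have p4: "p ^ 4 \<le> ?s * b * p\<^sup>2" by (simp add: power4_eq_xxxx power2_eq_square mult_ac)
      \<comment> \<open>The expansion of (u + 2 p)^4 contains 32 u p^3, which has no sign. Adding
        this square removes it and raises the coefficients 24 of u^2 p^2 and 16 of p^4 to 32 and
        48.\<close>
      have "0 \<le> 8 * (?u * p - 2 * p\<^sup>2)\<^sup>2" by simp
      then have "(?u + 2 * p) ^ 4 \<le> ?u ^ 4 + 8 * ?u ^ 3 * p + 32 * ?u\<^sup>2 * p\<^sup>2 + 48 * p ^ 4"
        by (simp add: power4_eq_xxxx power3_eq_cube power2_eq_square algebra_simps)
      then show "(?u + 2 * cross i X y) ^ 4 \<le> ?u ^ 4 + 8 * ?u ^ 3 * cross i X y + (32 * ?u\<^sup>2 + 48 * ?s * b) * (cross i X y)\<^sup>2"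
        using p4 unfolding p_def by (simp add: algebra_simps)
    qed
    also have "\<dots> = ?u ^ 4 + (32 * ?u\<^sup>2 + 48 * ?s * b) * (\<integral>y. (cross i X y)\<^sup>2 \<partial>Q)"
      using cross_mean[of i X] bmeas_integrable[OF bmeas_cross] bmeas_integrable[OF bmeas_power[OF bmeas_cross]]
      by (simp add: prob_space)
    also have "\<dots> \<le> ?u ^ 4 + (32 * ?u\<^sup>2 + 48 * ?s * b) * (F * ?s)"
      using normsq_nonneg[of i X] b_nonneg by (intro add_left_mono mult_left_mono cross_sq) auto
    also have "\<dots> \<le> (1 + 1 / real n) * ?u ^ 4 + (256 * real n * F\<^sup>2 + 48 * F * b) * ?s\<^sup>2"
    proof -
      \<comment> \<open>Young's inequality for the mixed term 32 F u^2 s, with weight 1/n on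
        u^4.\<close>
      have "0 \<le> (?u\<^sup>2 - 16 * real n * F * ?s)\<^sup>2 / n" by simp
      also have "\<dots> = ?u ^ 4 / n - 32 * ?u\<^sup>2 * F * ?s + 256 * real n * F\<^sup>2 * ?s\<^sup>2"
        using n by (simp add: field_simps power4_eq_xxxx power2_eq_square)
      finally show ?thesis by (simp add: algebra_simps power2_eq_square)
    qed
    finally show "(\<integral>y. (offdiag (Suc i) (X(Suc i := y))) ^ 4 \<partial>Q) \<le>
      (1 + 1 / real n) * ?u ^ 4 + (256 * real n * F\<^sup>2 + 48 * F * b) * ?s\<^sup>2" .
  qed (intro bmeas_stats)+
  also have "\<dots> = (1 + 1 / real n) * (\<integral>X. (offdiag i X) ^ 4 \<partial>PS i) +
    (256 * real n * F\<^sup>2 + 48 * F * b) * (\<integral>X. (normsq i X)\<^sup>2 \<partial>PS i)"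
    using integrable_PS[OF bmeas_power[OF bmeas_normsq]] integrable_PS[OF bmeas_power[OF bmeas_offdiag]]
    by simp
  finally show ?thesis .
qed

lemma offdiag_fourth_moment:
  assumes n: "n > 0"
  shows "(\<integral>X. (offdiag n X) ^ 4 \<partial>PS n) \<le>
    3 * real n * (256 * real n * F\<^sup>2 + 48 * F * b) * (2 * (real n)\<^sup>2 * H\<^sup>2 + 2 * real n * b * H + 4 * F * (real n)\<^sup>2 * H)"
    (is "_ \<le> 3 * real n * ?c * ?B")
proof -
  have c: "0 \<le> ?c" using F_nonneg b_nonneg by simp
  have B: "0 \<le> ?B" using F_nonneg b_nonneg H_nonneg by simp
  \<comment> \<open>Each step's source term is enlarged by the current power of 1 + 1/n, so the
    solution of the recursion is i times that power instead of a geometric sum.\<close>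
  have *: "(\<integral>X. (offdiag i X) ^ 4 \<partial>PS i) \<le> real i * (1 + 1 / n) ^ i * (?c * ?B)" if "i \<le> n" for i
    using that
  proof (induction i)
    case 0
    then show ?case by (simp add: offdiag_def normsq_def part_def diag_def)
  next
    case (Suc i)
    have "(\<integral>X. (normsq i X)\<^sup>2 \<partial>PS i) \<le> 2 * (real i)\<^sup>2 * H\<^sup>2 + 2 * real i * b * H + 4 * F * (real i)\<^sup>2 * H"
      by (rule normsq_sq_moment)
    also have "\<dots> \<le> ?B"
      using Suc.prems F_nonneg b_nonneg H_nonneg
      by (intro add_mono mult_right_mono mult_left_mono power_mono) auto
    finally have s: "(\<integral>X. (normsq i X)\<^sup>2 \<partial>PS i) \<le> ?B" .
    have "(\<integral>X. (offdiag (Suc i) X) ^ 4 \<partial>PS (Suc i))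
       \<le> (1 + 1 / real n) * (real i * (1 + 1 / n) ^ i * (?c * ?B)) + ?c * ?B"
      using Suc.IH Suc.prems s c
      by (intro order_trans[OF offdiag_fourth_step[OF n]] add_mono mult_left_mono) auto
    also have "\<dots> \<le> (1 + 1 / real n) * (real i * (1 + 1 / n) ^ i * (?c * ?B)) + (1 + 1 / n) ^ Suc i * (?c * ?B)"
      using c B mult_right_mono[of 1 "(1 + 1 / real n) ^ Suc i" "?c * ?B"] one_le_power[of "1 + 1 / real n" "Suc i"]
      by simp
    also have "\<dots> = real (Suc i) * (1 + 1 / n) ^ Suc i * (?c * ?B)"
      unfolding power_Suc of_nat_Suc by algebra
    finally show ?case .
  qed
  have "(1 + 1 / real n) ^ n \<le> exp (1 / real n) ^ n"
    by (intro power_mono) (auto simp: exp_ge_add_one_self)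
  also have "\<dots> = exp 1" using n by (simp flip: exp_of_nat_mult)
  also have "\<dots> \<le> 3" by (rule exp_le)
  finally have e: "(1 + 1 / real n) ^ n \<le> 3" .
  have "(\<integral>X. (offdiag n X) ^ 4 \<partial>PS n) \<le> real n * (1 + 1 / n) ^ n * (?c * ?B)" using * by simp
  also have "\<dots> \<le> real n * 3 * (?c * ?B)"
    using c B e by (intro mult_right_mono mult_left_mono) auto
  finally show ?thesis by (simp only: mult_ac)
qed

end

subsection \<open>Moment determinacy and Parseval identity\<close>

lemma power_le_exp_mult:
  fixes x \<delta> :: real
  assumes "0 < \<delta>"
  shows "\<bar>x\<bar> ^ n \<le> fact n / \<delta> ^ n * exp (\<delta> * \<bar>x\<bar>)"
proof -
  have "(\<delta> * \<bar>x\<bar>) ^ n /\<^sub>R fact n \<le> exp (\<delta> * \<bar>x\<bar>)"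
    using assms sum_le_suminf[OF summable_exp_generic, of "{n}" "\<delta> * \<bar>x\<bar>"] by (simp add: exp_def)
  then show ?thesis using assms by (simp add: field_simps power_mult_distrib)
qed

text \<open>The exponential moment makes the transform expandable in a power series around every
  point, on an interval of fixed length. All derivatives vanish at 0, and repeated re-expansion
  carries this along the line. Each re-expansion needs all derivatives at the new centre, so the
  claim is propagated for all x^n g at once.\<close>

lemma zero_moments_imp_zero_Fourier:
  fixes g :: "real \<Rightarrow> real"
  assumes [measurable]: "g \<in> borel_measurable borel" and \<delta>: "0 < \<delta>"
    and int: "integrable lborel (\<lambda>x. g x * exp (\<delta> * \<bar>x\<bar>))"
    and moments: "\<And>n. (\<integral>x. g x * x ^ n \<partial>lborel) = 0"
  shows "(CLINT x|lborel. of_real (g x) * iexp (t * x)) = 0"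
proof -
  \<comment> \<open>One half of \<delta> pays for the power of x, the other half dominates the
    partial sums of the exponential series.\<close>
  define \<epsilon> where "\<epsilon> = \<delta> / 2"
  have \<epsilon>: "0 < \<epsilon>" using \<delta> by (simp add: \<epsilon>_def)
  have int2: "integrable lborel (\<lambda>x. g x * x ^ n * exp (\<epsilon> * \<bar>x\<bar>))" for n
  proof (rule Bochner_Integration.integrable_bound[OF integrable_mult_right[OF int, of "fact n / \<epsilon> ^ n"]])
    show "AE x in lborel. norm (g x * x ^ n * exp (\<epsilon> * \<bar>x\<bar>))
        \<le> norm (fact n / \<epsilon> ^ n * (g x * exp (\<delta> * \<bar>x\<bar>)))"
    proof (rule AE_I2)
      fix x :: real
      have "\<bar>x\<bar> ^ n * exp (\<epsilon> * \<bar>x\<bar>) \<le> (fact n / \<epsilon> ^ n * exp (\<epsilon> * \<bar>x\<bar>)) * exp (\<epsilon> * \<bar>x\<bar>)"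
        by (intro mult_right_mono power_le_exp_mult \<epsilon>) auto
      also have "\<dots> = fact n / \<epsilon> ^ n * exp (\<delta> * \<bar>x\<bar>)"
        by (simp add: \<epsilon>_def mult.assoc flip: exp_add)
      finally have "\<bar>g x\<bar> * (\<bar>x\<bar> ^ n * exp (\<epsilon> * \<bar>x\<bar>)) \<le> \<bar>g x\<bar> * (fact n / \<epsilon> ^ n * exp (\<delta> * \<bar>x\<bar>))"
        by (rule mult_left_mono) auto
      then show "norm (g x * x ^ n * exp (\<epsilon> * \<bar>x\<bar>)) \<le> norm (fact n / \<epsilon> ^ n * (g x * exp (\<delta> * \<bar>x\<bar>)))"
        using \<epsilon> by (simp add: abs_mult power_abs mult_ac)
    qed
  qed measurable
  have int3: "integrable lborel (\<lambda>x. complex_of_real (g x * x ^ n) * iexp (t * x))" for n t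
  proof (rule Bochner_Integration.integrable_bound[OF int2[of n]])
    show "AE x in lborel. norm (complex_of_real (g x * x ^ n) * iexp (t * x))
        \<le> norm (g x * x ^ n * exp (\<epsilon> * \<bar>x\<bar>))"
    proof (rule AE_I2)
      fix x :: real
      have "\<bar>g x * x ^ n\<bar> * 1 \<le> \<bar>g x * x ^ n\<bar> * exp (\<epsilon> * \<bar>x\<bar>)"
        using \<epsilon> by (intro mult_left_mono) auto
      then show "norm (complex_of_real (g x * x ^ n) * iexp (t * x)) \<le> norm (g x * x ^ n * exp (\<epsilon> * \<bar>x\<bar>))"
        by (simp add: norm_mult abs_mult norm_power power_abs)
    qed
  qed measurable
  have step: "(CLINT x|lborel. of_real (g x * x ^ n) * iexp ((t + s) * x)) = 0"
    if zero: "\<And>n. (CLINT x|lborel. of_real (g x * x ^ n) * iexp (t * x)) = 0" and s: "\<bar>s\<bar> \<le> \<epsilon>" for s t n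
  proof -
    let ?T = "\<lambda>m x. (\<i> * of_real (s * x)) ^ m /\<^sub>R fact m"
    let ?S = "\<lambda>N x. complex_of_real (g x * x ^ n) * iexp (t * x) * (\<Sum>m<N. ?T m x)"
    have "(\<lambda>N. CLINT x|lborel. ?S N x) \<longlonglongrightarrow> (CLINT x|lborel. of_real (g x * x ^ n) * iexp ((t + s) * x))"
    proof (rule integral_dominated_convergence[OF _ _ int2[of n, THEN integrable_abs]])
      show "AE x in lborel. (\<lambda>N. ?S N x) \<longlonglongrightarrow> of_real (g x * x ^ n) * iexp ((t + s) * x)"
      proof (rule AE_I2)
        fix x :: real
        have "(\<lambda>N. \<Sum>m<N. ?T m x) \<longlonglongrightarrow> exp (\<i> * of_real (s * x))"
          using exp_converges[of "\<i> * of_real (s * x)"] by (simp add: sums_def)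
        then have "(\<lambda>N. ?S N x) \<longlonglongrightarrow> of_real (g x * x ^ n) * iexp (t * x) * exp (\<i> * of_real (s * x))"
          by (intro tendsto_intros)
        then show "(\<lambda>N. ?S N x) \<longlonglongrightarrow> of_real (g x * x ^ n) * iexp ((t + s) * x)"
          by (simp add: algebra_simps exp_add)
      qed
      show "AE x in lborel. norm (?S N x) \<le> \<bar>g x * x ^ n * exp (\<epsilon> * \<bar>x\<bar>)\<bar>" for N
      proof (rule AE_I2)
        fix x :: real
        have "norm (\<Sum>m<N. ?T m x) \<le> (\<Sum>m<N. norm (?T m x))" by (rule norm_sum)
        also have "\<dots> = (\<Sum>m<N. \<bar>s * x\<bar> ^ m /\<^sub>R fact m)"
          by (simp add: norm_mult norm_power abs_mult)
        also have "\<dots> \<le> exp \<bar>s * x\<bar>"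
          unfolding exp_def by (intro sum_le_suminf summable_exp_generic) auto
        also have "\<dots> \<le> exp (\<epsilon> * \<bar>x\<bar>)"
          using s by (auto simp: abs_mult intro!: mult_right_mono)
        finally show "norm (?S N x) \<le> \<bar>g x * x ^ n * exp (\<epsilon> * \<bar>x\<bar>)\<bar>"
          by (simp add: norm_mult abs_mult norm_power power_abs mult_left_mono)
      qed
    qed measurable
    moreover have "(CLINT x|lborel. ?S N x) = 0" for N
    proof -
      have eq: "?S N x = (\<Sum>m<N. ((\<i> * of_real s) ^ m /\<^sub>R fact m) * (of_real (g x * x ^ (n + m)) * iexp (t * x)))" for x
        by (simp add: sum_distrib_left sum_distrib_right power_mult_distrib power_add scaleR_conv_of_real mult_ac)
      show ?thesis unfolding eq
        by (subst Bochner_Integration.integral_sum) (use int3 zero in auto)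
    qed
    ultimately show ?thesis by (simp add: LIMSEQ_const_iff)
  qed
  have "\<forall>t. \<bar>t\<bar> \<le> real k * \<epsilon> \<longrightarrow> (\<forall>n. (CLINT x|lborel. of_real (g x * x ^ n) * iexp (t * x)) = 0)" for k
  proof (induction k)
    case 0
    then show ?case using moments by (simp del: of_real_mult add: integral_complex_of_real)
  next
    case (Suc k)
    show ?case
    proof (intro allI impI)
      fix t :: real and n assume t: "\<bar>t\<bar> \<le> real (Suc k) * \<epsilon>"
      \<comment> \<open>The point nearest to \<open>t\<close> in the interval already
        covered.\<close>
      define t0 where "t0 = max (- (real k * \<epsilon>)) (min t (real k * \<epsilon>))"
      have "0 \<le> real k * \<epsilon>" using \<epsilon> by simp
      then have "\<bar>t0\<bar> \<le> real k * \<epsilon>" "\<bar>t - t0\<bar> \<le> \<epsilon>"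
        using t \<epsilon> unfolding t0_def by (auto simp: algebra_simps abs_if split: if_splits)
      then have "(CLINT x|lborel. of_real (g x * x ^ n) * iexp ((t0 + (t - t0)) * x)) = 0"
        using Suc.IH by (intro step) auto
      then show "(CLINT x|lborel. of_real (g x * x ^ n) * iexp (t * x)) = 0" by simp
    qed
  qed
  moreover obtain k :: nat where "\<bar>t\<bar> / \<epsilon> \<le> real k" using real_arch_simple by blast
  then have "\<bar>t\<bar> \<le> real k * \<epsilon>" using \<epsilon> by (simp add: field_simps)
  ultimately have "(CLINT x|lborel. of_real (g x * x ^ 0) * iexp (t * x)) = 0" by blast
  then show ?thesis by simp
qed

text \<open>Uniqueness of characteristic functions speaks of probability measures, so the positive
  and negative parts are compared. They have equal mass by the case t = 0 and are normalised by
  it.\<close>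

lemma zero_Fourier_imp_AE_zero:
  fixes g :: "real \<Rightarrow> real"
  assumes int: "integrable lborel g"
    and fourier: "\<And>t. (CLINT x|lborel. of_real (g x) * iexp (t * x)) = 0"
  shows "AE x in lborel. g x = 0"
proof -
  have [measurable]: "g \<in> borel_measurable borel" using int by auto
  define p where "p = (\<lambda>x. max (g x) 0)"
  define q where "q = (\<lambda>x. max (- g x) 0)"
  have g: "g x = p x - q x" and pq: "0 \<le> p x" "0 \<le> q x" "\<bar>p x\<bar> \<le> \<bar>g x\<bar>" "\<bar>q x\<bar> \<le> \<bar>g x\<bar>" for x
    by (auto simp: p_def q_def)
  have [measurable]: "p \<in> borel_measurable borel" "q \<in> borel_measurable borel"
    unfolding p_def q_def by measurable
  have ip: "integrable lborel p" and iq: "integrable lborel q"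
    using pq by (auto intro!: Bochner_Integration.integrable_bound[OF int])
  define m where "m = (\<integral>x. p x \<partial>lborel)"
  have "(\<integral>x. g x \<partial>lborel) = 0"
    using fourier[of 0] by (simp add: integral_complex_of_real)
  then have mq: "(\<integral>x. q x \<partial>lborel) = m"
    unfolding g m_def using ip iq by simp
  show ?thesis
  proof (cases "m = 0")
    \<comment> \<open>Zero mass cannot be normalised, but then both parts vanish almost
      everywhere.\<close>
    case True
    then have "AE x in lborel. p x = 0" "AE x in lborel. q x = 0"
      using integral_nonneg_eq_0_iff_AE[OF ip] integral_nonneg_eq_0_iff_AE[OF iq] pq mq
      by (auto simp: m_def)
    then show ?thesis by eventually_elim (simp add: g)
  next
    case False
    have "0 \<le> m" unfolding m_def using pq by simp
    then have m: "0 < m" using False by simp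
    define D where "D = (\<lambda>r :: real \<Rightarrow> real. density lborel (\<lambda>x. ennreal (r x / m)))"
    have char: "char (D r) t = (CLINT x|lborel. of_real (r x) * iexp (t * x)) / m"
      if [measurable]: "r \<in> borel_measurable borel" and "\<And>x. 0 \<le> r x" for r t
    proof -
      have "char (D r) t = (CLINT x|lborel. (r x / m) *\<^sub>R iexp (t * x))"
        unfolding char_def D_def using that m by (subst integral_density) auto
      also have "\<dots> = (CLINT x|lborel. (of_real (r x) * iexp (t * x)) / of_real m)"
        by (intro Bochner_Integration.integral_cong) (auto simp: scaleR_conv_of_real)
      finally show ?thesis by simp
    qed
    have rd: "real_distribution (D r)"
      if [measurable]: "r \<in> borel_measurable borel" and "\<And>x. 0 \<le> r x" "integrable lborel r" "(\<integral>x. r x \<partial>lborel) = m" for r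
    proof -
      have "(\<integral>\<^sup>+x. ennreal (r x / m) \<partial>lborel) = ennreal (\<integral>x. r x / m \<partial>lborel)"
        using that m by (intro nn_integral_eq_integral) auto
      also have "\<dots> = 1" using that m by simp
      finally have "prob_space (D r)"
        unfolding D_def by (intro prob_spaceI) (simp add: emeasure_density)
      then show ?thesis unfolding real_distribution_def real_distribution_axioms_def D_def by simp
    qed
    have "char (D p) t = char (D q) t" for t
    proof -
      have ibd: "integrable lborel (\<lambda>x. complex_of_real (r x) * iexp (t * x))"
        if "integrable lborel r" for r
        by (rule Bochner_Integration.integrable_bound[OF that]) (use that in \<open>auto simp: norm_mult\<close>)
      have "(CLINT x|lborel. of_real (g x) * iexp (t * x))
          = (CLINT x|lborel. of_real (p x) * iexp (t * x) - of_real (q x) * iexp (t * x))"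
        by (simp add: g algebra_simps)
      also have "\<dots> = (CLINT x|lborel. of_real (p x) * iexp (t * x)) - (CLINT x|lborel. of_real (q x) * iexp (t * x))"
        by (intro Bochner_Integration.integral_diff ibd ip iq)
      finally show ?thesis using fourier[of t] pq by (simp add: char)
    qed
    then have "D p = D q"
      by (intro Levy_uniqueness rd ip iq mq ext) (auto simp: pq m_def)
    then have "AE x in lborel. ennreal (p x / m) = ennreal (q x / m)"
      unfolding D_def by (subst (asm) sigma_finite_measure.density_unique_iff[OF sigma_finite_lborel]) auto
    then show ?thesis
      by eventually_elim (use m pq g in \<open>simp add: divide_right_mono ennreal_eq_0_iff\<close>)
  qed
qed

section \<open>Orthonormal systems and Parseval's identity\<close>

lemma Cauchy_Schwarz_integral:
  fixes g h :: "'a \<Rightarrow> real"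
  assumes [measurable]: "g \<in> borel_measurable M" "h \<in> borel_measurable M"
    and g: "integrable M (\<lambda>x. (g x)\<^sup>2)" and h: "integrable M (\<lambda>x. (h x)\<^sup>2)"
  shows integrable_mult_L2: "integrable M (\<lambda>x. g x * h x)"
    and "(\<integral>x. g x * h x \<partial>M)\<^sup>2 \<le> (\<integral>x. (g x)\<^sup>2 \<partial>M) * (\<integral>x. (h x)\<^sup>2 \<partial>M)"
proof -
  show int: "integrable M (\<lambda>x. g x * h x)"
  proof (rule Bochner_Integration.integrable_bound[OF Bochner_Integration.integrable_add[OF g h]])
    have "\<bar>a * b\<bar> \<le> a\<^sup>2 + b\<^sup>2" for a b :: real
      using sum_squares_bound[of "\<bar>a\<bar>" "\<bar>b\<bar>"] mult_nonneg_nonneg[OF abs_ge_zero abs_ge_zero, of a b]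
      unfolding abs_mult power2_abs by linarith
    then show "AE x in M. norm (g x * h x) \<le> norm ((g x)\<^sup>2 + (h x)\<^sup>2)" by simp
  qed measurable
  let ?A = "\<integral>x. (g x)\<^sup>2 \<partial>M" and ?B = "\<integral>x. g x * h x \<partial>M" and ?C = "\<integral>x. (h x)\<^sup>2 \<partial>M"
  have q: "0 \<le> ?A - 2 * s * ?B + s\<^sup>2 * ?C" for s
  proof -
    have "0 \<le> (\<integral>x. (g x - s * h x)\<^sup>2 \<partial>M)" by simp
    also have "\<dots> = (\<integral>x. (g x)\<^sup>2 - 2 * s * (g x * h x) + s\<^sup>2 * (h x)\<^sup>2 \<partial>M)"
      by (simp add: power2_diff power_mult_distrib algebra_simps)
    finally show ?thesis using g h int by simp
  qed
  show "?B\<^sup>2 \<le> ?A * ?C"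
  proof (cases "?C = 0")
    case True
    have "?B = 0"
    proof (rule ccontr)
      assume "?B \<noteq> 0"
      then show False using q[of "(?A + 1) / (2 * ?B)"] True by simp
    qed
    then show ?thesis using True by simp
  next
    case False
    then have "0 < ?C" by (simp add: order.not_eq_order_implies_strict)
    then show ?thesis using q[of "?B / ?C"] by (simp add: field_simps power2_eq_square)
  qed
qed

lemma orthonormal_sum_square:
  fixes e :: "'i \<Rightarrow> 'a \<Rightarrow> real"
  assumes "\<And>i j. integrable M (\<lambda>x. e i x * e j x)"
    and "\<And>i j. (\<integral>x. e i x * e j x \<partial>M) = of_bool (i = j)"
    and "finite I"
  shows "integrable M (\<lambda>x. (\<Sum>i\<in>I. u i * e i x)\<^sup>2)"
    and "(\<integral>x. (\<Sum>i\<in>I. u i * e i x)\<^sup>2 \<partial>M) = (\<Sum>i\<in>I. (u i)\<^sup>2)"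
proof -
  have eq: "(\<Sum>i\<in>I. u i * e i x)\<^sup>2 = (\<Sum>i\<in>I. \<Sum>j\<in>I. u i * u j * (e i x * e j x))" for x
    by (simp add: power2_eq_square sum_product mult_ac)
  show "integrable M (\<lambda>x. (\<Sum>i\<in>I. u i * e i x)\<^sup>2)"
    unfolding eq using assms by (intro Bochner_Integration.integrable_sum integrable_mult_right)
  have "(\<integral>x. (\<Sum>i\<in>I. u i * e i x)\<^sup>2 \<partial>M) = (\<Sum>i\<in>I. \<Sum>j\<in>I. u i * u j * of_bool (i = j))"
    unfolding eq using assms by (simp add: Bochner_Integration.integral_sum)
  also have "\<dots> = (\<Sum>i\<in>I. (u i)\<^sup>2)"
    using assms(3) by (intro sum.cong) (auto simp: power2_eq_square of_bool_def if_distrib sum.delta cong: if_cong)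
  finally show "(\<integral>x. (\<Sum>i\<in>I. u i * e i x)\<^sup>2 \<partial>M) = (\<Sum>i\<in>I. (u i)\<^sup>2)" .
qed

text \<open>With u the true coefficients this gives the residual norms for Parseval; with the
  empirical coefficients it is the decomposition of the loss into squared coefficient error and
  squared bias.\<close>

lemma orthonormal_residual_square:
  fixes e :: "'i \<Rightarrow> 'a \<Rightarrow> real"
  assumes [measurable]: "\<And>i. e i \<in> borel_measurable M" "f \<in> borel_measurable M"
    and f2: "integrable M (\<lambda>x. (f x)\<^sup>2)"
    and int: "\<And>i j. integrable M (\<lambda>x. e i x * e j x)"
    and orth: "\<And>i j. (\<integral>x. e i x * e j x \<partial>M) = of_bool (i = j)"
    and fin: "finite I"
  defines "a \<equiv> \<lambda>i. \<integral>x. f x * e i x \<partial>M"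
  shows "integrable M (\<lambda>x. ((\<Sum>i\<in>I. u i * e i x) - f x)\<^sup>2)"
    and "(\<integral>x. ((\<Sum>i\<in>I. u i * e i x) - f x)\<^sup>2 \<partial>M) =
      (\<Sum>i\<in>I. (u i - a i)\<^sup>2) + (\<integral>x. (f x)\<^sup>2 \<partial>M) - (\<Sum>i\<in>I. (a i)\<^sup>2)"
proof -
  note s = orthonormal_sum_square[OF int orth fin, of u]
  have fe: "integrable M (\<lambda>x. f x * e i x)" for i
    using int[of i i] by (intro integrable_mult_L2 f2) (auto simp: power2_eq_square)
  have eq: "((\<Sum>i\<in>I. u i * e i x) - f x)\<^sup>2 = (\<Sum>i\<in>I. u i * e i x)\<^sup>2 - 2 * (\<Sum>i\<in>I. u i * (f x * e i x)) + (f x)\<^sup>2" for x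
    by (simp add: power2_diff sum_distrib_left sum_distrib_right mult_ac)
  have fs: "integrable M (\<lambda>x. \<Sum>i\<in>I. u i * (f x * e i x))"
    using fe by (intro Bochner_Integration.integrable_sum integrable_mult_right)
  show "integrable M (\<lambda>x. ((\<Sum>i\<in>I. u i * e i x) - f x)\<^sup>2)"
    unfolding eq using s fs f2 by simp
  have "(\<integral>x. ((\<Sum>i\<in>I. u i * e i x) - f x)\<^sup>2 \<partial>M)
      = (\<Sum>i\<in>I. (u i)\<^sup>2) - 2 * (\<Sum>i\<in>I. u i * a i) + (\<integral>x. (f x)\<^sup>2 \<partial>M)"
    unfolding eq using s fs f2 fe by (simp add: Bochner_Integration.integral_sum a_def)
  then show "(\<integral>x. ((\<Sum>i\<in>I. u i * e i x) - f x)\<^sup>2 \<partial>M) =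
      (\<Sum>i\<in>I. (u i - a i)\<^sup>2) + (\<integral>x. (f x)\<^sup>2 \<partial>M) - (\<Sum>i\<in>I. (a i)\<^sup>2)"
    by (simp add: power2_diff sum.distrib sum_subtractf sum_distrib_left mult_ac)
qed

text \<open>Completeness is needed only for this one sequence of residuals, so the Riesz--Fischer
  argument is run on them directly: a subsequence converges almost everywhere, and its limit is
  orthogonal to every basis function.\<close>

lemma total_orthonormal_Parseval:
  fixes e :: "nat \<Rightarrow> 'a \<Rightarrow> real"
  assumes em[measurable]: "\<And>i. e i \<in> borel_measurable M" and fm[measurable]: "f \<in> borel_measurable M"
    and f2: "integrable M (\<lambda>x. (f x)\<^sup>2)"
    and int: "\<And>i j. integrable M (\<lambda>x. e i x * e j x)"
    and orth: "\<And>i j. (\<integral>x. e i x * e j x \<partial>M) = of_bool (i = j)"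
    and supp: "\<And>x. x \<notin> A \<Longrightarrow> f x = 0" "\<And>i x. x \<notin> A \<Longrightarrow> e i x = 0"
    and total: "\<And>g. g \<in> borel_measurable M \<Longrightarrow> integrable M (\<lambda>x. (g x)\<^sup>2) \<Longrightarrow> (\<And>x. x \<notin> A \<Longrightarrow> g x = 0) \<Longrightarrow>
       (\<And>i. (\<integral>x. g x * e i x \<partial>M) = 0) \<Longrightarrow> AE x in M. g x = 0"
  shows "(\<lambda>i. (\<integral>x. f x * e i x \<partial>M)\<^sup>2) sums (\<integral>x. (f x)\<^sup>2 \<partial>M)"
proof -
  define a where "a i = (\<integral>x. f x * e i x \<partial>M)" for i
  define R where "R n x = (\<Sum>i<n. a i * e i x) - f x" for n x
  have [measurable]: "R n \<in> borel_measurable M" for n unfolding R_def by measurable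
  have e2: "integrable M (\<lambda>x. (e i x)\<^sup>2)" "(\<integral>x. (e i x)\<^sup>2 \<partial>M) = 1" for i
    using int[of i i] orth[of i i] by (auto simp: power2_eq_square)
  have R2: "integrable M (\<lambda>x. (R n x)\<^sup>2)"
    and R2_eq: "(\<integral>x. (R n x)\<^sup>2 \<partial>M) = (\<integral>x. (f x)\<^sup>2 \<partial>M) - (\<Sum>i<n. (a i)\<^sup>2)" for n
    using orthonormal_residual_square[OF em fm f2 int orth, of "{..<n}" a] unfolding R_def a_def by simp_all
  have Bessel: "(\<Sum>i<n. (a i)\<^sup>2) \<le> (\<integral>x. (f x)\<^sup>2 \<partial>M)" for n
  proof -
    have "0 \<le> (\<integral>x. (R n x)\<^sup>2 \<partial>M)" by simp
    then show ?thesis unfolding R2_eq by simp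
  qed
  have summ: "summable (\<lambda>i. (a i)\<^sup>2)"
    by (rule summableI_nonneg_bounded[OF _ Bessel]) simp
  define tail where "tail n = (\<Sum>i. (a (i + n))\<^sup>2)" for n
  have tail_lim: "tail \<longlonglongrightarrow> 0"
    unfolding tail_def using suminf_exist_split2[OF summ] by simp
  have diff2: "integrable M (\<lambda>x. (R m x - R n x)\<^sup>2)" "(\<integral>x. (R m x - R n x)\<^sup>2 \<partial>M) \<le> tail m"
    if "m \<le> n" for m n
  proof -
    have "R n x - R m x = (\<Sum>i\<in>{m..<n}. a i * e i x)" for x
      using sum_diff_nat_ivl[of 0 m n "\<lambda>i. a i * e i x"] that unfolding R_def by (simp add: atLeast0LessThan)
    then have eq: "(R m x - R n x)\<^sup>2 = (\<Sum>i\<in>{m..<n}. a i * e i x)\<^sup>2" for x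
      by (metis power2_commute)
    show "integrable M (\<lambda>x. (R m x - R n x)\<^sup>2)"
      unfolding eq by (intro orthonormal_sum_square int orth) auto
    have "(\<integral>x. (R m x - R n x)\<^sup>2 \<partial>M) = (\<Sum>i\<in>{m..<n}. (a i)\<^sup>2)"
      unfolding eq by (intro orthonormal_sum_square int orth) auto
    also have "\<dots> = (\<Sum>i<n - m. (a (i + m))\<^sup>2)"
      using that sum.shift_bounds_nat_ivl[of "\<lambda>i. (a i)\<^sup>2" 0 m "n - m"] by (simp add: atLeast0LessThan)
    also have "\<dots> \<le> tail m"
      unfolding tail_def by (intro sum_le_suminf summable_ignore_initial_segment summ) auto
    finally show "(\<integral>x. (R m x - R n x)\<^sup>2 \<partial>M) \<le> tail m" .
  qed
  \<comment> \<open>The rate 1/8 is chosen so that, after the weight 2^i used below, the summable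
    (1/4)^i is left.\<close>
  have "\<exists>N0. \<forall>n\<ge>N0. tail n < (1/8) ^ i" for i :: nat
    using order_tendstoD(2)[OF tail_lim, of "(1/8)^i"] by (simp add: eventually_sequentially)
  then obtain N0 where N0: "\<And>i n. n \<ge> N0 i \<Longrightarrow> tail n < (1/8) ^ i" by metis
  define N where "N i = i + (\<Sum>l\<le>i. N0 l)" for i
  have N_ge: "i \<le> N i" and N_mono: "N i \<le> N (Suc i)" for i unfolding N_def by auto
  have "N0 i \<le> N i" for i unfolding N_def by (intro trans_le_add2 member_le_sum) auto
  then have tailN: "tail (N i) < (1/8) ^ i" for i using N0 by blast
  define \<Delta> where "\<Delta> i x = R (N i) x - R (N (Suc i)) x" for i x
  have [measurable]: "\<Delta> i \<in> borel_measurable M" for i unfolding \<Delta>_def by measurable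
  have "(\<integral>\<^sup>+x. (\<Sum>i. ennreal (2 ^ i * (\<Delta> i x)\<^sup>2)) \<partial>M) = (\<Sum>i. \<integral>\<^sup>+x. ennreal (2 ^ i * (\<Delta> i x)\<^sup>2) \<partial>M)"
    by (rule nn_integral_suminf) measurable
  also have "\<dots> \<le> (\<Sum>i. ennreal ((1/4) ^ i))"
  proof (intro suminf_le)
    fix i
    have "(\<integral>\<^sup>+x. ennreal (2 ^ i * (\<Delta> i x)\<^sup>2) \<partial>M) = ennreal (\<integral>x. 2 ^ i * (\<Delta> i x)\<^sup>2 \<partial>M)"
      unfolding \<Delta>_def using diff2[OF N_mono] by (intro nn_integral_eq_integral) auto
    also have "\<dots> \<le> ennreal (2 ^ i * (1/8) ^ i)"
      using diff2[OF N_mono, of i] tailN[of i] unfolding \<Delta>_def by (intro ennreal_leI) auto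
    also have "\<dots> = ennreal ((1/4) ^ i)" by (simp flip: power_mult_distrib)
    finally show "(\<integral>\<^sup>+x. ennreal (2 ^ i * (\<Delta> i x)\<^sup>2) \<partial>M) \<le> ennreal ((1/4) ^ i)" .
  qed auto
  also have "\<dots> < \<infinity>"
    by (subst suminf_ennreal2) (auto simp: summable_geometric)
  finally have "AE x in M. (\<Sum>i. ennreal (2 ^ i * (\<Delta> i x)\<^sup>2)) \<noteq> \<infinity>"
    by (intro nn_integral_PInf_AE) auto
  then have conv: "AE x in M. convergent (\<lambda>i. R (N i) x)"
  proof eventually_elim
    case (elim x)
    then have "summable (\<lambda>i. 2 ^ i * (\<Delta> i x)\<^sup>2)"
      by (intro summable_suminf_not_top) auto
    then have s: "summable (\<lambda>i. 2 ^ i * (\<Delta> i x)\<^sup>2 + (1/2) ^ i)"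
      using summable_geometric[of "1/2::real"] by (intro summable_add) auto
    have "summable (\<lambda>i. \<Delta> i x)"
    proof (rule summable_comparison_test'[OF s])
      fix i
      \<comment> \<open>Splitting 1 as sqrt 2^i times its inverse before using 2 a b <= a^2 + b^2
        turns summability of the weighted squares into absolute convergence of the
        increments.\<close>
      have q: "(sqrt 2 ^ i)\<^sup>2 = (2::real) ^ i"
        by (metis power_even_eq power_mult real_sqrt_pow2 zero_le_numeral)
      have "2 * \<bar>\<Delta> i x\<bar> = 2 * (sqrt 2 ^ i * \<bar>\<Delta> i x\<bar>) * (1 / sqrt 2 ^ i)" by simp
      also have "\<dots> \<le> (sqrt 2 ^ i * \<bar>\<Delta> i x\<bar>)\<^sup>2 + (1 / sqrt 2 ^ i)\<^sup>2"
        by (rule sum_squares_bound)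
      also have "\<dots> = 2 ^ i * (\<Delta> i x)\<^sup>2 + (1/2) ^ i"
        using q by (simp add: power_mult_distrib power_divide power_one_over mult.commute)
      finally show "norm (\<Delta> i x) \<le> 2 ^ i * (\<Delta> i x)\<^sup>2 + (1/2) ^ i" by simp
    qed
    then have "(\<lambda>n. \<Sum>i<n. \<Delta> i x) \<longlonglongrightarrow> (\<Sum>i. \<Delta> i x)" by (rule summable_LIMSEQ)
    moreover have "(\<Sum>i<n. \<Delta> i x) = R (N 0) x - R (N n) x" for n
      unfolding \<Delta>_def by (induction n) auto
    ultimately have "(\<lambda>n. R (N 0) x - (R (N 0) x - R (N n) x)) \<longlonglongrightarrow> R (N 0) x - (\<Sum>i. \<Delta> i x)"
      by (intro tendsto_diff tendsto_const) simp
    then show "convergent (\<lambda>i. R (N i) x)" by (auto simp: convergent_def)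
  qed
  \<comment> \<open>Where the sequence diverges, on a null set, the value of \<open>lim\<close> is
    irrelevant. Off \<open>A\<close> all residuals are 0, so the limit vanishes there everywhere, as
    \<open>total\<close> demands.\<close>
  define r where "r x = lim (\<lambda>i. R (N i) x)" for x
  have [measurable]: "r \<in> borel_measurable M" unfolding r_def[abs_def] by measurable
  have r_supp: "r x = 0" if "x \<notin> A" for x
    using that supp unfolding r_def R_def by simp
  \<comment> \<open>The Cauchy bound \<open>diff2\<close> between \<open>R m\<close> and later
    members of the subsequence passes to the limit.\<close>
  have Fatou: "(\<integral>\<^sup>+x. ennreal ((R m x - r x)\<^sup>2) \<partial>M) \<le> ennreal (tail m)" for m
  proof -
    have "(\<integral>\<^sup>+x. ennreal ((R m x - r x)\<^sup>2) \<partial>M) = (\<integral>\<^sup>+x. liminf (\<lambda>i. ennreal ((R m x - R (N i) x)\<^sup>2)) \<partial>M)"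
    proof (rule nn_integral_cong_AE, use conv in eventually_elim)
      case (elim x)
      then have "(\<lambda>i. R (N i) x) \<longlonglongrightarrow> r x" unfolding r_def by (simp add: convergent_LIMSEQ_iff)
      then have "(\<lambda>i. ennreal ((R m x - R (N i) x)\<^sup>2)) \<longlonglongrightarrow> ennreal ((R m x - r x)\<^sup>2)"
        by (intro tendsto_intros)
      then show ?case by (rule lim_imp_Liminf[OF trivial_limit_sequentially, symmetric])
    qed
    also have "\<dots> \<le> liminf (\<lambda>i. \<integral>\<^sup>+x. ennreal ((R m x - R (N i) x)\<^sup>2) \<partial>M)"
      by (rule nn_integral_liminf) measurable
    also have "\<dots> \<le> limsup (\<lambda>i. \<integral>\<^sup>+x. ennreal ((R m x - R (N i) x)\<^sup>2) \<partial>M)"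
      by (rule Liminf_le_Limsup) simp
    also have "\<dots> \<le> ennreal (tail m)"
    proof (rule Limsup_bounded, rule eventually_mono[OF eventually_ge_at_top[of m]])
      fix i assume "m \<le> i"
      then have "m \<le> N i" using N_ge[of i] by simp
      then show "(\<integral>\<^sup>+x. ennreal ((R m x - R (N i) x)\<^sup>2) \<partial>M) \<le> ennreal (tail m)"
        using diff2[of m "N i"] by (subst nn_integral_eq_integral) (auto intro: ennreal_leI)
    qed
    finally show ?thesis .
  qed
  have Rr: "integrable M (\<lambda>x. (R m x - r x)\<^sup>2)" for m
    using Fatou[of m] by (intro integrableI_nonneg) (auto intro: le_less_trans)
  have tail_nonneg: "0 \<le> tail m" for m
    unfolding tail_def by (intro suminf_nonneg summable_ignore_initial_segment summ) auto
  have Rr_le: "(\<integral>x. (R m x - r x)\<^sup>2 \<partial>M) \<le> tail m" for m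
    using Fatou[of m] Rr[of m] tail_nonneg[of m] by (subst (asm) nn_integral_eq_integral) (auto simp: ennreal_le_iff)
  have r2: "integrable M (\<lambda>x. (r x)\<^sup>2)"
  proof (rule Bochner_Integration.integrable_bound[OF Bochner_Integration.integrable_add[OF
        integrable_mult_right[OF R2[of 0], of 2] integrable_mult_right[OF Rr[of 0], of 2]]])
    have "(b::real)\<^sup>2 \<le> 2 * c\<^sup>2 + 2 * (c - b)\<^sup>2" for b c
      using zero_le_power2[of "b - 2 * c"] by (simp add: power2_eq_square algebra_simps)
    then show "AE x in M. norm ((r x)\<^sup>2) \<le> norm (2 * (R 0 x)\<^sup>2 + 2 * (R 0 x - r x)\<^sup>2)" by simp
  qed measurable
  have "(\<integral>x. r x * e j x \<partial>M) = 0" for j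
  proof -
    \<comment> \<open>For m > j the residual \<open>R m\<close> is orthogonal to \<open>e j\<close>,
      so up to sign the coefficient of \<open>r\<close> is that of \<open>R m - r\<close>, whose
      norm tends to 0.\<close>
    have "(\<integral>x. r x * e j x \<partial>M)\<^sup>2 \<le> tail m" if "m > j" for m
    proof -
      have fe: "integrable M (\<lambda>x. f x * e i x)" for i
        by (intro integrable_mult_L2 f2 e2) measurable
      have Re_int: "integrable M (\<lambda>x. R m x * e j x)"
        by (intro integrable_mult_L2 R2 e2) measurable
      have re_int: "integrable M (\<lambda>x. r x * e j x)"
        by (intro integrable_mult_L2 r2 e2) measurable
      have "(\<integral>x. R m x * e j x \<partial>M) = (\<integral>x. (\<Sum>i<m. a i * (e i x * e j x)) - f x * e j x \<partial>M)"
        unfolding R_def left_diff_distrib sum_distrib_right mult.assoc ..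
      also have "\<dots> = (\<Sum>i<m. a i * of_bool (i = j)) - a j"
        using int fe by (simp add: Bochner_Integration.integral_sum orth a_def)
      also have "\<dots> = 0" using that by (simp add: of_bool_def if_distrib sum.delta cong: if_cong)
      finally have "(\<integral>x. (R m x - r x) * e j x \<partial>M) = - (\<integral>x. r x * e j x \<partial>M)"
        using Re_int re_int by (simp add: left_diff_distrib)
      then have "(\<integral>x. r x * e j x \<partial>M)\<^sup>2 = (\<integral>x. (R m x - r x) * e j x \<partial>M)\<^sup>2" by simp
      also have "\<dots> \<le> (\<integral>x. (R m x - r x)\<^sup>2 \<partial>M) * (\<integral>x. (e j x)\<^sup>2 \<partial>M)"
        by (intro Cauchy_Schwarz_integral Rr e2) measurable
      finally show ?thesis using Rr_le[of m] e2 by simp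
    qed
    then have "(\<integral>x. r x * e j x \<partial>M)\<^sup>2 \<le> 0"
      by (intro LIMSEQ_le_const[OF tail_lim]) (auto intro!: exI[of _ "Suc j"])
    then show ?thesis by simp
  qed
  then have r0: "AE x in M. r x = 0"
    by (intro total r2 r_supp) auto
  have "(\<integral>x. (f x)\<^sup>2 \<partial>M) - (\<Sum>i<m. (a i)\<^sup>2) \<le> tail m" for m
  proof -
    have "(\<integral>x. (R m x)\<^sup>2 \<partial>M) = (\<integral>x. (R m x - r x)\<^sup>2 \<partial>M)"
      by (rule integral_cong_AE) (use r0 in \<open>auto elim: eventually_mono\<close>)
    then show ?thesis using Rr_le[of m] R2_eq[of m] by simp
  qed
  then have "(\<lambda>m. (\<integral>x. (f x)\<^sup>2 \<partial>M) - (\<Sum>i<m. (a i)\<^sup>2)) \<longlonglongrightarrow> 0"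
    using Bessel by (intro tendsto_sandwich[OF _ _ tendsto_const tail_lim] always_eventually) auto
  then have "(\<lambda>m. (\<integral>x. (f x)\<^sup>2 \<partial>M) - ((\<integral>x. (f x)\<^sup>2 \<partial>M) - (\<Sum>i<m. (a i)\<^sup>2))) \<longlonglongrightarrow> (\<integral>x. (f x)\<^sup>2 \<partial>M) - 0"
    by (intro tendsto_diff tendsto_const)
  then show ?thesis unfolding sums_def a_def by simp
qed

section \<open>Weighted polynomial systems\<close>

lemma poly_le_exp:
  fixes q :: "real poly" and \<delta> :: real
  assumes "0 < \<delta>"
  obtains C where "\<And>x. \<bar>poly q x\<bar> \<le> C * exp (\<delta> * \<bar>x\<bar>)"
proof
  fix x
  have "\<bar>poly q x\<bar> \<le> (\<Sum>i\<le>degree q. \<bar>coeff q i\<bar> * \<bar>x\<bar> ^ i)"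
    unfolding poly_altdef by (rule order_trans[OF sum_abs]) (simp add: abs_mult power_abs)
  also have "\<dots> \<le> (\<Sum>i\<le>degree q. \<bar>coeff q i\<bar> * (fact i / \<delta> ^ i * exp (\<delta> * \<bar>x\<bar>)))"
    by (intro sum_mono mult_left_mono power_le_exp_mult assms) auto
  finally show "\<bar>poly q x\<bar> \<le> (\<Sum>i\<le>degree q. \<bar>coeff q i\<bar> * (fact i / \<delta> ^ i)) * exp (\<delta> * \<bar>x\<bar>)"
    by (simp only: sum_distrib_right mult.assoc)
qed

lemma integrable_mult_poly:
  fixes g :: "real \<Rightarrow> real"
  assumes [measurable]: "g \<in> borel_measurable borel" and \<delta>: "0 < \<delta>"
    and int: "integrable lborel (\<lambda>x. g x * exp (\<delta> * \<bar>x\<bar>))"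
  shows "integrable lborel (\<lambda>x. g x * poly q x)"
proof -
  obtain C where C: "\<And>x. \<bar>poly q x\<bar> \<le> C * exp (\<delta> * \<bar>x\<bar>)" using poly_le_exp[OF \<delta>] by metis
  have [measurable]: "poly q \<in> borel_measurable borel"
    by (intro borel_measurable_continuous_onI continuous_intros)
  show ?thesis
  proof (rule Bochner_Integration.integrable_bound[OF integrable_mult_right[OF int, of C]])
    have "norm (g x * poly q x) \<le> norm (C * (g x * exp (\<delta> * \<bar>x\<bar>)))" for x
    proof -
      have "\<bar>poly q x\<bar> \<le> \<bar>C * exp (\<delta> * \<bar>x\<bar>)\<bar>" using C[of x] by linarith
      then have "\<bar>g x\<bar> * \<bar>poly q x\<bar> \<le> \<bar>g x\<bar> * \<bar>C * exp (\<delta> * \<bar>x\<bar>)\<bar>" by (rule mult_left_mono) simp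
      then show ?thesis by (simp add: abs_mult mult_ac)
    qed
    then show "AE x in lborel. norm (g x * poly q x) \<le> norm (C * (g x * exp (\<delta> * \<bar>x\<bar>)))" by simp
  qed measurable
qed

text \<open>Subtracting a multiple of \<open>p n\<close> lowers the degree. The lemma serves both
  the completeness argument, with \<open>p\<close> the orthogonal polynomials, and Gaussian
  integration by parts, with \<open>p\<close> the monomials.\<close>

lemma linear_zero_on_graded_basis:
  fixes p :: "nat \<Rightarrow> real poly" and L :: "real poly \<Rightarrow> real"
  assumes deg: "\<And>j. degree (p j) = j" and nz: "p 0 \<noteq> 0"
    and add: "\<And>q r. L (q + r) = L q + L r" and smult: "\<And>a q. L (smult a q) = a * L q"
    and zero: "\<And>j. L (p j) = 0"
  shows "L q = 0"
proof -
  have L0: "L 0 = 0" using smult[of 0 0] by simp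
  have p_nz: "p j \<noteq> 0" for j using deg[of j] nz by (cases j) auto
  have "degree q < n \<Longrightarrow> L q = 0" for n q
  proof (induction n arbitrary: q)
    case (Suc n)
    define s where "s = coeff q n / coeff (p n) n"
    define r where "r = q - smult s (p n)"
    have c: "coeff (p n) n \<noteq> 0" using p_nz[of n] deg[of n] leading_coeff_0_iff by metis
    have "degree r \<le> n"
      unfolding r_def using Suc.prems deg[of n] by (intro degree_diff_le order_trans[OF degree_smult_le]) auto
    moreover have "coeff r n = 0" unfolding r_def s_def using c by simp
    ultimately have "r = 0 \<or> degree r < n"
      using leading_coeff_0_iff[of r] by (metis le_neq_implies_less)
    then have "L r = 0" using L0 Suc.IH by auto
    moreover have "q = r + smult s (p n)" unfolding r_def by simp
    ultimately show ?case using add[of r "smult s (p n)"] smult zero by simp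
  qed simp
  then show ?thesis by blast
qed

text \<open>Totality is moment determinacy: if g is orthogonal to the system, then
  \<open>g x * \<omega> x\<close> has an exponential moment by Cauchy-Schwarz and all its moments
  vanish, so it is zero almost everywhere; since \<omega> has no zero on \<open>A\<close>, so is
  g.\<close>

lemma weighted_polynomials_Parseval:
  fixes \<omega> :: "real \<Rightarrow> real" and p :: "nat \<Rightarrow> real poly"
  assumes [measurable]: "\<omega> \<in> borel_measurable borel" and \<delta>: "0 < \<delta>"
    and W: "integrable lborel (\<lambda>x. (\<omega> x)\<^sup>2 * exp (\<delta> * \<bar>x\<bar>))"
    and deg: "\<And>j. degree (p j) = j"
    and A: "\<And>x. x \<in> A \<longleftrightarrow> \<omega> x \<noteq> 0"
    and orth: "\<And>i j. (\<integral>x. (\<omega> x)\<^sup>2 * poly (p i * p j) x \<partial>lborel) = of_bool (i = j)"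
    and [measurable]: "f \<in> borel_measurable borel" and f2: "integrable lborel (\<lambda>x. (f x)\<^sup>2)"
    and supp: "\<And>x. x \<notin> A \<Longrightarrow> f x = 0"
  shows "(\<lambda>i. (\<integral>x. f x * (poly (p i) x * \<omega> x) \<partial>lborel)\<^sup>2) sums (\<integral>x. (f x)\<^sup>2 \<partial>lborel)"
proof (rule total_orthonormal_Parseval[where A = A and e = "\<lambda>i x. poly (p i) x * \<omega> x"])
  have pm[measurable]: "poly q \<in> borel_measurable borel" for q :: "real poly"
    by (intro borel_measurable_continuous_onI continuous_intros)
  show "(\<lambda>x. poly (p i) x * \<omega> x) \<in> borel_measurable lborel" for i by measurable
  show "f \<in> borel_measurable lborel" by simp
  have eq: "poly (p i) x * \<omega> x * (poly (p j) x * \<omega> x) = (\<omega> x)\<^sup>2 * poly (p i * p j) x" for i j x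
    by (simp add: power2_eq_square)
  show "integrable lborel (\<lambda>x. poly (p i) x * \<omega> x * (poly (p j) x * \<omega> x))" for i j
    unfolding eq by (intro integrable_mult_poly[OF _ \<delta> W]) measurable
  show "(\<integral>x. poly (p i) x * \<omega> x * (poly (p j) x * \<omega> x) \<partial>lborel) = of_bool (i = j)" for i j
    unfolding eq by (rule orth)
  show "x \<notin> A \<Longrightarrow> poly (p i) x * \<omega> x = 0" for i x using A by simp
  fix g :: "real \<Rightarrow> real"
  assume "g \<in> borel_measurable lborel" and g2: "integrable lborel (\<lambda>x. (g x)\<^sup>2)"
    and g_supp: "\<And>x. x \<notin> A \<Longrightarrow> g x = 0" and perp: "\<And>i. (\<integral>x. g x * (poly (p i) x * \<omega> x) \<partial>lborel) = 0"
  then have [measurable]: "g \<in> borel_measurable borel" by simp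
  define G where "G x = g x * \<omega> x" for x
  have [measurable]: "G \<in> borel_measurable borel" unfolding G_def by measurable
  have "integrable lborel (\<lambda>x. g x * (\<omega> x * exp (\<delta> / 2 * \<bar>x\<bar>)))"
  proof (rule integrable_mult_L2[OF _ _ g2])
    have "(\<omega> x * exp (\<delta> / 2 * \<bar>x\<bar>))\<^sup>2 = (\<omega> x)\<^sup>2 * exp (\<delta> * \<bar>x\<bar>)" for x
      by (simp add: power_mult_distrib flip: exp_double)
    then show "integrable lborel (\<lambda>x. (\<omega> x * exp (\<delta> / 2 * \<bar>x\<bar>))\<^sup>2)" using W by simp
  qed measurable
  then have G_exp: "integrable lborel (\<lambda>x. G x * exp (\<delta> / 2 * \<bar>x\<bar>))" by (simp add: G_def mult_ac)
  have \<delta>2: "0 < \<delta> / 2" using \<delta> by simp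
  have G_poly: "integrable lborel (\<lambda>x. G x * poly q x)" for q
    by (rule integrable_mult_poly[OF _ \<delta>2 G_exp]) measurable
  have "p 0 \<noteq> 0" using orth[of 0 0] by auto
  then have "(\<integral>x. G x * poly q x \<partial>lborel) = 0" for q
    by (rule linear_zero_on_graded_basis[OF deg])
      (use G_poly perp in \<open>simp_all add: distrib_left mult.left_commute, simp_all add: G_def mult_ac\<close>)
  from this[of "monom 1 _"] have moments: "(\<integral>x. G x * x ^ n \<partial>lborel) = 0" for n
    by (simp add: poly_monom)
  have "AE x in lborel. G x = 0"
  proof (rule zero_Fourier_imp_AE_zero)
    show "integrable lborel G" using G_poly[of 1] by simp
    show "(CLINT x|lborel. of_real (G x) * iexp (t * x)) = 0" for t
      by (rule zero_moments_imp_zero_Fourier[OF _ \<delta>2 G_exp moments]) measurable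
  qed
  then show "AE x in lborel. g x = 0"
    by eventually_elim (use A g_supp in \<open>auto simp: G_def\<close>)
qed (use f2 supp in auto)

lemma integral_weighted_poly:
  fixes \<omega> :: "real \<Rightarrow> real"
  assumes "\<And>n. has_bochner_integral lborel (\<lambda>x. \<omega> x * x ^ n) (\<mu> n)"
  shows "has_bochner_integral lborel (\<lambda>x. \<omega> x * poly q x) (\<Sum>i\<le>degree q. coeff q i * \<mu> i)"
proof -
  have "\<omega> x * poly q x = (\<Sum>i\<le>degree q. coeff q i * (\<omega> x * x ^ i))" for x
    unfolding poly_altdef by (simp add: sum_distrib_left mult_ac)
  then show ?thesis
    using assms by (auto intro!: has_bochner_integral_sum has_bochner_integral_mult_right)
qed

subsection \<open>Laguerre functions\<close>

definition laguerre_weight :: "real \<Rightarrow> real" where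
  "laguerre_weight x = sqrt 2 * exp (- x) * indicator {0<..} x"

definition laguerre_P :: "nat \<Rightarrow> real poly" where
  "laguerre_P j = (\<Sum>k\<le>j. monom ((-1) ^ k * real (j choose k) * 2 ^ k / fact k) k)"

lemma laguerre_fun_eq: "laguerre_fun j x = poly (laguerre_P j) x * laguerre_weight x"
  unfolding laguerre_fun_def laguerre_poly_def laguerre_P_def laguerre_weight_def
  by (simp add: poly_sum poly_monom power_mult_distrib mult_ac)

lemma coeff_laguerre_P: "coeff (laguerre_P j) k = (-1) ^ k * real (j choose k) * 2 ^ k / fact k"
  unfolding laguerre_P_def by (auto simp: coeff_sum sum.delta if_distrib cong: if_cong)

lemma degree_laguerre_P: "degree (laguerre_P j) = j"
proof (rule antisym)
  show "degree (laguerre_P j) \<le> j" by (intro degree_le) (auto simp: coeff_laguerre_P)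
  show "j \<le> degree (laguerre_P j)" by (intro le_degree) (simp add: coeff_laguerre_P)
qed

text \<open>Except at 0, the squared weight is the exponential density of rate 2, which is the
  Erlang density with parameters 0 and 2.\<close>

lemma laguerre_moment:
  "has_bochner_integral lborel (\<lambda>x. (laguerre_weight x)\<^sup>2 * x ^ n) (fact n / 2 ^ n)"
proof -
  have "has_bochner_integral lborel (\<lambda>x. erlang_density 0 2 x * x ^ n) (fact n / 2 ^ n)"
    using nn_integral_erlang_ith_moment[of 2 0 n]
    by (intro has_bochner_integral_nn_integral) (auto simp: erlang_density_def)
  moreover have "AE x in lborel. erlang_density 0 2 x * x ^ n = (laguerre_weight x)\<^sup>2 * x ^ n"
    using AE_lborel_singleton[of 0]
  proof eventually_elim
    case (elim x)
    have "exp (- (2 * x)) = (exp (- x))\<^sup>2" for x :: real by (simp flip: exp_double)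
    then show ?case using elim
      by (auto simp: erlang_density_def laguerre_weight_def power_mult_distrib indicator_def)
  qed
  ultimately show ?thesis
    by (subst has_bochner_integral_cong_AE[symmetric]) (auto simp: laguerre_weight_def)
qed

text \<open>An m-fold finite difference of a binomial coefficient in its upper argument; by Pascal's
  rule each difference lowers the lower index by one. The guard is needed because
  \<open>r - m\<close> is truncated subtraction.\<close>

lemma alternating_binomial_sum:
  "(\<Sum>i\<le>m. (-1) ^ i * real (m choose i) * real ((i + s) choose r)) =
     (-1) ^ m * (if m \<le> r then real (s choose (r - m)) else 0)"
proof (induction m arbitrary: r s)
  case (Suc m)
  define g where "g i = (-1) ^ i * real ((i + s) choose r)" for i
  have "(\<Sum>i\<le>Suc m. (-1) ^ i * real (Suc m choose i) * real ((i + s) choose r)) = (\<Sum>i\<le>Suc m. real (Suc m choose i) * g i)"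
    by (simp add: g_def mult_ac)
  also have "\<dots> = g 0 + (\<Sum>i\<le>m. real (Suc m choose Suc i) * g (Suc i))"
    by (subst sum.atMost_Suc_shift) simp
  also have "\<dots> = (g 0 + (\<Sum>i\<le>m. real (m choose Suc i) * g (Suc i))) + (\<Sum>i\<le>m. real (m choose i) * g (Suc i))"
    by (simp add: sum.distrib distrib_right)
  also have "g 0 + (\<Sum>i\<le>m. real (m choose Suc i) * g (Suc i)) = (\<Sum>i\<le>Suc m. real (m choose i) * g i)"
    by (subst sum.atMost_Suc_shift) simp
  also have "\<dots> = (\<Sum>i\<le>m. real (m choose i) * g i)" by simp
  also have "\<dots> + (\<Sum>i\<le>m. real (m choose i) * g (Suc i)) = (\<Sum>i\<le>m. real (m choose i) * (g i + g (Suc i)))"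
    by (simp add: sum.distrib distrib_left)
  also have "\<dots> = (-1) ^ Suc m * (if Suc m \<le> r then real (s choose (r - Suc m)) else 0)"
  proof (cases r)
    case 0
    then show ?thesis by (simp add: g_def)
  next
    case (Suc r')
    have "g i + g (Suc i) = - ((-1) ^ i * real ((i + s) choose r'))" for i
      unfolding g_def Suc by (simp add: algebra_simps)
    then have "(\<Sum>i\<le>m. real (m choose i) * (g i + g (Suc i))) = - (\<Sum>i\<le>m. (-1) ^ i * real (m choose i) * real ((i + s) choose r'))"
      by (simp add: sum_negf mult_ac)
    then show ?thesis using Suc.IH[of s r'] Suc by simp
  qed
  finally show ?case .
qed simp

text \<open>The moment (k + r)! / 2^(k + r) cancels the 2^k / k! of the coefficient up to r! / 2^r
  times (k + r choose r), which leaves an alternating binomial sum that is 0 for r < m.\<close>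

lemma laguerre_orthogonal_monom:
  assumes "r \<le> m"
  shows "(\<integral>x. (laguerre_weight x)\<^sup>2 * poly (laguerre_P m * monom 1 r) x \<partial>lborel) =
    of_bool (r = m) * (-1) ^ m * fact m / 2 ^ m"
proof -
  have eq: "(laguerre_weight x)\<^sup>2 * poly (laguerre_P m * monom 1 r) x =
      (\<Sum>k\<le>m. ((-1) ^ k * real (m choose k) * 2 ^ k / fact k) * ((laguerre_weight x)\<^sup>2 * x ^ (k + r)))" for x
    by (simp add: laguerre_P_def poly_sum poly_monom sum_distrib_left sum_distrib_right power_add mult_ac)
  have "(\<integral>x. (laguerre_weight x)\<^sup>2 * poly (laguerre_P m * monom 1 r) x \<partial>lborel) =
      (\<Sum>k\<le>m. ((-1) ^ k * real (m choose k) * 2 ^ k / fact k) * (fact (k + r) / 2 ^ (k + r)))"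
    unfolding eq using laguerre_moment
    by (intro has_bochner_integral_integral_eq has_bochner_integral_sum has_bochner_integral_mult_right)
  also have "\<dots> = (\<Sum>k\<le>m. fact r / 2 ^ r * ((-1) ^ k * real (m choose k) * real ((k + r) choose r)))"
  proof (intro sum.cong refl)
    fix k
    have "real ((k + r) choose r) = fact (k + r) / (fact r * fact k)"
      by (simp add: binomial_fact)
    then show "((-1) ^ k * real (m choose k) * 2 ^ k / fact k) * (fact (k + r) / 2 ^ (k + r)) =
      fact r / 2 ^ r * ((-1) ^ k * real (m choose k) * real ((k + r) choose r))"
      by (simp add: power_add field_simps)
  qed
  also have "\<dots> = fact r / 2 ^ r * ((-1) ^ m * (if m \<le> r then real (r choose (r - m)) else 0))"
    by (simp only: sum_distrib_left[symmetric] alternating_binomial_sum)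
  finally show ?thesis using assms by auto
qed

text \<open>For q = \<open>laguerre_P m\<close> the surviving coefficient is (-2)^m / m!, which
  gives norm 1; for lower degree it is 0.\<close>

lemma laguerre_orthogonal:
  assumes "degree q \<le> m"
  shows "(\<integral>x. (laguerre_weight x)\<^sup>2 * poly (laguerre_P m * q) x \<partial>lborel) =
    coeff q m * (-1) ^ m * fact m / 2 ^ m"
proof -
  have int: "integrable lborel (\<lambda>x. (laguerre_weight x)\<^sup>2 * poly q x)" for q
    using integral_weighted_poly[OF laguerre_moment] by (rule integrable.intros)
  have q: "q = (\<Sum>r\<le>m. smult (coeff q r) (monom 1 r))"
    using poly_as_sum_of_monoms'[OF assms] by (simp add: smult_monom)
  have "(laguerre_weight x)\<^sup>2 * poly (laguerre_P m * q) x =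
     (\<Sum>r\<le>m. coeff q r * ((laguerre_weight x)\<^sup>2 * poly (laguerre_P m * monom 1 r) x))" for x
    by (subst q) (simp add: poly_sum sum_distrib_left mult_ac)
  then have "(\<integral>x. (laguerre_weight x)\<^sup>2 * poly (laguerre_P m * q) x \<partial>lborel) =
    (\<Sum>r\<le>m. coeff q r * (\<integral>x. (laguerre_weight x)\<^sup>2 * poly (laguerre_P m * monom 1 r) x \<partial>lborel))"
    using int by (simp only: Bochner_Integration.integral_sum integrable_mult_right integral_mult_right_zero)
  also have "\<dots> = (\<Sum>r\<le>m. if r = m then coeff q m * (-1) ^ m * fact m / 2 ^ m else 0)"
    by (intro sum.cong) (auto simp: laguerre_orthogonal_monom simp del: poly_mult)
  finally show ?thesis by simp
qed

lemma laguerre_orthonormal: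
  "(\<integral>x. (laguerre_weight x)\<^sup>2 * poly (laguerre_P i * laguerre_P j) x \<partial>lborel) = of_bool (i = j)"
proof -
  have *: "(\<integral>x. (laguerre_weight x)\<^sup>2 * poly (laguerre_P i * laguerre_P j) x \<partial>lborel) = of_bool (i = j)"
    if "j \<le> i" for i j
    using that by (subst laguerre_orthogonal) (auto simp: degree_laguerre_P coeff_laguerre_P power_mult_distrib[symmetric] simp flip: power_add)
  show ?thesis
  proof (cases "j \<le> i")
    case False
    then have "i \<le> j" by simp
    from *[OF this] show ?thesis by (simp only: mult.commute[of "laguerre_P i"] eq_commute[of i])
  qed (rule *)
qed

text \<open>The factor 1 is written out to match the pattern
  \<open>exp (\<delta> * \<bar>x\<bar>)\<close> with \<delta> = 1.\<close>

lemma laguerre_weight_exp_integrable: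
  "integrable lborel (\<lambda>x. (laguerre_weight x)\<^sup>2 * exp (1 * \<bar>x\<bar>))"
proof (rule Bochner_Integration.integrable_bound)
  have "has_bochner_integral lborel (\<lambda>x. erlang_density 0 1 x * x ^ 0) 1"
    using nn_integral_erlang_ith_moment[of 1 0 0]
    by (intro has_bochner_integral_nn_integral) (auto simp: erlang_density_def)
  then show "integrable lborel (\<lambda>x. 2 * erlang_density 0 1 x)"
    by (auto dest: integrable.intros)
  show "AE x in lborel. norm ((laguerre_weight x)\<^sup>2 * exp (1 * \<bar>x\<bar>)) \<le> norm (2 * erlang_density 0 1 x)"
  proof (rule AE_I2)
    fix x :: real
    have "(exp (- x))\<^sup>2 * exp x = exp (- x)" by (simp add: power2_eq_square flip: exp_add)
    then show "norm ((laguerre_weight x)\<^sup>2 * exp (1 * \<bar>x\<bar>)) \<le> norm (2 * erlang_density 0 1 x)"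
      by (auto simp: erlang_density_def laguerre_weight_def power_mult_distrib indicator_def abs_mult)
  qed
qed (simp add: laguerre_weight_def)

subsection \<open>Hermite functions\<close>

text \<open>The derivative of (-1)^j P(t) exp(-t^2) is (-1)^(j+1) (2 t P(t) - P'(t)) exp(-t^2); the
  sign is kept outside the polynomial.\<close>

fun hermite_P :: "nat \<Rightarrow> real poly" where
  "hermite_P 0 = 1"
| "hermite_P (Suc j) = [:0, 2:] * hermite_P j - pderiv (hermite_P j)"

lemma deriv_funpow_Gaussian:
  "(deriv ^^ j) (\<lambda>t. exp (- t\<^sup>2)) = (\<lambda>t. (-1) ^ j * poly (hermite_P j) t * exp (- t\<^sup>2 :: real))"
proof (induction j)
  case (Suc j)
  have "deriv (\<lambda>t. (-1) ^ j * poly (hermite_P j) t * exp (- t\<^sup>2 :: real)) t =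
      (-1) ^ Suc j * poly (hermite_P (Suc j)) t * exp (- t\<^sup>2)" for t
    by (rule DERIV_imp_deriv) (auto intro!: derivative_eq_intros simp: algebra_simps)
  then have "deriv (\<lambda>t. (-1) ^ j * poly (hermite_P j) t * exp (- t\<^sup>2 :: real)) =
      (\<lambda>t. (-1) ^ Suc j * poly (hermite_P (Suc j)) t * exp (- t\<^sup>2))" by (rule ext)
  then show ?case by (simp only: funpow.simps o_apply Suc.IH)
qed simp

lemma hermite_poly_eq: "hermite_poly j x = poly (hermite_P j) x"
proof -
  have "hermite_poly j x = ((-1) ^ j * (-1) ^ j) * (exp (x\<^sup>2) * exp (- x\<^sup>2)) * poly (hermite_P j) x"
    unfolding hermite_poly_def deriv_funpow_Gaussian by simp
  also have "\<dots> = poly (hermite_P j) x"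
    by (simp only: power_mult_distrib[symmetric] exp_add[symmetric]) simp
  finally show ?thesis .
qed

lemma hermite_P_degree: "degree (hermite_P j) = j \<and> coeff (hermite_P j) j = 2 ^ j"
proof (induction j)
  case (Suc j)
  have le: "degree (hermite_P (Suc j)) \<le> Suc j"
    using Suc.IH by (auto intro!: degree_diff_le order_trans[OF degree_mult_le] simp: degree_pderiv)
  have "coeff (pderiv (hermite_P j)) (Suc j) = 0"
    using Suc.IH by (intro coeff_eq_0) (simp add: degree_pderiv)
  then have "coeff (hermite_P (Suc j)) (Suc j) = 2 ^ Suc j"
    using Suc.IH by simp
  moreover from this have "Suc j \<le> degree (hermite_P (Suc j))" by (intro le_degree) simp
  ultimately show ?case using le by simp
qed simp

definition gauss_moment :: "nat \<Rightarrow> real" where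
  "gauss_moment n = (if even n then sqrt pi * (fact n / (2 ^ n * fact (n div 2))) else 0)"

lemma has_gauss_moment: "has_bochner_integral lborel (\<lambda>x::real. exp (- x\<^sup>2) * x ^ n) (gauss_moment n)"
proof (cases "even n")
  case True
  then obtain k where k: "n = 2 * k" by blast
  show ?thesis
    using has_bochner_integral_even_function[OF gaussian_moment_even_pos[of k]]
    by (simp add: k gauss_moment_def)
next
  case False
  then obtain k where k: "n = 2 * k + 1" by (elim oddE)
  show ?thesis
    using has_bochner_integral_odd_function[OF gaussian_moment_odd_pos[of k]]
    by (simp add: k gauss_moment_def)
qed

text \<open>Integration by parts on monomials, read off from the factorials. At n = 0 the truncated
  \<open>n - 1\<close> is harmless: its factor is 0, and the first moment is 0.\<close>

lemma gauss_moment_Suc: "2 * gauss_moment (Suc n) = real n * gauss_moment (n - 1)"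
proof (cases "even n")
  case False
  then obtain k where k: "n = 2 * k + 1" by (elim oddE)
  define a b d :: real where "a = fact (2 * k)" and "b = fact k" and "d = 2 ^ (2 * k)"
  have nz: "b \<noteq> 0" "d \<noteq> 0" "1 + real k \<noteq> 0" unfolding b_def d_def by auto
  have "2 * (sqrt pi * ((2 * real k + 2) * (2 * real k + 1) * a / (4 * d * ((1 + real k) * b))))
      = (2 * real k + 1) * (sqrt pi * (a / (d * b)))"
    using nz by (simp add: divide_simps)
  moreover have "fact (2 * k + 2) = (2 * real k + 2) * (2 * real k + 1) * a"
    unfolding a_def by (simp add: algebra_simps)
  moreover have "fact (k + 1) = (1 + real k) * b" unfolding b_def by simp
  ultimately show ?thesis by (simp add: gauss_moment_def k a_def b_def d_def algebra_simps)
qed (simp add: gauss_moment_def)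

definition gauss_int :: "real poly \<Rightarrow> real" where
  "gauss_int q = (\<integral>x. exp (- x\<^sup>2) * poly q x \<partial>lborel)"

lemma gauss_int_integrable: "integrable lborel (\<lambda>x::real. exp (- x\<^sup>2) * poly q x)"
  using integral_weighted_poly[OF has_gauss_moment] by (rule integrable.intros)

lemma gauss_int_add: "gauss_int (q + r) = gauss_int q + gauss_int r"
  unfolding gauss_int_def using gauss_int_integrable by (simp add: distrib_left)

lemma gauss_int_smult: "gauss_int (smult a q) = a * gauss_int q"
  unfolding gauss_int_def by (simp add: mult.left_commute)

lemma gauss_int_diff: "gauss_int (q - r) = gauss_int q - gauss_int r"
  using gauss_int_add[of q "smult (-1) r"] gauss_int_smult[of "-1" r] by simp

lemma gauss_int_monom: "gauss_int (monom 1 n) = gauss_moment n"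
  unfolding gauss_int_def using has_gauss_moment[of n] by (simp add: poly_monom has_bochner_integral_integral_eq)

text \<open>Verified on monomials through the explicit moments and extended by linearity, which
  avoids boundary terms at infinity.\<close>

lemma gauss_int_by_parts: "gauss_int ([:0, 2:] * q) = gauss_int (pderiv q)"
proof -
  have "gauss_int ([:0, 2:] * q) - gauss_int (pderiv q) = 0"
  proof (rule linear_zero_on_graded_basis[where p = "\<lambda>n. monom 1 n"
        and L = "\<lambda>q. gauss_int ([:0, 2:] * q) - gauss_int (pderiv q)"])
    fix n
    have pd: "pderiv (monom 1 n) = smult (real n) (monom 1 (n - 1))"
      by (simp add: pderiv_monom smult_monom)
    have "[:0, 2:] * monom 1 n = smult 2 (monom (1::real) (Suc n))"
      by (simp add: monom_Suc)
    then show "gauss_int ([:0, 2:] * monom 1 n) - gauss_int (pderiv (monom 1 n)) = 0"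
      using gauss_moment_Suc[of n] pd by (simp only: gauss_int_smult gauss_int_monom)
  qed (simp_all only: distrib_left pderiv_add gauss_int_add mult_smult_right pderiv_smult gauss_int_smult,
       simp_all add: degree_monom_eq algebra_simps)
  then show ?thesis by simp
qed

text \<open>The recurrence and integration by parts move one derivative onto q per step, until only
  j! times its coefficient of degree j is left.\<close>

lemma hermite_orthogonal:
  assumes "degree q \<le> j"
  shows "gauss_int (hermite_P j * q) = fact j * coeff q j * sqrt pi"
  using assms
proof (induction j arbitrary: q)
  case 0
  then have "q = smult (coeff q 0) (monom 1 0)" by (simp add: degree_0_id smult_monom monom_0)
  then have "gauss_int (hermite_P 0 * q) = coeff q 0 * gauss_int (monom 1 0)"
    by (metis gauss_int_smult hermite_P.simps(1) mult_1)
  then show ?case by (simp only: gauss_int_monom) (simp add: gauss_moment_def)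
next
  case (Suc j)
  have "gauss_int (hermite_P (Suc j) * q) = gauss_int ([:0, 2:] * (hermite_P j * q) - pderiv (hermite_P j) * q)"
    by (simp only: hermite_P.simps left_diff_distrib mult.assoc)
  also have "\<dots> = gauss_int (hermite_P j * pderiv q)"
    unfolding gauss_int_diff gauss_int_by_parts pderiv_mult gauss_int_add by (simp add: mult.commute)
  also have "\<dots> = fact j * coeff (pderiv q) j * sqrt pi"
    using Suc.prems by (intro Suc.IH) (simp add: degree_pderiv)
  finally show ?case by (simp add: coeff_pderiv)
qed

definition hermite_weight :: "real \<Rightarrow> real" where "hermite_weight x = exp (- x\<^sup>2 / 2)"

definition hermite_N :: "nat \<Rightarrow> real poly" where
  "hermite_N j = smult ((2 ^ j * fact j * sqrt pi) powr (-1/2)) (hermite_P j)"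

lemma hermite_fun_eq: "hermite_fun j x = poly (hermite_N j) x * hermite_weight x"
  unfolding hermite_fun_def hermite_poly_eq hermite_N_def hermite_weight_def by simp

lemma degree_hermite_N: "degree (hermite_N j) = j"
  unfolding hermite_N_def using hermite_P_degree[of j] by simp

lemma hermite_weight_square: "(hermite_weight x)\<^sup>2 = exp (- x\<^sup>2)"
  unfolding hermite_weight_def by (simp flip: exp_double)

lemma hermite_orthonormal:
  "(\<integral>x. (hermite_weight x)\<^sup>2 * poly (hermite_N i * hermite_N j) x \<partial>lborel) = of_bool (i = j)"
proof -
  have *: "(\<integral>x. (hermite_weight x)\<^sup>2 * poly (hermite_N i * hermite_N j) x \<partial>lborel) = of_bool (i = j)"
    if "j \<le> i" for i j
  proof -
    let ?c = "\<lambda>j. (2 ^ j * fact j * sqrt pi) powr (-1/2)"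
    have "(\<integral>x. (hermite_weight x)\<^sup>2 * poly (hermite_N i * hermite_N j) x \<partial>lborel)
        = ?c i * (?c j * gauss_int (hermite_P i * hermite_P j))"
      unfolding hermite_weight_square gauss_int_def[symmetric] hermite_N_def
      by (simp only: mult_smult_left mult_smult_right gauss_int_smult mult.left_commute)
    also have "\<dots> = ?c i * (?c j * (fact i * coeff (hermite_P j) i * sqrt pi))"
      using that hermite_P_degree[of j] by (simp add: hermite_orthogonal)
    also have "\<dots> = of_bool (i = j)"
    proof (cases "i = j")
      case True
      have "?c j * ?c j = 1 / (2 ^ j * fact j * sqrt pi)"
        by (simp only: powr_add[symmetric]) (simp add: powr_minus_divide)
      then show ?thesis using True hermite_P_degree[of j]
        by (simp add: mult.assoc[symmetric])
    next
      case False
      then have "coeff (hermite_P j) i = 0" using that hermite_P_degree[of j] by (intro coeff_eq_0) simp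
      then show ?thesis using False by simp
    qed
    finally show ?thesis .
  qed
  show ?thesis
  proof (cases "j \<le> i")
    case False
    then have "i \<le> j" by simp
    from *[OF this] show ?thesis by (simp only: mult.commute[of "hermite_N i"] eq_commute[of i])
  qed (rule *)
qed

lemma hermite_weight_exp_integrable:
  "integrable lborel (\<lambda>x. (hermite_weight x)\<^sup>2 * exp (1 * \<bar>x\<bar>))"
proof (rule Bochner_Integration.integrable_bound)
  show "integrable lborel (\<lambda>x. exp (1/2) * sqrt (2 * pi) * (std_normal_density x * x ^ 0))"
    by (intro integrable_mult_right integrable_std_normal_moment)
  show "AE x in lborel. norm ((hermite_weight x)\<^sup>2 * exp (1 * \<bar>x\<bar>))
      \<le> norm (exp (1/2) * sqrt (2 * pi) * (std_normal_density x * x ^ 0))"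
  proof (rule AE_I2)
    fix x :: real
    have "2 * \<bar>x\<bar> \<le> x\<^sup>2 + 1" using sum_squares_bound[of "\<bar>x\<bar>" 1] by simp
    then have "- x\<^sup>2 + \<bar>x\<bar> \<le> 1/2 + - x\<^sup>2 / 2" by simp
    then have "exp (- x\<^sup>2) * exp \<bar>x\<bar> \<le> exp (1/2) * exp (- x\<^sup>2 / 2)"
      unfolding exp_add[symmetric] exp_le_cancel_iff .
    then show "norm ((hermite_weight x)\<^sup>2 * exp (1 * \<bar>x\<bar>))
        \<le> norm (exp (1/2) * sqrt (2 * pi) * (std_normal_density x * x ^ 0))"
      by (simp add: hermite_weight_square std_normal_density_def)
  qed
qed (simp add: hermite_weight_def)

subsection \<open>Consequences of admissibility\<close>

fun weight_fun :: "setting \<Rightarrow> real \<Rightarrow> real" where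
  "weight_fun Laguerre = laguerre_weight"
| "weight_fun Hermite = hermite_weight"

fun basis_poly :: "setting \<Rightarrow> nat \<Rightarrow> real poly" where
  "basis_poly Laguerre = laguerre_P"
| "basis_poly Hermite = hermite_N"

lemma phi_eq: "phi c j x = poly (basis_poly c j) x * weight_fun c x"
  by (cases c) (simp_all add: laguerre_fun_eq hermite_fun_eq)

lemma weight_fun_measurable [measurable]: "weight_fun c \<in> borel_measurable borel"
  by (cases c) (simp_all add: laguerre_weight_def[abs_def] hermite_weight_def[abs_def])

lemma phi_measurable [measurable]: "phi c j \<in> borel_measurable borel"
proof -
  have [measurable]: "poly q \<in> borel_measurable borel" for q :: "real poly"
    by (intro borel_measurable_continuous_onI continuous_intros)
  show ?thesis unfolding phi_eq[abs_def] by measurable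
qed

lemma weight_fun_nz: "x \<in> dom_A c \<longleftrightarrow> weight_fun c x \<noteq> 0"
  by (cases c) (auto simp: laguerre_weight_def hermite_weight_def indicator_def)

lemma phi_outside: "x \<notin> dom_A c \<Longrightarrow> phi c j x = 0"
  using weight_fun_nz[of x c] by (simp add: phi_eq)

lemma weight_fun_exp_integrable: "integrable lborel (\<lambda>x. (weight_fun c x)\<^sup>2 * exp (1 * \<bar>x\<bar>))"
  using laguerre_weight_exp_integrable hermite_weight_exp_integrable by (cases c) auto

lemma basis_poly_orthonormal:
  "(\<integral>x. (weight_fun c x)\<^sup>2 * poly (basis_poly c i * basis_poly c j) x \<partial>lborel) = of_bool (i = j)"
  using laguerre_orthonormal hermite_orthonormal by (cases c) auto

lemma phi_orthonormal:
  shows phi_mult_integrable: "integrable lborel (\<lambda>x. phi c i x * phi c j x)"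
    and "(\<integral>x. phi c i x * phi c j x \<partial>lborel) = of_bool (i = j)"
proof -
  have eq: "phi c i x * phi c j x = (weight_fun c x)\<^sup>2 * poly (basis_poly c i * basis_poly c j) x" for x
    by (simp add: phi_eq power2_eq_square)
  show "integrable lborel (\<lambda>x. phi c i x * phi c j x)"
    unfolding eq by (intro integrable_mult_poly[OF _ _ weight_fun_exp_integrable]) auto
  show "(\<integral>x. phi c i x * phi c j x \<partial>lborel) = of_bool (i = j)"
    unfolding eq by (rule basis_poly_orthonormal)
qed

lemma phi_Parseval:
  assumes "f \<in> borel_measurable borel" "integrable lborel (\<lambda>x. (f x)\<^sup>2)" "\<And>x. x \<notin> dom_A c \<Longrightarrow> f x = 0"
  shows "(\<lambda>i. (\<integral>x. f x * phi c i x \<partial>lborel)\<^sup>2) sums (\<integral>x. (f x)\<^sup>2 \<partial>lborel)"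
  unfolding phi_eq
proof (rule weighted_polynomials_Parseval[OF _ _ weight_fun_exp_integrable _ weight_fun_nz basis_poly_orthonormal])
  show "degree (basis_poly c j) = j" for j
    by (cases c) (simp_all add: degree_laguerre_P degree_hermite_N)
qed (use assms in auto)

lemma open_dom_A: "open (dom_A c)"
  by (cases c) auto

text \<open>Only on the domain, since the Laguerre functions jump at 0.\<close>

lemma phi_continuous: "continuous_on (dom_A c) (phi c j)"
proof (cases c)
  case Laguerre
  have "continuous_on {0<..} (\<lambda>x. poly (laguerre_P j) x * (sqrt 2 * exp (- x)))"
    by (intro continuous_intros)
  then have "continuous_on {0<..} (phi c j)"
    by (rule continuous_on_eq) (auto simp: Laguerre laguerre_fun_eq laguerre_weight_def)
  then show ?thesis by (simp add: Laguerre)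
next
  case Hermite
  show ?thesis unfolding phi_eq[abs_def] Hermite by (auto simp: hermite_weight_def[abs_def] intro!: continuous_intros)
qed

lemma L2_inner_eq:
  assumes "\<And>x. x \<notin> dom_A c \<Longrightarrow> g x * h x = 0"
  shows "L2_inner c g h = (\<integral>x. g x * h x \<partial>lborel)"
  unfolding L2_inner_def set_lebesgue_integral_def
proof (intro Bochner_Integration.integral_cong refl)
  show "indicator (dom_A c) x *\<^sub>R (g x * h x) = g x * h x" for x
    by (cases "x \<in> dom_A c") (simp_all add: assms)
qed

lemma L2_norm_sq: 
  assumes "\<And>x. x \<notin> dom_A c \<Longrightarrow> g x = 0"
  shows "(L2_norm c g)\<^sup>2 = (\<integral>x. (g x)\<^sup>2 \<partial>lborel)"
proof -
  have "L2_inner c g g = (\<integral>x. (g x)\<^sup>2 \<partial>lborel)"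
    using assms by (subst L2_inner_eq) (auto simp: power2_eq_square)
  then show ?thesis unfolding L2_norm_def by simp
qed

lemma sup_norm_leD:
  assumes "sup_norm g \<le> ennreal B" "0 \<le> B"
  shows "\<bar>g x\<bar> \<le> B"
proof -
  have "ennreal \<bar>g x\<bar> \<le> sup_norm g" unfolding sup_norm_def by (rule SUP_upper) simp
  also note assms(1)
  finally show ?thesis using assms(2) by simp
qed

lemma abs_le_sup_norm: "sup_norm g < \<infinity> \<Longrightarrow> \<bar>g x\<bar> \<le> enn2real (sup_norm g)"
  by (rule sup_norm_leD) simp_all

lemma admissible_ge_1: "admissible_const c C \<Longrightarrow> 1 \<le> C"
  unfolding admissible_const_def by blast

text \<open>Both values of \<open>dexp\<close> are at most 1, so one linear envelope serves both
  settings.\<close>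

lemma admissible_sup_bound:
  assumes "admissible_const c C"
  shows "(\<Sum>j<k. (phi c j x)\<^sup>2) \<le> C * real k"
proof (cases "k = 0")
  case False
  have C: "1 \<le> C" using admissible_ge_1[OF assms] .
  have "\<bar>\<Sum>j<k. (phi c j x)\<^sup>2\<bar> \<le> C * real k powr dexp c"
    using False assms C by (intro sup_norm_leD[where g = "\<lambda>x. \<Sum>j<k. (phi c j x)\<^sup>2"]) (auto simp: admissible_const_def)
  also have "\<dots> \<le> C * real k powr 1"
    using False C by (intro mult_left_mono powr_mono) (cases c; simp)+
  finally show ?thesis using False by simp
qed simp

lemma admissible_phi_sq_bound:
  assumes "admissible_const c C"
  shows "(phi c j x)\<^sup>2 \<le> C * real (Suc j)"
proof -
  have "(phi c j x)\<^sup>2 \<le> (\<Sum>j<Suc j. (phi c j x)\<^sup>2)" by (simp add: sum_nonneg)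
  also have "\<dots> \<le> C * real (Suc j)" using admissible_sup_bound[OF assms] .
  finally show ?thesis .
qed

section \<open>Bias of a density and loss of an aggregate\<close>

locale square_integrable_density =
  fixes c :: setting and f :: "real \<Rightarrow> real"
  assumes dens: "L2_density c f"
begin

lemma f_measurable [measurable]: "f \<in> borel_measurable borel"
  and f_nonneg: "0 \<le> f x"
  and f_outside: "x \<notin> dom_A c \<Longrightarrow> f x = 0"
  using dens unfolding L2_density_def by auto

lemma f_integral: "(\<integral>x. f x \<partial>lborel) = 1"
proof -
  have "has_bochner_integral lborel f 1"
    using dens unfolding L2_density_def by (intro has_bochner_integral_nn_integral) auto
  then show ?thesis by (simp add: has_bochner_integral_iff)
qed

lemma f_sq_integrable: "integrable lborel (\<lambda>x. (f x)\<^sup>2)"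
proof -
  have "integrable lborel (\<lambda>x. indicator (dom_A c) x *\<^sub>R (f x)\<^sup>2)"
    using dens unfolding L2_density_def set_integrable_def by auto
  moreover have "indicator (dom_A c) x *\<^sub>R (f x)\<^sup>2 = (f x)\<^sup>2" for x
    by (auto simp: indicator_def f_outside)
  ultimately show ?thesis by (simp only:)
qed

lemma prob_space_law: "prob_space (law f)"
  using dens unfolding L2_density_def law_def
  by (intro prob_spaceI) (simp add: emeasure_density)

lemma sets_law [simp, measurable_cong]: "sets (law f) = sets borel" and space_law [simp]: "space (law f) = UNIV"
  unfolding law_def by auto

lemma law_integral: "h \<in> borel_measurable borel \<Longrightarrow> (\<integral>x. h x \<partial>law f) = (\<integral>x. f x * (h x :: real) \<partial>lborel)"
  unfolding law_def by (subst integral_density) (auto simp: f_nonneg)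

lemma norm_sq: "(L2_norm c f)\<^sup>2 = (\<integral>x. (f x)\<^sup>2 \<partial>lborel)"
  by (rule L2_norm_sq) (rule f_outside)

lemma coeff_eq: "coeff_a c f j = (\<integral>x. f x * phi c j x \<partial>lborel)"
  unfolding coeff_a_def by (rule L2_inner_eq) (simp add: f_outside)

lemma coeff_law: "coeff_a c f j = (\<integral>x. phi c j x \<partial>law f)"
  unfolding coeff_eq by (simp add: law_integral)

lemma coeff_sums: "(\<lambda>j. (coeff_a c f j)\<^sup>2) sums (L2_norm c f)\<^sup>2"
  unfolding coeff_eq norm_sq by (rule phi_Parseval) (use f_sq_integrable f_outside in auto)

lemma norm_pos: "0 < (L2_norm c f)\<^sup>2"
proof (rule ccontr)
  assume "\<not> 0 < (L2_norm c f)\<^sup>2"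
  then have "(\<integral>x. (f x)\<^sup>2 \<partial>lborel) = 0"
    unfolding norm_sq[symmetric] by simp
  then have "AE x in lborel. (f x)\<^sup>2 = 0"
    using f_sq_integrable by (subst (asm) integral_nonneg_eq_0_iff_AE) auto
  then have "(\<integral>x. f x \<partial>lborel) = (\<integral>x. 0 \<partial>(lborel :: real measure))"
    by (intro integral_cong_AE) auto
  then show False using f_integral by simp
qed

text \<open>The unnormalised squared bias in the form in which it occurs in the loss. That it equals
  the tail sum inside \<open>bias_b\<close> is Parseval's identity, used in
  \<open>tail_eq\<close>.\<close>

definition bias2 :: "nat \<Rightarrow> real" where
  "bias2 k = (L2_norm c f)\<^sup>2 - (\<Sum>j<k. (coeff_a c f j)\<^sup>2)"

lemma tail_eq: "(\<Sum>j. (coeff_a c f (j + k))\<^sup>2) = bias2 k"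
  using suminf_split_initial_segment[OF sums_summable[OF coeff_sums], of k] sums_unique[OF coeff_sums]
  unfolding bias2_def by simp

lemma bias2_nonneg: "0 \<le> bias2 k"
  using sum_le_suminf[OF sums_summable[OF coeff_sums], of "{..<k}"] sums_unique[OF coeff_sums]
  unfolding bias2_def by simp

lemma bias_b_sq: "(L2_norm c f)\<^sup>2 * (bias_b c f k)\<^sup>2 = bias2 k"
proof -
  have "0 \<le> bias2 k / (L2_norm c f)\<^sup>2" using bias2_nonneg by simp
  then have "(bias_b c f k)\<^sup>2 = bias2 k / (L2_norm c f)\<^sup>2"
    unfolding bias_b_def power2_abs tail_eq by simp
  then show ?thesis using norm_pos by simp
qed

lemma f_hat_norm: "(L2_norm c (f_hat c n X k))\<^sup>2 = (\<Sum>j<k. (a_hat c n X j)\<^sup>2)"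
proof -
  have "(L2_norm c (f_hat c n X k))\<^sup>2 = (\<integral>x. (f_hat c n X k x)\<^sup>2 \<partial>lborel)"
    by (rule L2_norm_sq) (simp add: f_hat_def phi_outside)
  also have "\<dots> = (\<Sum>j<k. (a_hat c n X j)\<^sup>2)"
    unfolding f_hat_def by (intro orthonormal_sum_square phi_orthonormal) simp
  finally show ?thesis .
qed

definition err :: "nat \<Rightarrow> (nat \<Rightarrow> real) \<Rightarrow> nat \<Rightarrow> real" where
  "err n X k = (\<Sum>j<k. (a_hat c n X j - coeff_a c f j)\<^sup>2)"

text \<open>Weights summing to 1 make the error of the aggregate a convex combination of the single
  errors, so Jensen's inequality applies pointwise; each single error then splits by
  Pythagoras.\<close>

lemma agg_loss:
  assumes w: "\<And>k. k \<in> {1..max_dim c n} \<Longrightarrow> 0 \<le> w n X k" and w1: "(\<Sum>k=1..max_dim c n. w n X k) = 1"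
  shows "(L2_norm c (\<lambda>x. agg_est c w n X x - f x))\<^sup>2
    \<le> (\<Sum>k=1..max_dim c n. w n X k * (err n X k + bias2 k))"
proof -
  let ?I = "{1..max_dim c n}"
  define g where "g k x = f_hat c n X k x - f x" for k x
  have g_int: "integrable lborel (\<lambda>x. (g k x)\<^sup>2)" and g_eq: "(\<integral>x. (g k x)\<^sup>2 \<partial>lborel) = err n X k + bias2 k" for k
  proof -
    have m: "phi c j \<in> borel_measurable lborel" "f \<in> borel_measurable lborel" for j by auto
    note r = orthonormal_residual_square[OF m f_sq_integrable phi_orthonormal, of "{..<k}" "a_hat c n X"]
    show "integrable lborel (\<lambda>x. (g k x)\<^sup>2)" unfolding g_def f_hat_def using r(1) by simp
    show "(\<integral>x. (g k x)\<^sup>2 \<partial>lborel) = err n X k + bias2 k"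
      unfolding g_def f_hat_def err_def bias2_def norm_sq coeff_eq using r(2) by simp
  qed
  have eq: "agg_est c w n X x - f x = (\<Sum>k\<in>?I. w n X k * g k x)" for x
    using w1 unfolding agg_est_def g_def by (simp add: right_diff_distrib sum_subtractf flip: sum_distrib_right)
  have jensen: "(\<Sum>k\<in>?I. w n X k * y k)\<^sup>2 \<le> (\<Sum>k\<in>?I. w n X k * (y k)\<^sup>2)" for y :: "nat \<Rightarrow> real"
  proof -
    define m where "m = (\<Sum>k\<in>?I. w n X k * y k)"
    have "0 \<le> (\<Sum>k\<in>?I. w n X k * (y k - m)\<^sup>2)" using w by (intro sum_nonneg mult_nonneg_nonneg) auto
    also have "\<dots> = (\<Sum>k\<in>?I. w n X k * (y k)\<^sup>2 - 2 * m * (w n X k * y k) + m\<^sup>2 * w n X k)"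
      by (intro sum.cong) (auto simp: power2_diff algebra_simps)
    also have "\<dots> = (\<Sum>k\<in>?I. w n X k * (y k)\<^sup>2) - 2 * m * m + m\<^sup>2 * 1"
      unfolding sum.distrib sum_subtractf sum_distrib_left[symmetric] m_def[symmetric] w1 ..
    finally show ?thesis unfolding m_def[symmetric] by (simp add: power2_eq_square)
  qed
  have "(L2_norm c (\<lambda>x. agg_est c w n X x - f x))\<^sup>2 = (\<integral>x. (\<Sum>k\<in>?I. w n X k * g k x)\<^sup>2 \<partial>lborel)"
    unfolding eq[symmetric] by (rule L2_norm_sq) (simp add: agg_est_def f_hat_def phi_outside f_outside)
  also have "\<dots> \<le> (\<integral>x. (\<Sum>k\<in>?I. w n X k * (g k x)\<^sup>2) \<partial>lborel)"
    by (rule integral_mono_AE') (use g_int jensen w in \<open>auto intro!: Bochner_Integration.integrable_sum sum_nonneg\<close>)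
  also have "\<dots> = (\<Sum>k\<in>?I. w n X k * (err n X k + bias2 k))"
    using g_int g_eq by (simp add: Bochner_Integration.integral_sum)
  finally show ?thesis .
qed

end

text \<open>The bound on expectations in the admissibility condition holds for every density, in
  particular for uniform densities on short intervals; by continuity it is therefore pointwise.\<close>

lemma admissible_pointwise:
  assumes adm: "admissible_const c C" and k: "k \<ge> 1"
  shows "(\<Sum>j<k. (phi c j x)\<^sup>2) \<le> C * (\<bar>x\<bar> powr alpha c + 1) * sqrt (real k)"
proof (rule ccontr)
  assume neg: "\<not> ?thesis"
  have C: "1 \<le> C" using adm by (rule admissible_ge_1)
  define g where "g y = (\<Sum>j<k. (phi c j y)\<^sup>2) - C * (\<bar>y\<bar> powr alpha c + 1) * sqrt (real k)" for y
  have gx: "0 < g x" using neg unfolding g_def by simp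
  \<comment> \<open>Off the domain the left side is 0; inside it, openness and continuity give a
    whole neighbourhood of violation.\<close>
  have xA: "x \<in> dom_A c"
  proof (rule ccontr)
    assume "x \<notin> dom_A c"
    then have "(\<Sum>j<k. (phi c j x)\<^sup>2) = 0" by (simp add: phi_outside)
    moreover have "0 \<le> C * (\<bar>x\<bar> powr alpha c + 1) * sqrt (real k)" using C by simp
    ultimately show False using neg by simp
  qed
  have cont_pow: "continuous_on (dom_A c) (\<lambda>y. \<bar>y\<bar> powr alpha c)"
    by (cases c) (auto intro!: continuous_intros continuous_on_powr')
  have cont_g: "continuous_on (dom_A c) g"
    unfolding g_def by (intro continuous_intros phi_continuous cont_pow)
  have lims: "((\<lambda>y. \<bar>y\<bar> powr alpha c) \<longlongrightarrow> \<bar>x\<bar> powr alpha c) (nhds x)" "(g \<longlongrightarrow> g x) (nhds x)"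
    using cont_pow cont_g xA open_dom_A[of c]
    by (auto simp: continuous_on_eq_continuous_at isCont_def
      tendsto_at_iff_tendsto_nhds[of "\<lambda>y. \<bar>y\<bar> powr alpha c"] tendsto_at_iff_tendsto_nhds[of g])
  have "\<forall>\<^sub>F y in nhds x. \<bar>y\<bar> powr alpha c < \<bar>x\<bar> powr alpha c + 1" "\<forall>\<^sub>F y in nhds x. g x / 2 < g y"
    by (rule order_tendstoD(2)[OF lims(1)], simp) (rule order_tendstoD(1)[OF lims(2)], use gx in simp)
  moreover have "\<forall>\<^sub>F y in nhds x. y \<in> dom_A c"
    using eventually_nhds open_dom_A xA by blast
  ultimately have "\<forall>\<^sub>F y in nhds x. y \<in> dom_A c \<and> \<bar>y\<bar> powr alpha c < \<bar>x\<bar> powr alpha c + 1 \<and> g x / 2 < g y"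
    by eventually_elim simp
  then obtain e where e: "0 < e" and near: "\<And>y. dist y x < e \<Longrightarrow> y \<in> dom_A c \<and> \<bar>y\<bar> powr alpha c < \<bar>x\<bar> powr alpha c + 1 \<and> g x / 2 < g y"
    unfolding eventually_nhds_metric by blast
  define I where "I = {x - e / 2 .. x + e / 2}"
  have I: "y \<in> dom_A c" "\<bar>y\<bar> powr alpha c < \<bar>x\<bar> powr alpha c + 1" "g x / 2 < g y" if "y \<in> I" for y
    using near[of y] that e unfolding I_def by (auto simp: dist_real_def abs_if split: if_splits)
  \<comment> \<open>Uniform density on a closed interval of length e; its half-width e/2 keeps it
    inside the ball of radius e on which \<open>near\<close> holds.\<close>
  define u where "u y = indicator I y / e" for y :: real
  have [measurable]: "I \<in> sets borel" unfolding I_def by simp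
  have "(\<integral>\<^sup>+y. ennreal (u y) \<partial>lborel) = (\<integral>\<^sup>+y. ennreal (1 / e) * indicator I y \<partial>lborel)"
    by (intro nn_integral_cong) (auto simp: u_def indicator_def)
  also have "\<dots> = ennreal (1 / e) * ennreal e"
    using e by (simp add: nn_integral_cmult_indicator I_def)
  also have "\<dots> = 1" using e by (simp flip: ennreal_mult')
  finally have u1: "(\<integral>\<^sup>+y. ennreal (u y) \<partial>lborel) = 1" .
  have "integrable lborel (\<lambda>y. (1 / e)\<^sup>2 * indicator I y :: real)"
    using e by (intro integrable_mult_right integrable_real_indicator) (auto simp: I_def)
  moreover have "indicator (dom_A c) y *\<^sub>R (u y)\<^sup>2 = (1 / e)\<^sup>2 * indicator I y" for y
    using I(1)[of y] by (auto simp: u_def indicator_def power_divide)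
  ultimately have "set_integrable lborel (dom_A c) (\<lambda>y. (u y)\<^sup>2)"
    unfolding set_integrable_def by simp
  then have dens: "L2_density c u"
    using e u1 I(1) unfolding L2_density_def by (auto simp: u_def[abs_def] indicator_def)
  interpret square_integrable_density c u by unfold_locales (rule dens)
  interpret law: prob_space "law u" by (rule prob_space_law)
  have AE_I: "AE y in law u. y \<in> I"
    unfolding law_def using e by (subst AE_density) (auto simp: u_def indicator_def)
  \<comment> \<open>The local bound on the power gives \<open>u\<close> the moment that
    \<open>admissible_const\<close> asks for.\<close>
  have int_pow: "integrable (law u) (\<lambda>y. \<bar>y\<bar> powr alpha c)"
    by (rule law.integrable_const_bound[where B = "\<bar>x\<bar> powr alpha c + 1"])
      (use AE_I in \<open>auto elim!: eventually_mono dest: I(2)\<close>)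
  have int_phi: "integrable (law u) (\<lambda>y. (phi c j y)\<^sup>2)" for j
    by (rule law.integrable_const_bound[where B = "C * real (Suc j)"])
      (use admissible_phi_sq_bound[OF adm] in \<open>auto simp del: of_nat_Suc\<close>)
  have "(\<Sum>j<k. \<integral>y. (phi c j y)\<^sup>2 \<partial>law u) \<le> C * v_mom c u * sqrt (real k)"
    using adm k dens int_pow unfolding admissible_const_def by blast
  moreover have pU: "law.prob UNIV = 1" using law.prob_space by simp
  ultimately have "(\<integral>y. g y \<partial>law u) \<le> 0"
    unfolding g_def v_mom_def using int_phi int_pow
    by (simp add: Bochner_Integration.integral_sum algebra_simps)
  moreover have "(\<integral>y. g x / 2 \<partial>law u) \<le> (\<integral>y. g y \<partial>law u)"
  proof (rule integral_mono_AE)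
    show "integrable (law u) g" unfolding g_def[abs_def] using int_phi int_pow by simp
    show "AE y in law u. g x / 2 \<le> g y" using AE_I by (rule eventually_mono) (use I(3) in force)
  qed simp
  ultimately show False using gx by (simp add: pU)
qed

subsection \<open>Oracle inequality for the weights\<close>

lemma sum_inverse_squares_le: "(\<Sum>k=1..M. 1 / (real k)\<^sup>2) \<le> 2"
proof -
  have le: "(\<Sum>k=1..Suc M. 1 / (real k)\<^sup>2) \<le> 2 - 1 / real (Suc M)" for M
  proof (induction M)
    case (Suc M)
    have "1 / (real (Suc (Suc M)))\<^sup>2 \<le> 1 / (real (Suc M) * real (Suc (Suc M)))"
      by (intro divide_left_mono) (auto simp: power2_eq_square)
    also have "\<dots> = 1 / real (Suc M) - 1 / real (Suc (Suc M))" by (simp add: field_simps)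
    finally show ?case using Suc by simp
  qed simp
  show ?thesis
  proof (cases M)
    case (Suc m)
    have "0 \<le> 1 / real (Suc m)" by simp
    then show ?thesis using le[of m] unfolding Suc by linarith
  qed simp
qed

text \<open>The fourth term of the exponential series at sqrt k / 2; 384 = 4! * 2^4.\<close>

lemma exp_neg_half_sqrt_le:
  assumes "k \<ge> 1"
  shows "exp (- sqrt (real k) / 2) \<le> 384 * (1 / (real k)\<^sup>2)"
proof -
  have "(sqrt (real k) / 2) ^ 4 \<le> fact 4 / 1 ^ 4 * exp (1 * \<bar>sqrt (real k) / 2\<bar>)"
    using power_le_exp_mult[of 1 "sqrt (real k) / 2" 4] by simp
  moreover have "(sqrt (real k)) ^ 4 = (real k)\<^sup>2"
    using power_mult[of "sqrt (real k)" 2 2] by simp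
  ultimately have "(real k)\<^sup>2 \<le> 384 * exp (sqrt (real k) / 2)"
    by (simp add: power_divide fact_numeral)
  then show ?thesis using assms by (simp add: exp_minus field_simps)
qed

text \<open>The entropy term of the Gibbs weights costs \<open>\<Sum> w\<^sub>k \<surd>k\<close>, which the penalty can
  absorb, instead of the usual \<open>ln M\<close>.\<close>

lemma exponential_weights_oracle:
  fixes r :: "nat \<Rightarrow> real" and \<kappa> N :: real
  assumes \<kappa>: "\<kappa> \<ge> 1" and N: "N > 0" and l: "l \<in> {1..M}"
  defines "w \<equiv> \<lambda>k. exp (- \<kappa> * N * r k) / (\<Sum>i=1..M. exp (- \<kappa> * N * r i))"
  shows "(\<Sum>k=1..M. w k * r k) \<le> r l + ((\<Sum>k=1..M. w k * sqrt (real k)) + 768) / N"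
proof -
  define Z where "Z = (\<Sum>i=1..M. exp (- \<kappa> * N * r i))"
  define D where "D k = \<kappa> * N * (r k - r l)" for k
  have Zl: "exp (- \<kappa> * N * r l) \<le> Z"
    unfolding Z_def using l by (intro member_le_sum) auto
  then have Z: "0 < Z" using exp_gt_zero order_less_le_trans by blast
  have w_nonneg: "0 \<le> w k" for k unfolding w_def by (intro divide_nonneg_nonneg sum_nonneg) auto
  have w1: "(\<Sum>k=1..M. w k) = 1"
    using Z unfolding w_def Z_def[symmetric] sum_divide_distrib[symmetric] by simp
  have w_le: "w k \<le> exp (- D k)" for k
  proof -
    have "w k \<le> exp (- \<kappa> * N * r k) / exp (- \<kappa> * N * r l)"
      unfolding w_def Z_def[symmetric] using Zl by (intro divide_left_mono mult_pos_pos Z) auto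
    also have "\<dots> = exp (- D k)" by (simp add: D_def algebra_simps flip: exp_diff)
    finally show ?thesis .
  qed
  \<comment> \<open>A small \<open>D k\<close> is charged to the entropy sum. For a large one, w <=
    exp(-D) and D <= exp(D/2) give w D <= exp(-D/2), below a summable sequence that depends on k
    alone.\<close>
  have wD: "w k * D k \<le> w k * sqrt (real k) + exp (- sqrt (real k) / 2)" for k
  proof (cases "D k \<le> sqrt (real k)")
    case True
    then show ?thesis using mult_left_mono[OF True w_nonneg[of k]] by (simp add: add_increasing2)
  next
    case False
    then have D: "0 \<le> D k" using real_sqrt_ge_zero[of "real k"] by linarith
    have "D k / 2 * 2 \<le> 1 + D k / 2 + (D k / 2)\<^sup>2 / 2"
      using zero_le_power2[of "D k / 2 - 1"] by (simp add: power2_eq_square algebra_simps)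
    also have "\<dots> \<le> exp (D k / 2)" using D exp_lower_Taylor_quadratic[of "D k / 2"] by simp
    finally have "D k \<le> exp (D k / 2)" by simp
    then have "w k * D k \<le> exp (- D k) * exp (D k / 2)"
      using w_le[of k] D w_nonneg by (intro mult_mono) auto
    also have "\<dots> = exp (- D k / 2)" by (simp flip: exp_add)
    also have "\<dots> \<le> exp (- sqrt (real k) / 2)" using False by simp
    finally show ?thesis using mult_nonneg_nonneg[OF w_nonneg[of k], of "sqrt (real k)"] by simp
  qed
  have "\<kappa> * N * (\<Sum>k=1..M. w k * (r k - r l)) = (\<Sum>k=1..M. w k * D k)"
    unfolding D_def sum_distrib_left by (simp add: mult_ac)
  also have "\<dots> \<le> (\<Sum>k=1..M. w k * sqrt (real k) + exp (- sqrt (real k) / 2))"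
    by (intro sum_mono wD)
  also have "\<dots> \<le> (\<Sum>k=1..M. w k * sqrt (real k)) + (\<Sum>k=1..M. 384 * (1 / (real k)\<^sup>2))"
    unfolding sum.distrib by (intro add_left_mono sum_mono exp_neg_half_sqrt_le) auto
  also have "\<dots> \<le> (\<Sum>k=1..M. w k * sqrt (real k)) + 768"
    using sum_inverse_squares_le[of M] unfolding sum_distrib_left[symmetric] by simp
  finally have le: "\<kappa> * N * (\<Sum>k=1..M. w k * (r k - r l)) \<le> (\<Sum>k=1..M. w k * sqrt (real k)) + 768"
    (is "_ \<le> ?R") .
  have "0 \<le> ?R" using w_nonneg by (intro add_nonneg_nonneg sum_nonneg mult_nonneg_nonneg) auto
  have "(\<Sum>k=1..M. w k * (r k - r l)) \<le> ?R / (\<kappa> * N)"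
    using le \<kappa> N by (simp add: field_simps)
  also have "\<dots> \<le> ?R / N"
    using \<kappa> N \<open>0 \<le> ?R\<close> by (intro divide_left_mono) auto
  finally have "(\<Sum>k=1..M. w k * (r k - r l)) \<le> ?R / N" .
  moreover have "(\<Sum>k=1..M. w k * (r k - r l)) = (\<Sum>k=1..M. w k * r k) - r l"
    using w1 by (simp add: right_diff_distrib sum_subtractf flip: sum_distrib_right)
  ultimately show ?thesis by simp
qed

lemma bayes_weights_nonneg: "0 \<le> bayes_weights c \<Delta> \<kappa> n X k"
  unfolding bayes_weights_def by (intro divide_nonneg_nonneg sum_nonneg) auto

lemma bayes_weights_sum:
  assumes "max_dim c n \<ge> 1"
  shows "(\<Sum>k=1..max_dim c n. bayes_weights c \<Delta> \<kappa> n X k) = 1"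
proof -
  have "0 < (\<Sum>l=1..max_dim c n. exp (- \<kappa> * real n * crit c \<Delta> n X l))"
    using assms by (intro sum_pos) auto
  then show ?thesis unfolding bayes_weights_def sum_divide_distrib[symmetric] by simp
qed

lemma k_hat_minimises:
  assumes "max_dim c n \<ge> 1"
  shows "k_hat c \<Delta> n X \<in> {1..max_dim c n} \<and>
    (\<forall>l\<in>{1..max_dim c n}. crit c \<Delta> n X (k_hat c \<Delta> n X) \<le> crit c \<Delta> n X l)"
  unfolding k_hat_def
proof (rule LeastI_ex)
  have "finite {1..max_dim c n}" "{1..max_dim c n} \<noteq> {}" using assms by auto
  from ex_is_arg_min_if_finite[OF this, of "crit c \<Delta> n X"]
  show "\<exists>k. k \<in> {1..max_dim c n} \<and> (\<forall>l\<in>{1..max_dim c n}. crit c \<Delta> n X k \<le> crit c \<Delta> n X l)"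
    by (auto simp: is_arg_min_linorder)
qed

text \<open>The only properties through which the two kinds of weights enter the risk bound. Model
  selection attains the minimum of \<open>crit\<close> and so satisfies the last one with
  slack.\<close>

lemma weights_oracle:
  assumes w: "w = bayes_weights c \<Delta> \<kappa> \<or> w = ms_weights c \<Delta>" and \<kappa>: "\<kappa> \<ge> 1"
    and n: "n > 0" and M: "max_dim c n \<ge> 1"
  shows "0 \<le> w n X k"
    and "(\<Sum>k=1..max_dim c n. w n X k) = 1"
    and "l \<in> {1..max_dim c n} \<Longrightarrow> (\<Sum>k=1..max_dim c n. w n X k * crit c \<Delta> n X k)
      \<le> crit c \<Delta> n X l + ((\<Sum>k=1..max_dim c n. w n X k * sqrt (real k)) + 768) / n"
proof -
  show w0: "0 \<le> w n X k" for k using w bayes_weights_nonneg by (auto simp: ms_weights_def)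
  have kh: "k_hat c \<Delta> n X \<in> {1..max_dim c n}" using k_hat_minimises[OF M] by blast
  show "(\<Sum>k=1..max_dim c n. w n X k) = 1"
    using w bayes_weights_sum[OF M] kh by (auto simp: ms_weights_def sum.delta)
  assume l: "l \<in> {1..max_dim c n}"
  show "(\<Sum>k=1..max_dim c n. w n X k * crit c \<Delta> n X k)
      \<le> crit c \<Delta> n X l + ((\<Sum>k=1..max_dim c n. w n X k * sqrt (real k)) + 768) / n"
    using w
  proof
    assume "w = bayes_weights c \<Delta> \<kappa>"
    then show ?thesis
      using exponential_weights_oracle[OF \<kappa>, of "real n" l "max_dim c n" "crit c \<Delta> n X"] n l
      by (simp add: bayes_weights_def)
  next
    assume ms: "w = ms_weights c \<Delta>"
    have "(\<Sum>k=1..max_dim c n. w n X k * crit c \<Delta> n X k) = (\<Sum>k=1..max_dim c n. if k = k_hat c \<Delta> n X then crit c \<Delta> n X k else 0)"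
      by (intro sum.cong) (auto simp: ms ms_weights_def)
    also have "\<dots> = crit c \<Delta> n X (k_hat c \<Delta> n X)" using kh by (simp add: sum.delta)
    also have "\<dots> \<le> crit c \<Delta> n X l" using k_hat_minimises[OF M] l by blast
    also have "\<dots> \<le> crit c \<Delta> n X l + ((\<Sum>k=1..max_dim c n. w n X k * sqrt (real k)) + 768) / n"
      using w0 by (simp add: sum_nonneg)
    finally show ?thesis .
  qed
qed

text \<open>Young's inequality with factors 1/2 and 2: the factor 1/2 on the squared coefficients
  lets the bias be absorbed into half of the loss.\<close>

lemma cross_term_bound:
  fixes a e :: "nat \<Rightarrow> real"
  assumes "k \<le> l"
  shows "\<bar>2 * ((\<Sum>j<l. a j * e j) - (\<Sum>j<k. a j * e j))\<bar>
    \<le> ((\<Sum>j<l. (a j)\<^sup>2) - (\<Sum>j<k. (a j)\<^sup>2)) / 2 + 2 * ((\<Sum>j<l. (e j)\<^sup>2) - (\<Sum>j<k. (e j)\<^sup>2))"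
proof -
  have split: "(\<Sum>j<l. g j) - (\<Sum>j<k. g j) = (\<Sum>j=k..<l. g j)" for g :: "nat \<Rightarrow> real"
    using sum_diff_nat_ivl[of 0 k l g] assms by (simp add: atLeast0LessThan)
  have "\<bar>2 * (\<Sum>j=k..<l. a j * e j)\<bar> \<le> (\<Sum>j=k..<l. \<bar>2 * (a j * e j)\<bar>)"
    unfolding sum_distrib_left by (rule sum_abs)
  also have "\<dots> \<le> (\<Sum>j=k..<l. (a j)\<^sup>2 / 2 + 2 * (e j)\<^sup>2)"
  proof (rule sum_mono)
    fix j
    show "\<bar>2 * (a j * e j)\<bar> \<le> (a j)\<^sup>2 / 2 + 2 * (e j)\<^sup>2"
      using zero_le_power2[of "a j - 2 * e j"] zero_le_power2[of "a j + 2 * e j"]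
      by (simp add: abs_le_iff power2_eq_square algebra_simps)
  qed
  finally show ?thesis unfolding split by (simp add: sum.distrib sum_divide_distrib sum_distrib_left)
qed

text \<open>Expanding the empirical norm shows that \<open>r k\<close> underestimates the loss, up
  to constants and the penalty, by 2 S plus a linear noise term, and that term costs another 2 S:
  the penalty must pay for 4 S. It also costs half of the loss, whose absorption on the left doubles
  all other terms.\<close>

lemma deterministic_oracle:
  fixes a ah :: "nat \<Rightarrow> real" and pen w :: "nat \<Rightarrow> real" and N E :: real
  defines "S \<equiv> \<lambda>k. \<Sum>j<k. (ah j - a j)\<^sup>2" and "B \<equiv> \<lambda>k. N - (\<Sum>j<k. (a j)\<^sup>2)"
  defines "r \<equiv> \<lambda>k. - (\<Sum>j<k. (ah j)\<^sup>2) + pen k"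
  assumes B: "\<And>k. 0 \<le> B k" and w: "\<And>k. k \<in> I \<Longrightarrow> 0 \<le> w k" and w1: "(\<Sum>k\<in>I. w k) = 1"
    and r: "(\<Sum>k\<in>I. w k * r k) \<le> r l + E"
  shows "(\<Sum>k\<in>I. w k * (S k + B k)) \<le>
    3 * B l + 2 * S l + 2 * pen l + 2 * E + 2 * (\<Sum>k\<in>I. w k * (4 * S k - pen k))"
proof -
  define L where "L k = (\<Sum>j<k. a j * (ah j - a j))" for k
  have r_eq: "r k = S k + B k - N - 2 * S k - 2 * L k + pen k" for k
    unfolding r_def S_def B_def L_def
    by (simp add: power2_eq_square algebra_simps sum.distrib sum_subtractf sum_distrib_left)
  have S: "0 \<le> S k" for k unfolding S_def by (simp add: sum_nonneg)
  have cb: "\<bar>2 * (L m - L k)\<bar> \<le> (B k - B m) / 2 + 2 * (S m - S k)" if "k \<le> m" for k m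
    using cross_term_bound[OF that, of a "\<lambda>j. ah j - a j"] by (simp add: L_def S_def B_def)
  \<comment> \<open>The difference of the linear terms sees only the indices between k and l; the
    two orders of k and l give the same bound once nonnegative terms are added.\<close>
  have cross: "2 * (L k - L l) \<le> (S k + B k) / 2 + B l / 2 + 2 * S k + 2 * S l" for k
  proof (cases "k \<le> l")
    case True
    then show ?thesis using abs_le_D2[OF cb[OF True]] B[of l] B[of k] S[of k] S[of l] by argo
  next
    case False
    then have lk: "l \<le> k" by simp
    show ?thesis using abs_le_D1[OF cb[OF lk]] B[of l] B[of k] S[of k] S[of l] by argo
  qed
  have "(\<Sum>k\<in>I. w k * ((S k + B k) / 2)) \<le>
    (\<Sum>k\<in>I. w k * (r k - r l) + w k * (3 / 2 * B l + S l + pen l) + w k * (4 * S k - pen k))"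
  proof (rule sum_mono)
    fix k assume k: "k \<in> I"
    have "(S k + B k) / 2 \<le> (r k - r l) + (3 / 2 * B l + S l + pen l) + (4 * S k - pen k)"
      using cross[of k] unfolding r_eq by argo
    from mult_left_mono[OF this w[OF k]]
    show "w k * ((S k + B k) / 2) \<le> w k * (r k - r l) + w k * (3 / 2 * B l + S l + pen l) + w k * (4 * S k - pen k)"
      by (simp only: distrib_left)
  qed
  also have "\<dots> = (\<Sum>k\<in>I. w k * r k) - r l + (3 / 2 * B l + S l + pen l) + (\<Sum>k\<in>I. w k * (4 * S k - pen k))"
    using w1 by (simp add: sum.distrib right_diff_distrib sum_subtractf flip: sum_distrib_right)
  finally have "(\<Sum>k\<in>I. w k * ((S k + B k) / 2)) \<le>
    (\<Sum>k\<in>I. w k * r k) - r l + (3 / 2 * B l + S l + pen l) + (\<Sum>k\<in>I. w k * (4 * S k - pen k))" .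
  moreover have "(\<Sum>k\<in>I. w k * ((S k + B k) / 2)) = (\<Sum>k\<in>I. w k * (S k + B k)) / 2"
    by (simp add: sum_divide_distrib)
  ultimately show ?thesis using r by linarith
qed

subsection \<open>Stochastic error\<close>

lemma (in prob_space) iid_sum_square:
  fixes h :: "'a \<Rightarrow> real" and n :: nat
  assumes [measurable]: "h \<in> borel_measurable M" and h2: "integrable M (\<lambda>x. (h x)\<^sup>2)" and mean: "(\<integral>x. h x \<partial>M) = 0"
  shows "integrable (PiM {1..n} (\<lambda>_. M)) (\<lambda>X. (\<Sum>l=1..n. h (X l))\<^sup>2)"
    and "(\<integral>X. (\<Sum>l=1..n. h (X l))\<^sup>2 \<partial>PiM {1..n} (\<lambda>_. M)) = n * (\<integral>x. (h x)\<^sup>2 \<partial>M)"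
proof -
  interpret P: product_sigma_finite "\<lambda>_::nat. M"
    by (simp add: product_sigma_finite_def sigma_finite_measure_axioms)
  have h1: "integrable M h"
    using integrable_mult_L2[of h M "\<lambda>_. 1"] h2 by simp
  \<comment> \<open>Spreads h(X_l) h(X_m) over all coordinates, with 1 elsewhere and h^2 when l = m,
    so that the integral of a product of coordinate functions factorises.\<close>
  define g where "g l m i y = (if i = l then h y else 1) * (if i = m then h y else 1)" for l m i :: nat and y
  have g_int: "integrable M (g l m i)" for l m i
    unfolding g_def using h1 h2 by (cases "i = l"; cases "i = m") (auto simp: power2_eq_square)
  have g_eq: "h (X l) * h (X m) = (\<Prod>i=1..n. g l m i (X i))" if "l \<in> {1..n}" "m \<in> {1..n}" for l m X
    unfolding g_def prod.distrib using that by (simp add: prod.delta)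
  have sq: "(\<Sum>l=1..n. h (X l))\<^sup>2 = (\<Sum>l=1..n. \<Sum>m=1..n. \<Prod>i=1..n. g l m i (X i))" for X
    unfolding power2_eq_square sum_product by (intro sum.cong refl g_eq)
  have int: "integrable (PiM {1..n} (\<lambda>_. M)) (\<lambda>X. \<Prod>i=1..n. g l m i (X i))" for l m
    by (intro P.product_integrable_prod g_int) simp
  show "integrable (PiM {1..n} (\<lambda>_. M)) (\<lambda>X. (\<Sum>l=1..n. h (X l))\<^sup>2)"
    unfolding sq by (intro Bochner_Integration.integrable_sum int)
  have prod_int: "(\<integral>X. (\<Prod>i=1..n. g l m i (X i)) \<partial>PiM {1..n} (\<lambda>_. M)) = (if l = m then \<integral>x. (h x)\<^sup>2 \<partial>M else 0)"
    if lm: "l \<in> {1..n}" "m \<in> {1..n}" for l m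
  proof -
    have "(\<integral>X. (\<Prod>i=1..n. g l m i (X i)) \<partial>PiM {1..n} (\<lambda>_. M)) = (\<Prod>i=1..n. \<integral>x. g l m i x \<partial>M)"
      by (intro P.product_integral_prod g_int) simp
    also have "\<dots> = (if l = m then \<integral>x. (h x)\<^sup>2 \<partial>M else 0)"
    proof (cases "l = m")
      case True
      then have "(\<integral>x. g l m i x \<partial>M) = (if i = l then \<integral>x. (h x)\<^sup>2 \<partial>M else 1)" for i
        by (simp add: g_def power2_eq_square prob_space)
      then show ?thesis using True lm by (simp add: prod.delta)
    next
      case False
      then have "(\<integral>x. g l m l x \<partial>M) = 0" unfolding g_def using mean by simp
      then show ?thesis using False lm by (auto intro!: prod_zero)
    qed
    finally show ?thesis .
  qed
  have "(\<integral>X. (\<Sum>l=1..n. h (X l))\<^sup>2 \<partial>PiM {1..n} (\<lambda>_. M)) =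
     (\<Sum>l=1..n. \<Sum>m=1..n. \<integral>X. (\<Prod>i=1..n. g l m i (X i)) \<partial>PiM {1..n} (\<lambda>_. M))"
    unfolding sq using int by (simp add: Bochner_Integration.integral_sum)
  also have "\<dots> = (\<Sum>l=1..n. \<Sum>m=1..n. if l = m then \<integral>x. (h x)\<^sup>2 \<partial>M else 0)"
    by (intro sum.cong refl prod_int)
  also have "\<dots> = n * (\<integral>x. (h x)\<^sup>2 \<partial>M)" by (simp add: sum.delta)
  finally show "(\<integral>X. (\<Sum>l=1..n. h (X l))\<^sup>2 \<partial>PiM {1..n} (\<lambda>_. M)) = n * (\<integral>x. (h x)\<^sup>2 \<partial>M)" .
qed

lemma (in prob_space) PiM_component_integral:
  fixes h :: "'a \<Rightarrow> real"
  assumes h: "integrable M h" and l: "l \<in> I" and I: "finite I"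
  shows "integrable (PiM I (\<lambda>_. M)) (\<lambda>X. h (X l))"
    and "(\<integral>X. h (X l) \<partial>PiM I (\<lambda>_. M)) = (\<integral>x. h x \<partial>M)"
proof -
  interpret P: product_prob_space "\<lambda>_. M" I
    by unfold_locales
  have d: "distr (PiM I (\<lambda>_. M)) M (\<lambda>X. X l) = M"
    using P.PiM_component[OF l] by simp
  have [measurable]: "h \<in> borel_measurable M" using h by auto
  have m: "(\<lambda>X. X l) \<in> measurable (PiM I (\<lambda>_. M)) M" using l by measurable
  show "integrable (PiM I (\<lambda>_. M)) (\<lambda>X. h (X l))"
    using integrable_distr[OF m, of h] h d by simp
  show "(\<integral>X. h (X l) \<partial>PiM I (\<lambda>_. M)) = (\<integral>x. h x \<partial>M)"
    using integral_distr[OF m, of h] d by simp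
qed

text \<open>Here s stands for sqrt k, 4 C s^2 for the envelope, and the denominator is (n H)^3 n^2.
  The constant is 3 * 256 * 8; G^3 arises as G^2 from the first bracket times G from the
  second.\<close>

lemma fourth_moment_ratio:
  fixes n s C F G v :: real
  assumes n: "1 \<le> n" and s: "1 \<le> s" "s \<le> 2 * n" and C: "1 \<le> C" and F: "0 \<le> F" "F \<le> G" "1 \<le> G" and v: "1 \<le> v"
  defines "H \<equiv> C * v * s"
  shows "3 * n * (256 * n * F\<^sup>2 + 48 * F * (4 * C * s\<^sup>2)) * (2 * n\<^sup>2 * H\<^sup>2 + 2 * n * (4 * C * s\<^sup>2) * H + 4 * F * n\<^sup>2 * H) / (n ^ 5 * H ^ 3)
    \<le> 6144 * C\<^sup>2 * G ^ 3 * (2 / (n * s) + 5 * s / n\<^sup>2)"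
proof -
  have Cv: "1 \<le> C * v" using C v mult_mono[of 1 C 1 v] by simp
  have H: "s \<le> H" unfolding H_def using mult_right_mono[OF Cv, of s] s by simp
  then have H1: "1 \<le> H" using s by simp
  have FG: "F\<^sup>2 \<le> C * G\<^sup>2" "F * C \<le> C * G\<^sup>2"
  proof -
    have "F\<^sup>2 \<le> G\<^sup>2" using F by (intro power_mono) auto
    also have "\<dots> \<le> C * G\<^sup>2" using C mult_right_mono[OF C, of "G\<^sup>2"] by simp
    finally show "F\<^sup>2 \<le> C * G\<^sup>2" .
    have "F \<le> G\<^sup>2" using F mult_mono[of 1 G F G] by (simp add: power2_eq_square)
    then show "F * C \<le> C * G\<^sup>2" using C mult_left_mono[of F "G\<^sup>2" C] by (simp add: mult.commute)
  qed
  have A: "256 * n * F\<^sup>2 + 48 * F * (4 * C * s\<^sup>2) \<le> 256 * (C * G\<^sup>2) * (n + s\<^sup>2)"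
  proof -
    have "n * F\<^sup>2 \<le> n * (C * G\<^sup>2)" using n FG by (intro mult_left_mono) auto
    moreover have "F * C * s\<^sup>2 \<le> C * G\<^sup>2 * s\<^sup>2" using FG by (intro mult_right_mono) auto
    moreover have "0 \<le> C * G\<^sup>2 * s\<^sup>2" using C by simp
    ultimately show ?thesis by (simp add: algebra_simps)
  qed
  have CG: "1 \<le> C * G" "C \<le> C * G" "F \<le> C * G"
    using C F mult_mono[of 1 C 1 G] mult_left_mono[of 1 G C] mult_mono[of 1 C F G] by auto
  have B: "2 * n\<^sup>2 * H\<^sup>2 + 2 * n * (4 * C * s\<^sup>2) * H + 4 * F * n\<^sup>2 * H \<le> 8 * (C * G) * (n * H * (n * H + s\<^sup>2 + n))"
  proof -
    have "1 * (n\<^sup>2 * H\<^sup>2) \<le> (C * G) * (n\<^sup>2 * H\<^sup>2)" using CG by (intro mult_right_mono) auto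
    moreover have "C * (n * s\<^sup>2 * H) \<le> (C * G) * (n * s\<^sup>2 * H)" using CG n H1 by (intro mult_right_mono) auto
    moreover have "F * (n\<^sup>2 * H) \<le> (C * G) * (n\<^sup>2 * H)" using CG H1 by (intro mult_right_mono) auto
    moreover have "0 \<le> F * (n\<^sup>2 * H)" "0 \<le> n\<^sup>2 * H\<^sup>2" using F H1 by auto
    ultimately show ?thesis by (simp add: algebra_simps power2_eq_square)
  qed
  have "3 * n * (256 * n * F\<^sup>2 + 48 * F * (4 * C * s\<^sup>2)) * (2 * n\<^sup>2 * H\<^sup>2 + 2 * n * (4 * C * s\<^sup>2) * H + 4 * F * n\<^sup>2 * H)
      \<le> 3 * n * (256 * (C * G\<^sup>2) * (n + s\<^sup>2)) * (8 * (C * G) * (n * H * (n * H + s\<^sup>2 + n)))"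
    using A B n C F H1 by (intro mult_mono mult_left_mono mult_nonneg_nonneg add_nonneg_nonneg) auto
  then have "3 * n * (256 * n * F\<^sup>2 + 48 * F * (4 * C * s\<^sup>2)) * (2 * n\<^sup>2 * H\<^sup>2 + 2 * n * (4 * C * s\<^sup>2) * H + 4 * F * n\<^sup>2 * H) / (n ^ 5 * H ^ 3)
      \<le> 3 * n * (256 * (C * G\<^sup>2) * (n + s\<^sup>2)) * (8 * (C * G) * (n * H * (n * H + s\<^sup>2 + n))) / (n ^ 5 * H ^ 3)"
    using n H1 by (intro divide_right_mono) auto
  also have "\<dots> = 6144 * C\<^sup>2 * G ^ 3 * ((n + s\<^sup>2) / n ^ 3 * ((n * H + s\<^sup>2 + n) / H\<^sup>2))"
    using n H1 by (simp add: field_simps power2_eq_square power3_eq_cube eval_nat_numeral)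
  also have "\<dots> \<le> 6144 * C\<^sup>2 * G ^ 3 * ((n + s\<^sup>2) / n ^ 3 * (2 * n / s + 1))"
  proof (intro mult_left_mono)
    have "n * H / H\<^sup>2 = n / H" using H1 by (simp add: power2_eq_square)
    also have "\<dots> \<le> n / s" using H s n by (intro divide_left_mono) auto
    finally have "n * H / H\<^sup>2 \<le> n / s" .
    moreover have "s\<^sup>2 / H\<^sup>2 \<le> 1" using H H1 s by (simp add: power_mono)
    moreover have "n / H\<^sup>2 \<le> n / s"
    proof (rule divide_left_mono)
      have "1 * s \<le> H * H" using H H1 s by (intro mult_mono) auto
      then show "s \<le> H\<^sup>2" by (simp add: power2_eq_square)
    qed (use n s H1 in auto)
    ultimately show "(n * H + s\<^sup>2 + n) / H\<^sup>2 \<le> 2 * n / s + 1"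
      by (simp add: add_divide_distrib)
  qed (use n C F in auto)
  also have "(n + s\<^sup>2) / n ^ 3 * (2 * n / s + 1) = 2 / (n * s) + (1 + 2 * s) / n\<^sup>2 + s * s / (n * n\<^sup>2)"
    using n s by (simp add: field_simps power2_eq_square power3_eq_cube)
  also have "6144 * C\<^sup>2 * G ^ 3 * \<dots> \<le> 6144 * C\<^sup>2 * G ^ 3 * (2 / (n * s) + 5 * s / n\<^sup>2)"
  proof (intro mult_left_mono)
    have "(1 + 2 * s) / n\<^sup>2 \<le> 3 * s / n\<^sup>2" using s by (intro divide_right_mono) auto
    moreover have "s * s / (n * n\<^sup>2) \<le> s * (2 * n) / (n * n\<^sup>2)" using s n by (intro divide_right_mono mult_left_mono) auto
    moreover have "s * (2 * n) / (n * n\<^sup>2) = 2 * s / n\<^sup>2" using n by simp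
    ultimately have "(1 + 2 * s) / n\<^sup>2 + s * s / (n * n\<^sup>2) \<le> 3 * s / n\<^sup>2 + 2 * s / n\<^sup>2"
      by (intro add_mono) simp_all
    also have "\<dots> = 5 * s / n\<^sup>2" by (simp add: add_divide_distrib[symmetric])
    finally show "2 / (n * s) + (1 + 2 * s) / n\<^sup>2 + s * s / (n * n\<^sup>2) \<le> 2 / (n * s) + 5 * s / n\<^sup>2" by linarith
  qed (use C F in auto)
  finally show ?thesis .
qed

text \<open>Markov's inequality in integrated form: it bounds an expected excess directly, without
  integrating tail probabilities.\<close>

lemma positive_part_le_fourth_power:
  fixes u t :: real
  assumes "0 < t"
  shows "max 0 (u - t) \<le> u ^ 4 / t ^ 3"
proof (cases "u \<le> t")
  case False
  then have "t ^ 3 \<le> u ^ 3" using assms by (intro power_mono) auto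
  then have "u * t ^ 3 \<le> u * u ^ 3" using False assms by (intro mult_left_mono) auto
  then have "u \<le> u ^ 4 / t ^ 3" using assms by (simp add: field_simps power4_eq_xxxx power3_eq_cube)
  then show ?thesis using assms False by simp
qed (use assms in simp)

section \<open>Samples from a bounded density\<close>

locale density_sample = square_integrable_density +
  fixes C :: real and n :: nat
  assumes adm: "admissible_const c C" and n_pos: "0 < n" and bounded: "sup_norm f < \<infinity>"
    and moment: "integrable (law f) (\<lambda>x. \<bar>x\<bar> powr (2 * alpha c))"
begin

sublocale law: prob_space "law f" by (rule prob_space_law)

abbreviation "F \<equiv> enn2real (sup_norm f)"
abbreviation "v \<equiv> v_mom c f"
abbreviation "SL \<equiv> sample_law n f"

definition Y :: "real \<Rightarrow> nat \<Rightarrow> real" where "Y x j = phi c j x - coeff_a c f j"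

lemma C_ge_1: "1 \<le> C" using adm by (rule admissible_ge_1)

lemma pow_sq: "(\<bar>x\<bar> powr alpha c)\<^sup>2 = \<bar>x\<bar> powr (2 * alpha c)"
  using powr_add[of "\<bar>x\<bar>" "alpha c" "alpha c"] by (simp add: power2_eq_square)

lemma pow_integrable: "integrable (law f) (\<lambda>x. \<bar>x\<bar> powr alpha c)"
proof -
  have "integrable (law f) (\<lambda>x. (\<bar>x\<bar> powr alpha c)\<^sup>2)" unfolding pow_sq by (rule moment)
  then show ?thesis using integrable_mult_L2[of "\<lambda>x. \<bar>x\<bar> powr alpha c" "law f" "\<lambda>_. 1"] by simp
qed

lemma v_ge_1: "1 \<le> v" unfolding v_mom_def by simp

lemma phi_bmeas: "bmeas (law f) (phi c j)"
  unfolding bmeas_def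
proof (intro conjI exI ballI)
  show "\<bar>phi c j x\<bar> \<le> sqrt (C * real (Suc j))" for x
    using real_sqrt_le_mono[OF admissible_phi_sq_bound[OF adm, of j x]] by simp
qed simp

lemma phi_sum_sq_integral: "(\<integral>x. (\<Sum>j<k. (phi c j x)\<^sup>2) \<partial>law f) \<le> C * real k"
  and phi_sum_sq_integral': "k \<ge> 1 \<Longrightarrow> (\<integral>x. (\<Sum>j<k. (phi c j x)\<^sup>2) \<partial>law f) \<le> C * v * sqrt (real k)"
proof -
  have int: "integrable (law f) (\<lambda>x. \<Sum>j<k. (phi c j x)\<^sup>2)"
    by (intro law.bmeas_integrable bmeas_intros phi_bmeas)
  have "(\<integral>x. (\<Sum>j<k. (phi c j x)\<^sup>2) \<partial>law f) \<le> (\<integral>x. C * real k \<partial>law f)"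
    by (intro integral_mono int admissible_sup_bound adm) simp
  then show "(\<integral>x. (\<Sum>j<k. (phi c j x)\<^sup>2) \<partial>law f) \<le> C * real k"
    using law.prob_space by simp
  assume k: "k \<ge> 1"
  have "(\<integral>x. (\<Sum>j<k. (phi c j x)\<^sup>2) \<partial>law f) \<le> (\<integral>x. C * (\<bar>x\<bar> powr alpha c + 1) * sqrt (real k) \<partial>law f)"
    using pow_integrable by (intro integral_mono int admissible_pointwise adm k) simp
  also have "\<dots> = C * v * sqrt (real k)"
    using pow_integrable law.prob_space unfolding v_mom_def by simp
  finally show "(\<integral>x. (\<Sum>j<k. (phi c j x)\<^sup>2) \<partial>law f) \<le> C * v * sqrt (real k)" .
qed

lemma centered_sum_square:
  "(\<integral>x. (\<Sum>j<k. u j * Y x j)\<^sup>2 \<partial>law f) \<le> (\<integral>x. (\<Sum>j<k. u j * phi c j x)\<^sup>2 \<partial>law f)"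
proof -
  define g where "g x = (\<Sum>j<k. u j * phi c j x)" for x
  define m where "m = (\<Sum>j<k. u j * coeff_a c f j)"
  have g: "bmeas (law f) g" unfolding g_def by (intro bmeas_intros phi_bmeas)
  have m: "(\<integral>x. g x \<partial>law f) = m"
    unfolding g_def m_def coeff_law
    by (subst Bochner_Integration.integral_sum) (auto intro!: law.bmeas_integrable phi_bmeas)
  have "(\<integral>x. (\<Sum>j<k. u j * Y x j)\<^sup>2 \<partial>law f) = (\<integral>x. (g x)\<^sup>2 - 2 * m * g x + m\<^sup>2 \<partial>law f)"
    by (simp add: Y_def g_def m_def right_diff_distrib sum_subtractf power2_diff algebra_simps)
  also have "\<dots> = (\<integral>x. (g x)\<^sup>2 \<partial>law f) - m\<^sup>2"
    using law.bmeas_integrable[OF g] law.bmeas_integrable[OF bmeas_power[OF g, of 2]] law.prob_space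
    by (simp add: m) (simp add: power2_eq_square)
  finally show ?thesis unfolding g_def by simp
qed

lemma centered_trace:
  "(\<integral>x. (\<Sum>j<k. (Y x j)\<^sup>2) \<partial>law f) = (\<integral>x. (\<Sum>j<k. (phi c j x)\<^sup>2) \<partial>law f) - (\<Sum>j<k. (coeff_a c f j)\<^sup>2)"
proof -
  have "(\<Sum>j<k. (Y x j)\<^sup>2) = (\<Sum>j<k. (phi c j x)\<^sup>2) - (\<Sum>j<k. 2 * coeff_a c f j * phi c j x) + (\<Sum>j<k. (coeff_a c f j)\<^sup>2)" for x
    by (simp add: Y_def power2_diff sum.distrib sum_subtractf mult_ac)
  then have "(\<integral>x. (\<Sum>j<k. (Y x j)\<^sup>2) \<partial>law f) = (\<integral>x. (\<Sum>j<k. (phi c j x)\<^sup>2) \<partial>law f)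
     - (\<Sum>j<k. 2 * coeff_a c f j * (\<integral>x. phi c j x \<partial>law f)) + (\<Sum>j<k. (coeff_a c f j)\<^sup>2)"
    using law.bmeas_integrable[OF phi_bmeas] law.bmeas_integrable[OF bmeas_power[OF phi_bmeas, of _ 2]] law.prob_space
    by (simp add: Bochner_Integration.integral_sum)
  also have "(\<Sum>j<k. 2 * coeff_a c f j * (\<integral>x. phi c j x \<partial>law f)) = 2 * (\<Sum>j<k. (coeff_a c f j)\<^sup>2)"
    unfolding coeff_law[symmetric] by (simp add: sum_distrib_left power2_eq_square mult_ac)
  finally show ?thesis by simp
qed

lemma coeff_sum_sq_le: "(\<Sum>j<k. (coeff_a c f j)\<^sup>2) \<le> (\<integral>x. (\<Sum>j<k. (phi c j x)\<^sup>2) \<partial>law f)"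
proof -
  have "0 \<le> (\<integral>x. (\<Sum>j<k. (Y x j)\<^sup>2) \<partial>law f)" by (simp add: sum_nonneg)
  then show ?thesis unfolding centered_trace by simp
qed

lemma Y_sum_sq_le: "(\<Sum>j<k. (Y x j)\<^sup>2) \<le> 2 * (\<Sum>j<k. (phi c j x)\<^sup>2) + 2 * (\<Sum>j<k. (coeff_a c f j)\<^sup>2)"
proof -
  have "(\<Sum>j<k. (Y x j)\<^sup>2) \<le> (\<Sum>j<k. 2 * (phi c j x)\<^sup>2 + 2 * (coeff_a c f j)\<^sup>2)"
  proof (rule sum_mono)
    fix j
    show "(Y x j)\<^sup>2 \<le> 2 * (phi c j x)\<^sup>2 + 2 * (coeff_a c f j)\<^sup>2"
      using zero_le_power2[of "phi c j x + coeff_a c f j"]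
      by (simp add: Y_def power2_eq_square algebra_simps)
  qed
  then show ?thesis by (simp add: sum.distrib sum_distrib_left)
qed

text \<open>The operator norm is bounded by the sup norm because f <= F reduces the second moment to
  Lebesgue measure, under which the system is orthonormal. The envelope 4 C k is 2 C k each for
  basis functions and coefficients.\<close>

lemma centered_vector_sample:
  assumes k: "k \<ge> 1"
  shows "bounded_vector_sample (law f) Y {..<k} (4 * C * real k) (C * v * sqrt (real k)) F"
proof unfold_locales
  show "(\<lambda>x. Y x j) \<in> borel_measurable (law f)" for j unfolding Y_def by simp
  show "(\<Sum>j<k. (Y x j)\<^sup>2) \<le> 4 * C * real k" for x
    using Y_sum_sq_le[where k = k and x = x] admissible_sup_bound[OF adm, where k = k and x = x]
      coeff_sum_sq_le[of k] phi_sum_sq_integral[of k] by linarith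
  show "(\<integral>x. Y x j \<partial>law f) = 0" for j
    unfolding Y_def using law.bmeas_integrable[OF phi_bmeas] law.prob_space by (simp add: coeff_law)
  show "(\<integral>x. (\<Sum>j<k. (Y x j)\<^sup>2) \<partial>law f) \<le> C * v * sqrt (real k)"
    unfolding centered_trace using phi_sum_sq_integral'[OF k] by (smt (verit) sum_nonneg zero_le_power2)
  show "(\<integral>x. (\<Sum>j<k. u j * Y x j)\<^sup>2 \<partial>law f) \<le> F * (\<Sum>j<k. (u j)\<^sup>2)" for u
  proof -
    have s: "integrable lborel (\<lambda>x. (\<Sum>j<k. u j * phi c j x)\<^sup>2)" "(\<integral>x. (\<Sum>j<k. u j * phi c j x)\<^sup>2 \<partial>lborel) = (\<Sum>j<k. (u j)\<^sup>2)"
      by (intro orthonormal_sum_square phi_orthonormal; simp)+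
    have "(\<integral>x. (\<Sum>j<k. u j * Y x j)\<^sup>2 \<partial>law f) \<le> (\<integral>x. (\<Sum>j<k. u j * phi c j x)\<^sup>2 \<partial>law f)"
      by (rule centered_sum_square)
    also have "\<dots> = (\<integral>x. f x * (\<Sum>j<k. u j * phi c j x)\<^sup>2 \<partial>lborel)"
      by (rule law_integral) measurable
    also have "\<dots> \<le> (\<integral>x. F * (\<Sum>j<k. u j * phi c j x)\<^sup>2 \<partial>lborel)"
    proof (rule integral_mono_AE')
      show "AE x in lborel. f x * (\<Sum>j<k. u j * phi c j x)\<^sup>2 \<le> F * (\<Sum>j<k. u j * phi c j x)\<^sup>2"
        using abs_le_sup_norm[OF bounded] by (intro AE_I2 mult_right_mono) (auto simp: abs_le_iff)
    qed (use s f_nonneg in auto)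
    also have "\<dots> = F * (\<Sum>j<k. (u j)\<^sup>2)" using s by simp
    finally show ?thesis .
  qed
qed (use enn2real_nonneg in auto)

end

text \<open>In the Laguerre case e <= 3 gives 600 ln n >= 1, so the negative power is at most 1. The
  bound ensures sqrt k <= n.\<close>

lemma max_dim_le: 
  assumes "n \<ge> 3" shows "max_dim c n \<le> n\<^sup>2"
proof (cases c)
  case Laguerre
  have "1 \<le> ln (3::real)"
    using exp_le by (subst ln_ge_iff) auto
  also have "\<dots> \<le> ln (real n)" using assms by simp
  finally have "1 \<le> 600 * ln (real n)" by simp
  then have "(600 * ln (real n)) powr (-4) \<le> 1"
    using powr_mono[of "-4" 0 "600 * ln (real n)"] by simp
  then have "(real n)\<^sup>2 * (600 * ln (real n)) powr (-4) \<le> (real n)\<^sup>2"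
    by (intro mult_left_le) auto
  then have "\<lfloor>(real n)\<^sup>2 * (600 * ln (real n)) powr (-4)\<rfloor> \<le> int (n\<^sup>2)"
    by (simp add: floor_le_iff)
  then show ?thesis unfolding Laguerre max_dim.simps by (simp add: nat_le_iff)
qed simp

section \<open>Simultaneous control of the coefficient errors\<close>

context density_sample
begin

text \<open>This is \<open>offdiag\<close> for the index set \<open>{..<k}\<close>, restated as a
  function of k because each dimension is a separate interpretation of the locale.\<close>

definition U :: "nat \<Rightarrow> (nat \<Rightarrow> real) \<Rightarrow> real" where
  "U k X = (\<Sum>j<k. (\<Sum>l=1..n. Y (X l) j)\<^sup>2) - (\<Sum>l=1..n. \<Sum>j<k. (Y (X l) j)\<^sup>2)"

abbreviation "G \<equiv> max F 1"

lemma sum_Y_eq: "(\<Sum>l=1..n. Y (X l) j) = real n * (a_hat c n X j - coeff_a c f j)"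
  using n_pos by (simp add: Y_def a_hat_def sum_subtractf algebra_simps)

lemma err_eq: "(\<Sum>j<k. (\<Sum>l=1..n. Y (X l) j)\<^sup>2) = (real n)\<^sup>2 * err n X k"
  unfolding sum_Y_eq err_def by (simp add: power_mult_distrib sum_distrib_left)

sublocale SL: prob_space SL
  unfolding sample_law_def by (intro prob_space_PiM law.prob_space_axioms)

lemma err_moment:
  assumes k: "k \<ge> 1"
  shows "integrable SL (\<lambda>X. err n X k)" and "(\<integral>X. err n X k \<partial>SL) \<le> C * v * sqrt (real k) / n"
proof -
  interpret B: bounded_vector_sample "law f" Y "{..<k}" "4 * C * real k" "C * v * sqrt (real k)" F
    by (rule centered_vector_sample[OF k])
  have PS: "B.PS n = SL" by (simp add: B.PS_def sample_law_def)
  have ns: "B.normsq n X = (real n)\<^sup>2 * err n X k" for X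
    unfolding B.normsq_def B.part_def by (rule err_eq)
  have e: "err n X k = B.normsq n X / (real n)\<^sup>2" for X using ns n_pos by simp
  have int: "integrable SL (B.normsq n)" using B.integrable_PS[OF B.bmeas_normsq] PS by metis
  show "integrable SL (\<lambda>X. err n X k)" unfolding e using int by simp
  have "(\<integral>X. err n X k \<partial>SL) = (\<integral>X. B.normsq n X \<partial>SL) / (real n)\<^sup>2"
    unfolding e by simp
  also have "\<dots> \<le> (n * (C * v * sqrt (real k))) / (real n)\<^sup>2"
    using B.normsq_moment[of n] unfolding PS by (intro divide_right_mono) auto
  finally show "(\<integral>X. err n X k \<partial>SL) \<le> C * v * sqrt (real k) / n"
    using n_pos by (simp add: power2_eq_square)
qed

text \<open>The threshold is H / n at k = 4^m, of the same order as the penalty; only what exceeds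
  it has to be small in expectation.\<close>

definition excess :: "nat \<Rightarrow> (nat \<Rightarrow> real) \<Rightarrow> real" where
  "excess m X = max 0 (U (4 ^ m) X / (real n)\<^sup>2 - C * v * 2 ^ m / n)"

lemma excess_moment:
  shows "integrable SL (excess m)"
    and "2 ^ m \<le> 2 * real n \<Longrightarrow>
      (\<integral>X. excess m X \<partial>SL) \<le> 6144 * C\<^sup>2 * G ^ 3 * (2 / (real n * 2 ^ m) + 5 * 2 ^ m / (real n)\<^sup>2)"
proof -
  have sq: "sqrt (real (4 ^ m)) = 2 ^ m"
    by (simp add: real_sqrt_power)
  have k4: "real (4 ^ m) = (2 ^ m)\<^sup>2"
    by (simp add: power2_eq_square flip: power_mult_distrib)
  interpret B: bounded_vector_sample "law f" Y "{..<4 ^ m}" "4 * C * (2 ^ m)\<^sup>2" "C * v * 2 ^ m" F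
    using centered_vector_sample[of "4 ^ m"] unfolding sq k4 by simp
  have PS: "B.PS n = SL" by (simp add: B.PS_def sample_law_def)
  have U_eq: "U (4 ^ m) = B.offdiag n"
    unfolding U_def[abs_def] B.offdiag_def[abs_def] B.normsq_def B.diag_def B.part_def by (rule refl)
  have Ub: "bmeas SL (U (4 ^ m))" using B.bmeas_offdiag[of n] unfolding PS U_eq .
  define H where "H = C * v * 2 ^ m"
  have H: "0 < H" unfolding H_def using C_ge_1 v_ge_1 by simp
  have nn: "1 \<le> real n" using n_pos by simp
  have excess_eq: "excess m X = max 0 (U (4 ^ m) X - n * H) / (real n)\<^sup>2" for X
    unfolding excess_def H_def[symmetric] using nn
    by (auto simp: max_def field_simps power2_eq_square)
  show int: "integrable SL (excess m)"
    unfolding excess_def[abs_def] using SL.bmeas_integrable[OF Ub] by (intro integrable_max) auto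
  assume m: "2 ^ m \<le> 2 * real n"
  have "(\<integral>X. excess m X \<partial>SL) \<le> (\<integral>X. (U (4 ^ m) X) ^ 4 / (real n ^ 5 * H ^ 3) \<partial>SL)"
  proof (rule integral_mono[OF int])
    show "integrable SL (\<lambda>X. (U (4 ^ m) X) ^ 4 / (real n ^ 5 * H ^ 3))"
      using SL.bmeas_integrable[OF bmeas_power[OF Ub]] by simp
    fix X
    have "max 0 (U (4 ^ m) X - n * H) \<le> (U (4 ^ m) X) ^ 4 / (n * H) ^ 3"
      using nn H by (intro positive_part_le_fourth_power) auto
    then have "excess m X \<le> (U (4 ^ m) X) ^ 4 / (n * H) ^ 3 / (real n)\<^sup>2"
      unfolding excess_eq by (intro divide_right_mono) auto
    also have "\<dots> = (U (4 ^ m) X) ^ 4 / (real n ^ 5 * H ^ 3)"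
      by (simp add: power_mult_distrib power_add[symmetric] mult_ac)
    finally show "excess m X \<le> (U (4 ^ m) X) ^ 4 / (real n ^ 5 * H ^ 3)" .
  qed
  also have "\<dots> = (\<integral>X. (U (4 ^ m) X) ^ 4 \<partial>SL) / (real n ^ 5 * H ^ 3)" by simp
  also have "\<dots> \<le> 3 * real n * (256 * real n * F\<^sup>2 + 48 * F * (4 * C * (2 ^ m)\<^sup>2)) *
      (2 * (real n)\<^sup>2 * H\<^sup>2 + 2 * real n * (4 * C * (2 ^ m)\<^sup>2) * H + 4 * F * (real n)\<^sup>2 * H) / (real n ^ 5 * H ^ 3)"
    using B.offdiag_fourth_moment[OF n_pos] H unfolding PS U_eq[symmetric] H_def[symmetric]
    by (intro divide_right_mono) auto
  also have "\<dots> \<le> 6144 * C\<^sup>2 * G ^ 3 * (2 / (real n * 2 ^ m) + 5 * 2 ^ m / (real n)\<^sup>2)"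
    unfolding H_def by (rule fourth_moment_ratio) (use nn m C_ge_1 v_ge_1 in auto)
  finally show "(\<integral>X. excess m X \<partial>SL) \<le> 6144 * C\<^sup>2 * G ^ 3 * (2 / (real n * 2 ^ m) + 5 * 2 ^ m / (real n)\<^sup>2)" .
qed

text \<open>Levels up to this one reach dimension n^2, since 4^L >= n^2, while 2^L <= 2 n keeps all
  of them within the range of the fourth moment bound.\<close>

definition top_level :: nat where "top_level = (LEAST L. n \<le> 2 ^ L)"

lemma top_level_ge: "n \<le> 2 ^ top_level"
  unfolding top_level_def by (rule LeastI[of _ n]) (simp add: less_imp_le)

lemma top_level_le: "2 ^ top_level \<le> 2 * n"
proof (cases top_level)
  case (Suc L)
  then have "\<not> n \<le> 2 ^ L" unfolding top_level_def using not_less_Least[of L "\<lambda>L. n \<le> 2 ^ L"] by simp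
  then show ?thesis unfolding Suc by simp
qed (use n_pos in simp)

text \<open>A sum over levels, hence above the excess at each of them: one variable serves all k at
  once.\<close>

definition T :: "(nat \<Rightarrow> real) \<Rightarrow> real" where "T X = (\<Sum>m\<le>top_level. excess m X)"

lemma T_moment:
  shows "integrable SL T" and "(\<integral>X. T X \<partial>SL) \<le> 147456 * C\<^sup>2 * G ^ 3 / n"
proof -
  show "integrable SL T" unfolding T_def[abs_def] by (intro Bochner_Integration.integrable_sum excess_moment)
  have "(\<Sum>m\<le>L. (1/2) ^ m) = 2 - (1/2 :: real) ^ L" for L by (induction L) auto
  then have half: "(\<Sum>m\<le>top_level. (1/2 :: real) ^ m) \<le> 2" by simp
  have "(\<Sum>m\<le>L. 2 ^ m) \<le> 2 * (2::real) ^ L" for L by (induction L) auto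
  from this[of top_level] have double: "(\<Sum>m\<le>top_level. 2 ^ m) \<le> 4 * real n"
    using of_nat_mono[OF top_level_le, where 'a = real] by simp
  have "(\<integral>X. T X \<partial>SL) = (\<Sum>m\<le>top_level. \<integral>X. excess m X \<partial>SL)"
    unfolding T_def by (intro Bochner_Integration.integral_sum excess_moment)
  also have "\<dots> \<le> (\<Sum>m\<le>top_level. 6144 * C\<^sup>2 * G ^ 3 * (2 / (real n * 2 ^ m) + 5 * 2 ^ m / (real n)\<^sup>2))"
  proof (intro sum_mono excess_moment(2))
    fix m assume "m \<in> {..top_level}"
    then have "(2::nat) ^ m \<le> 2 ^ top_level" by (intro power_increasing) auto
    then have "2 ^ m \<le> 2 * n" using top_level_le by linarith
    then have "real (2 ^ m) \<le> real (2 * n)" by (simp only: of_nat_le_iff)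
    then show "2 ^ m \<le> 2 * real n" by simp
  qed
  also have "\<dots> = 6144 * C\<^sup>2 * G ^ 3 * (2 / n * (\<Sum>m\<le>top_level. (1/2) ^ m) + 5 / (real n)\<^sup>2 * (\<Sum>m\<le>top_level. 2 ^ m))"
    by (simp add: sum_distrib_left sum.distrib sum_divide_distrib power_one_over field_simps)
  \<comment> \<open>The two geometric sums contribute 2 * 2 and 5 * 4, so the constant becomes 6144
    * 24.\<close>
  also have "\<dots> \<le> 6144 * C\<^sup>2 * G ^ 3 * (2 / n * 2 + 5 / (real n)\<^sup>2 * (4 * n))"
    using half double by (intro mult_left_mono add_mono) auto
  also have "\<dots> = 147456 * C\<^sup>2 * G ^ 3 / n"
    using n_pos by (simp add: field_simps power2_eq_square)
  finally show "(\<integral>X. T X \<partial>SL) \<le> 147456 * C\<^sup>2 * G ^ 3 / n" .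
qed

lemma v_hat_ge_1: "1 \<le> v_hat c n X"
  unfolding v_hat_def by (simp add: sum_nonneg)

lemma err_mono: "k \<le> k' \<Longrightarrow> err n X k \<le> err n X k'"
  unfolding err_def by (intro sum_mono2) auto

text \<open>Rounding k up to a power of 4 at most 4 k doubles sqrt k. Before doubling, the diagonal
  contributes 2 \<open>v_hat\<close> + 2 v and the threshold in \<open>excess\<close> one further
  v.\<close>

lemma err_le:
  assumes k: "k \<in> {1..n\<^sup>2}"
  shows "err n X k \<le> sqrt (real k) / n * (C * (4 * v_hat c n X + 6 * v)) + T X"
proof -
  define m where "m = (LEAST m. k \<le> 4 ^ m)"
  have m_ge: "k \<le> 4 ^ m" unfolding m_def
    by (rule LeastI[of _ k]) (simp add: less_imp_le less_exp order_less_le_trans[OF less_exp power_mono])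
  have "k \<le> n\<^sup>2" using k by simp
  also have "\<dots> \<le> (2 ^ top_level)\<^sup>2" using top_level_ge by (intro power_mono) auto
  also have "\<dots> = 4 ^ top_level" by (metis num_double numeral_times_numeral power2_eq_square power_mult_distrib)
  finally have m_le: "m \<le> top_level" unfolding m_def by (rule Least_le)
  have "4 ^ m \<le> 4 * k"
  proof (cases m)
    case (Suc m')
    then have "\<not> k \<le> 4 ^ m'" unfolding m_def using not_less_Least[of m' "\<lambda>m. k \<le> 4 ^ m"] by simp
    then show ?thesis unfolding Suc by simp
  qed (use k in simp)
  then have "real (4 ^ m) \<le> real (4 * k)" by (simp only: of_nat_le_iff)
  then have "sqrt (real (4 ^ m)) \<le> sqrt (real (4 * k))" by (rule real_sqrt_le_mono)
  moreover have sq: "sqrt (real (4 ^ m)) = 2 ^ m" by (simp add: real_sqrt_power)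
  ultimately have s_le: "2 ^ m \<le> 2 * sqrt (real k)" by (simp add: real_sqrt_mult)
  let ?K = "4 ^ m :: nat"
  have a: "(\<Sum>j<?K. (coeff_a c f j)\<^sup>2) \<le> C * v * 2 ^ m"
    using coeff_sum_sq_le[of ?K] phi_sum_sq_integral'[of ?K] unfolding sq by simp
  have "(\<Sum>l=1..n. \<Sum>j<?K. (Y (X l) j)\<^sup>2) \<le> (\<Sum>l=1..n. 2 * (C * (\<bar>X l\<bar> powr alpha c + 1) * 2 ^ m) + 2 * (C * v * 2 ^ m))"
  proof (rule sum_mono)
    fix l
    show "(\<Sum>j<?K. (Y (X l) j)\<^sup>2) \<le> 2 * (C * (\<bar>X l\<bar> powr alpha c + 1) * 2 ^ m) + 2 * (C * v * 2 ^ m)"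
      using Y_sum_sq_le[of "X l" ?K] a admissible_pointwise[OF adm, of ?K "X l"] unfolding sq by simp
  qed
  also have "\<dots> = 2 ^ m * n * (C * (2 * v_hat c n X + 2 * v))"
    using n_pos unfolding v_hat_def
    by (simp add: sum.distrib sum_distrib_left sum_distrib_right field_simps)
  finally have D: "(\<Sum>l=1..n. \<Sum>j<?K. (Y (X l) j)\<^sup>2) \<le> 2 ^ m * n * (C * (2 * v_hat c n X + 2 * v))" .
  define r where "r = 2 ^ m / real n"
  have "excess m X \<le> T X"
    unfolding T_def using m_le by (intro member_le_sum) (auto simp: excess_def)
  then have "U ?K X / (real n)\<^sup>2 \<le> 2 ^ m / n * (C * v) + T X"
    unfolding excess_def by (simp add: max_def mult_ac split: if_splits)
  moreover have "(real n)\<^sup>2 * err n X ?K \<le> U ?K X + 2 ^ m * n * (C * (2 * v_hat c n X + 2 * v))"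
    using D unfolding U_def err_eq by simp
  then have "err n X ?K \<le> U ?K X / (real n)\<^sup>2 + 2 ^ m / n * (C * (2 * v_hat c n X + 2 * v))"
    using n_pos by (simp add: field_simps power2_eq_square)
  ultimately have "err n X ?K \<le> 2 ^ m / n * (C * (2 * v_hat c n X + 3 * v)) + T X"
    unfolding r_def[symmetric] by (simp add: algebra_simps)
  also have "\<dots> \<le> (2 * sqrt (real k)) / n * (C * (2 * v_hat c n X + 3 * v)) + T X"
    using s_le C_ge_1 v_ge_1 v_hat_ge_1[of X] by (intro add_right_mono mult_right_mono divide_right_mono) auto
  finally show ?thesis using err_mono[OF m_ge, of X] by (simp add: algebra_simps)
qed

text \<open>The variance bound is where the moment of order 2 \<open>alpha\<close> enters the
  risk.\<close>

lemma v_hat_moment: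
  shows "integrable SL (v_hat c n)" and "(\<integral>X. v_hat c n X \<partial>SL) = v"
    and "integrable SL (\<lambda>X. (v_hat c n X - v)\<^sup>2)"
    and "(\<integral>X. (v_hat c n X - v)\<^sup>2 \<partial>SL) \<le> (\<integral>x. \<bar>x\<bar> powr (2 * alpha c) \<partial>law f) / n"
proof -
  define h where "h x = \<bar>x\<bar> powr alpha c - (v - 1)" for x
  have comp: "integrable SL (\<lambda>X. \<bar>X l\<bar> powr alpha c)" "(\<integral>X. \<bar>X l\<bar> powr alpha c \<partial>SL) = v - 1"
    if "l \<in> {1..n}" for l
    using law.PiM_component_integral[OF pow_integrable that] unfolding sample_law_def v_mom_def by simp_all
  have sum_int: "integrable SL (\<lambda>X. 1 / real n * (\<Sum>l=1..n. \<bar>X l\<bar> powr alpha c))"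
    by (intro integrable_mult_right Bochner_Integration.integrable_sum comp)
  show "integrable SL (v_hat c n)"
    unfolding v_hat_def[abs_def] using sum_int by (intro Bochner_Integration.integrable_add) simp_all
  have "(\<integral>X. v_hat c n X \<partial>SL) = (\<integral>X. 1 \<partial>SL) + (\<integral>X. 1 / real n * (\<Sum>l=1..n. \<bar>X l\<bar> powr alpha c) \<partial>SL)"
    unfolding v_hat_def using sum_int by (intro Bochner_Integration.integral_add) simp_all
  also have "\<dots> = 1 + 1 / real n * (\<Sum>l=1..n. v - 1)"
    using SL.prob_space comp by (simp only: integral_mult_right_zero Bochner_Integration.integral_sum) simp
  finally show "(\<integral>X. v_hat c n X \<partial>SL) = v" using n_pos by simp
  have hm: "h \<in> borel_measurable (law f)" unfolding h_def by simp
  have h_sq: "(h x)\<^sup>2 = \<bar>x\<bar> powr (2 * alpha c) - 2 * (v - 1) * (\<bar>x\<bar> powr alpha c) + (v - 1)\<^sup>2" for x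
    unfolding h_def power2_diff pow_sq by simp
  have h2: "integrable (law f) (\<lambda>x. (h x)\<^sup>2)"
    unfolding h_sq using pow_integrable moment by simp
  have h0: "(\<integral>x. h x \<partial>law f) = 0"
    unfolding h_def using pow_integrable law.prob_space by (simp add: v_mom_def)
  have "(\<integral>x. (h x)\<^sup>2 \<partial>law f) = (\<integral>x. \<bar>x\<bar> powr (2 * alpha c) \<partial>law f) - 2 * (v - 1) * (v - 1) + (v - 1)\<^sup>2"
    unfolding h_sq using pow_integrable moment law.prob_space by (simp add: v_mom_def)
  then have h2_le: "(\<integral>x. (h x)\<^sup>2 \<partial>law f) \<le> (\<integral>x. \<bar>x\<bar> powr (2 * alpha c) \<partial>law f)"
    using zero_le_square[of "v - 1"] by (simp add: power2_eq_square algebra_simps)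
  have eq: "(v_hat c n X - v)\<^sup>2 = (\<Sum>l=1..n. h (X l))\<^sup>2 / (real n)\<^sup>2" for X
  proof -
    have "v_hat c n X - v = (\<Sum>l=1..n. h (X l)) / n"
      using n_pos by (simp add: v_hat_def h_def sum.distrib sum_subtractf field_simps)
    then show ?thesis by (simp add: power_divide)
  qed
  show "integrable SL (\<lambda>X. (v_hat c n X - v)\<^sup>2)"
    unfolding eq sample_law_def using law.iid_sum_square(1)[OF hm h2 h0] by simp
  have "(\<integral>X. (v_hat c n X - v)\<^sup>2 \<partial>SL) = n * (\<integral>x. (h x)\<^sup>2 \<partial>law f) / (real n)\<^sup>2"
    unfolding eq sample_law_def using law.iid_sum_square(2)[OF hm h2 h0, of n] by simp
  also have "\<dots> = (\<integral>x. (h x)\<^sup>2 \<partial>law f) / n" using n_pos by (simp add: power2_eq_square)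
  also have "\<dots> \<le> (\<integral>x. \<bar>x\<bar> powr (2 * alpha c) \<partial>law f) / n"
    using h2_le by (rule divide_right_mono) simp
  finally show "(\<integral>X. (v_hat c n X - v)\<^sup>2 \<partial>SL) \<le> (\<integral>x. \<bar>x\<bar> powr (2 * alpha c) \<partial>law f) / n" .
qed

lemma penalised_err_le:
  assumes \<Delta>: "84 * C \<le> \<Delta>" and k: "k \<in> {1..n\<^sup>2}"
  shows "4 * err n X k - pen_hat c \<Delta> n X k + sqrt (real k) / n \<le> 4 * T X + 100 * C * (v_hat c n X - v)\<^sup>2"
proof -
  define q where "q = sqrt (real k) / n"
  define vh where "vh = v_hat c n X"
  have vh: "1 \<le> vh" unfolding vh_def by (rule v_hat_ge_1)
  have "sqrt (real k) \<le> sqrt (real (n\<^sup>2))" using k by (intro real_sqrt_le_mono) (simp only: of_nat_le_iff, simp)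
  then have q: "0 \<le> q" "q \<le> 1" unfolding q_def using n_pos by auto
  have "84 * C * (vh * q) \<le> \<Delta> * (vh * q)" using \<Delta> vh q by (intro mult_right_mono) auto
  then have pen: "84 * C * (vh * q) \<le> pen_hat c \<Delta> n X k"
    unfolding pen_hat_def vh_def q_def by (simp add: mult_ac)
  have e: "err n X k \<le> q * (C * (4 * vh + 6 * v)) + T X"
    using err_le[OF k, of X] unfolding q_def vh_def .
  have main: "4 * err n X k - pen_hat c \<Delta> n X k + q \<le> q * (24 * (C * v) + 1 - 68 * (C * vh)) + 4 * T X"
    using e pen by (simp add: algebra_simps)
  have "q * (24 * (C * v) + 1 - 68 * (C * vh)) \<le> 100 * C * (vh - v)\<^sup>2"
  \<comment> \<open>If v <= 2 \<open>vh\<close>, the bracket is negative since 2 * 24 + 1 <= 68.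
    Otherwise v / 2 < v - \<open>vh\<close>, and v >= 1 gives v <= v^2 <= 4 (\<open>vh\<close> -
    v)^2: Chebyshev's inequality in pointwise form.\<close>
  proof (cases "v \<le> 2 * vh")
    case True
    have "C * v \<le> C * (2 * vh)" using True C_ge_1 by (intro mult_left_mono) auto
    moreover have "1 \<le> C * vh" using C_ge_1 vh mult_mono[of 1 C 1 vh] by simp
    ultimately have "q * (24 * (C * v) + 1 - 68 * (C * vh)) \<le> 0"
      using q by (intro mult_nonneg_nonpos) auto
    also have "0 \<le> 100 * C * (vh - v)\<^sup>2" using C_ge_1 by simp
    finally show ?thesis .
  next
    case False
    have Cv: "1 \<le> C * v" using C_ge_1 v_ge_1 mult_mono[of 1 C 1 v] by simp
    have "0 \<le> C * vh" using C_ge_1 vh by simp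
    then have "q * (24 * (C * v) + 1 - 68 * (C * vh)) \<le> q * (25 * (C * v))"
      using Cv q by (intro mult_left_mono) auto
    also have "\<dots> \<le> 1 * (25 * (C * v))" using q Cv by (intro mult_right_mono) auto
    also have "\<dots> \<le> 100 * C * (vh - v)\<^sup>2"
    proof -
      have "v / 2 * (v / 2) \<le> (v - vh) * (v - vh)" using False v_ge_1 by (intro mult_mono) auto
      moreover have "v * 1 \<le> v * v" using v_ge_1 by (intro mult_left_mono) auto
      ultimately have "v \<le> 4 * (vh - v)\<^sup>2" by (simp add: power2_eq_square algebra_simps)
      then have "25 * C * v \<le> 25 * C * (4 * (vh - v)\<^sup>2)" using C_ge_1 by (intro mult_left_mono) auto
      then show ?thesis by simp
    qed
    finally show ?thesis .
  qed
  then show ?thesis using main unfolding q_def vh_def by linarith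
qed

text \<open>The constants are 1536 = 2 * 768 from the weights, 1179648 = 8 * 147456 from
  \<open>T\<close> and 200 = 2 * 100 from the fluctuation of \<open>v_hat\<close>.\<close>

lemma risk_bound:
  assumes \<Delta>: "84 * C \<le> \<Delta>" and \<kappa>: "1 \<le> \<kappa>" and w: "w = bayes_weights c \<Delta> \<kappa> \<or> w = ms_weights c \<Delta>"
    and n3: "n \<ge> 3" and l: "l \<in> {1..max_dim c n}"
  shows "risk c w n f \<le> ennreal (3 * bias2 l + 2 * (C + \<Delta>) * (v * sqrt (real l) / n) +
    (1536 + 1179648 * C\<^sup>2 * G ^ 3 + 200 * C * (\<integral>x. \<bar>x\<bar> powr (2 * alpha c) \<partial>law f)) / n)"
proof -
  let ?I = "{1..max_dim c n}"
  have M: "max_dim c n \<ge> 1" using l by simp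
  note wts = weights_oracle[OF w \<kappa> n_pos M]
  define g where "g X = 3 * bias2 l + 2 * err n X l + 2 * (\<Delta> * sqrt (real l) / n) * v_hat c n X + 1536 / n +
      8 * T X + 200 * C * (v_hat c n X - v)\<^sup>2" for X
  have loss: "(L2_norm c (\<lambda>x. agg_est c w n X x - f x))\<^sup>2 \<le> g X" for X
  proof -
    define E where "E = ((\<Sum>k\<in>?I. w n X k * sqrt (real k)) + 768) / n"
    have w0: "0 \<le> w n X k" for k by (rule wts(1))
    have w1: "(\<Sum>k\<in>?I. w n X k) = 1" by (rule wts(2))
    have r: "(\<Sum>k\<in>?I. w n X k * (- (\<Sum>j<k. (a_hat c n X j)\<^sup>2) + pen_hat c \<Delta> n X k))
        \<le> - (\<Sum>j<l. (a_hat c n X j)\<^sup>2) + pen_hat c \<Delta> n X l + E"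
      using wts(3)[OF l, of X] unfolding crit_def f_hat_norm E_def .
    have "(L2_norm c (\<lambda>x. agg_est c w n X x - f x))\<^sup>2 \<le> (\<Sum>k\<in>?I. w n X k * (err n X k + bias2 k))"
      using w0 w1 by (rule agg_loss)
    also have "\<dots> \<le> 3 * bias2 l + 2 * err n X l + 2 * pen_hat c \<Delta> n X l + 2 * E +
        2 * (\<Sum>k\<in>?I. w n X k * (4 * err n X k - pen_hat c \<Delta> n X k))"
      using deterministic_oracle[where I = ?I and w = "w n X" and ah = "a_hat c n X" and a = "coeff_a c f"
          and pen = "pen_hat c \<Delta> n X" and N = "(L2_norm c f)\<^sup>2" and l = l and E = E]
        bias2_nonneg w0 w1 r unfolding err_def bias2_def by blast
    \<comment> \<open>The entropy part of \<open>E\<close> returns into the weighted sum as sqrt k /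
      n for each k, where the penalty can pay for it.\<close>
    also have "\<dots> = 3 * bias2 l + 2 * err n X l + 2 * pen_hat c \<Delta> n X l + 1536 / n +
        2 * (\<Sum>k\<in>?I. w n X k * (4 * err n X k - pen_hat c \<Delta> n X k + sqrt (real k) / n))"
      unfolding E_def by (simp add: distrib_left sum.distrib sum_divide_distrib add_divide_distrib)
    also have "\<dots> \<le> 3 * bias2 l + 2 * err n X l + 2 * pen_hat c \<Delta> n X l + 1536 / n +
        2 * (\<Sum>k\<in>?I. w n X k * (4 * T X + 100 * C * (v_hat c n X - v)\<^sup>2))"
      using max_dim_le[OF n3, of c]
      by (intro add_left_mono mult_left_mono sum_mono penalised_err_le \<Delta> w0) auto
    also have "\<dots> = g X"
      unfolding g_def sum_distrib_right[symmetric] w1 by (simp add: pen_hat_def mult_ac)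
    finally show ?thesis .
  qed
  have g_int: "integrable SL g"
    unfolding g_def[abs_def] using err_moment[of l] l v_hat_moment T_moment by simp
  have "risk c w n f \<le> (\<integral>\<^sup>+X. ennreal (g X) \<partial>SL)"
    unfolding risk_def by (intro nn_integral_mono ennreal_leI loss)
  also have "\<dots> = ennreal (\<integral>X. g X \<partial>SL)"
    using g_int loss by (intro nn_integral_eq_integral AE_I2) (auto intro: order_trans[OF zero_le_power2])
  also have "(\<integral>X. g X \<partial>SL) = 3 * bias2 l + 2 * (\<integral>X. err n X l \<partial>SL) + 2 * (\<Delta> * sqrt (real l) / n) * v + 1536 / n +
      8 * (\<integral>X. T X \<partial>SL) + 200 * C * (\<integral>X. (v_hat c n X - v)\<^sup>2 \<partial>SL)"
    unfolding g_def using err_moment[of l] l v_hat_moment T_moment SL.prob_space by simp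
  also have "\<dots> \<le> 3 * bias2 l + 2 * (C * v * sqrt (real l) / n) + 2 * (\<Delta> * sqrt (real l) / n) * v + 1536 / n +
      8 * (147456 * C\<^sup>2 * G ^ 3 / n) + 200 * C * ((\<integral>x. \<bar>x\<bar> powr (2 * alpha c) \<partial>law f) / n)"
    using err_moment(2)[of l] l T_moment(2) v_hat_moment(4) C_ge_1
    by (intro add_mono mult_left_mono order_refl) auto
  also have "\<dots> = 3 * bias2 l + 2 * (C + \<Delta>) * (v * sqrt (real l) / n) +
    (1536 + 1179648 * C\<^sup>2 * G ^ 3 + 200 * C * (\<integral>x. \<bar>x\<bar> powr (2 * alpha c) \<partial>law f)) / n"
    by (simp add: algebra_simps add_divide_distrib)
  finally show ?thesis by (simp add: ennreal_leI)
qed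

end

section \<open>Growth of the dimension and the two final bounds\<close>

lemma eventually_max_dim_ge: "\<forall>\<^sub>F n in at_top. K \<le> max_dim c n"
proof (cases c)
  case Laguerre
  have "filterlim (\<lambda>n. (real n)\<^sup>2 * (600 * ln (real n)) powr (-4)) at_top at_top" by real_asymp
  then have "\<forall>\<^sub>F n in at_top. real K \<le> (real n)\<^sup>2 * (600 * ln (real n)) powr (-4)"
    by (simp add: filterlim_at_top)
  then show ?thesis
  proof eventually_elim
    case (elim n)
    then have "int K \<le> \<lfloor>(real n)\<^sup>2 * (600 * ln (real n)) powr (-4)\<rfloor>" by (simp add: le_floor_iff)
    then show ?case by (simp add: Laguerre le_nat_iff)
  qed
next
  case Hermite
  have "K \<le> n\<^sup>2" if "K \<le> n" for n
    using that power2_nat_le_imp_le order_trans self_le_power[of n 2] by (cases n) auto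
  then show ?thesis unfolding Hermite by (auto simp: eventually_at_top_linorder)
qed

theorem theorem3p3:
  fixes c :: setting and C\<phi> \<Delta> \<kappa> :: real
    and w :: "nat \<Rightarrow> (nat \<Rightarrow> real) \<Rightarrow> nat \<Rightarrow> real"
  assumes "admissible_const c C\<phi>"
    and "\<Delta> \<ge> 84 * C\<phi>"
    and "\<kappa> \<ge> 1"
    and "w = bayes_weights c \<Delta> \<kappa> \<or> w = ms_weights c \<Delta>"
  shows
    "(\<forall>f. L2_density c f \<and> sup_norm f < \<infinity> \<and>
          integrable (law f) (\<lambda>x. \<bar>x\<bar> powr (2 * alpha c)) \<and>
          (\<exists>K\<ge>1. 1 \<ge> bias_b c f (K - 1) \<and> bias_b c f (K - 1) > 0 \<and> bias_b c f K = 0) \<longrightarrow>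
        (\<exists>C\<^sub>f :: real. \<forall>n\<ge>3. max_dim c n \<ge> 1 \<longrightarrow>
           risk c w n f \<le> ennreal (C\<^sub>f / real n)))
     \<and>
     (\<exists>C :: real. \<forall>f. L2_density c f \<and> sup_norm f < \<infinity> \<and>
          integrable (law f) (\<lambda>x. \<bar>x\<bar> powr (2 * alpha c)) \<and>
          (\<forall>k\<ge>1. bias_b c f k > 0) \<longrightarrow>
        (\<forall>n\<ge>3. max_dim c n \<ge> 1 \<longrightarrow>
           risk c w n f \<le> ennreal (C *
             (((L2_norm c f)\<^sup>2 + v_mom c f) * rate_min c C\<phi> n f +
              (max ((enn2real (sup_norm f)) ^ 3) 1 * v_mom c f +
               max ((L2_norm c f)\<^sup>2) 1 * (\<integral>x. \<bar>x\<bar> powr (2 * alpha c) \<partial>law f)) / real n))))"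
proof (intro conjI allI impI, goal_cases)
  case (1 f)
  then obtain K where K: "K \<ge> 1" "bias_b c f K = 0" by auto
  \<comment> \<open>From \<open>N\<close> on, dimension \<open>K\<close> is available and has no
    bias. \<open>N\<close> depends on f only through \<open>K\<close>, so it may enter the
    constant.\<close>
  obtain N where N: "\<And>n. n \<ge> N \<Longrightarrow> K \<le> max_dim c n"
    using eventually_max_dim_ge[of K c] by (auto simp: eventually_at_top_linorder)
  interpret square_integrable_density c f by unfold_locales (use 1 in simp)
  define R where "R = 1536 + 1179648 * C\<phi>\<^sup>2 * max (enn2real (sup_norm f)) 1 ^ 3 + 200 * C\<phi> * (\<integral>x. \<bar>x\<bar> powr (2 * alpha c) \<partial>law f)"
  define V where "V = 2 * (C\<phi> + \<Delta>) * v_mom c f"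
  have C1: "1 \<le> C\<phi>" using assms(1) by (rule admissible_ge_1)
  have V: "0 \<le> V" unfolding V_def v_mom_def using C1 assms(2) by simp
  have "risk c w n f \<le> ennreal ((3 * bias2 1 * N + V * sqrt (real K) + R) / real n)"
    if n: "n \<ge> 3" and M: "max_dim c n \<ge> 1" for n
  proof -
    interpret D: density_sample c f C\<phi> n by unfold_locales (use 1 assms(1) n in auto)
    have risk: "risk c w n f \<le> ennreal (3 * bias2 l + V * sqrt (real l) / n + R / n)" if "l \<in> {1..max_dim c n}" for l
      using D.risk_bound[OF assms(2,3,4) n that] unfolding V_def R_def by (simp add: mult_ac)
    show ?thesis
    proof (cases "K \<le> max_dim c n")
      case True
      have "bias2 K = 0" using bias_b_sq[of K] K by simp
      then have le: "3 * bias2 K + V * sqrt (real K) / n + R / n \<le> (3 * bias2 1 * N + V * sqrt (real K) + R) / n"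
        using bias2_nonneg[of 1] by (simp add: add_divide_distrib)
      show ?thesis by (rule order_trans[OF risk ennreal_leI[OF le]]) (use K True in auto)
    next
      \<comment> \<open>Dimension 1 is always allowed. Its bias does not decay, but n <= N bounds it
        by N / n times itself.\<close>
      case False
      then have "n \<le> N" using N[of n] by linarith
      then have "bias2 1 * n \<le> bias2 1 * N" using bias2_nonneg by (intro mult_left_mono) auto
      then have "3 * bias2 1 \<le> 3 * bias2 1 * N / n" using n by (simp add: field_simps)
      moreover have "V * sqrt (real 1) / n \<le> V * sqrt (real K) / n"
        using V K by (intro divide_right_mono mult_left_mono real_sqrt_le_mono) auto
      ultimately have le: "3 * bias2 1 + V * sqrt (real 1) / n + R / n \<le> (3 * bias2 1 * N + V * sqrt (real K) + R) / n"
        unfolding add_divide_distrib by linarith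
      show ?thesis by (rule order_trans[OF risk ennreal_leI[OF le]]) (use M in auto)
    qed
  qed
  then show ?case by blast
next
  case 2
  have C1: "1 \<le> C\<phi>" using assms(1) by (rule admissible_ge_1)
  \<comment> \<open>The sum of all coefficients of \<open>risk_bound\<close>, fixed before f and n:
    it depends on \<open>C\<phi>\<close> and \<Delta> alone.\<close>
  define Q where "Q = 3 + 2 * (C\<phi> + \<Delta>) + 1536 + 1179648 * C\<phi>\<^sup>2 + 200 * C\<phi>"
  show ?case
  proof (rule exI[of _ Q], intro allI impI, goal_cases)
    case (1 f n)
    then interpret D: density_sample c f C\<phi> n by unfold_locales (use assms(1) in auto)
    define m2 where "m2 = (\<integral>x. \<bar>x\<bar> powr (2 * alpha c) \<partial>law f)"
    have m2: "0 \<le> m2" unfolding m2_def by simp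
    let ?rate = "\<lambda>k. max (rate_k c n f k)
       (exp (- (C\<phi> * v_mom c f / max 1 (400 * enn2real (sup_norm f))) * sqrt (real k)))"
    \<comment> \<open>The minimum is attained; \<open>risk_bound\<close> is applied at this
      minimiser.\<close>
    have "rate_min c C\<phi> n f \<in> ?rate ` {1..max_dim c n}"
      unfolding rate_min_def using 1 by (intro Min_in) auto
    then obtain l where l: "l \<in> {1..max_dim c n}" and rate: "rate_min c C\<phi> n f = ?rate l" by auto
    define r where "r = rate_min c C\<phi> n f"
    have r: "(bias_b c f l)\<^sup>2 \<le> r" "sqrt (real l) / n \<le> r"
      unfolding r_def rate rate_k_def by auto
    then have r0: "0 \<le> r" by (meson order_trans zero_le_power2)
    have v: "1 \<le> v_mom c f" by (rule D.v_ge_1)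
    have G: "max (enn2real (sup_norm f)) 1 ^ 3 = max (enn2real (sup_norm f) ^ 3) 1" (is "_ = ?G3")
      by (cases "enn2real (sup_norm f) \<le> 1") (auto simp: max_def power_le_one not_le dest: one_less_power[of _ 3])
    have bias: "3 * D.bias2 l \<le> 3 * ((L2_norm c f)\<^sup>2 * r)"
      unfolding D.bias_b_sq[symmetric] using r by (intro mult_left_mono) auto
    have var: "v_mom c f * sqrt (real l) / n \<le> v_mom c f * r"
      using mult_left_mono[OF r(2), of "v_mom c f"] v by simp
    have "3 * D.bias2 l + 2 * (C\<phi> + \<Delta>) * (v_mom c f * sqrt (real l) / n)
        \<le> (3 + 2 * (C\<phi> + \<Delta>)) * (((L2_norm c f)\<^sup>2 + v_mom c f) * r)"
    proof -
      have "2 * (C\<phi> + \<Delta>) * (v_mom c f * sqrt (real l) / n) \<le> 2 * (C\<phi> + \<Delta>) * (v_mom c f * r)"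
        using var C1 assms(2) by (intro mult_left_mono) auto
      moreover have "0 \<le> (C\<phi> + \<Delta>) * ((L2_norm c f)\<^sup>2 * r)" "0 \<le> v_mom c f * r"
        using C1 assms(2) r0 v by auto
      ultimately show ?thesis using bias by (simp add: algebra_simps)
    qed
    also have "\<dots> \<le> Q * (((L2_norm c f)\<^sup>2 + v_mom c f) * r)"
      unfolding Q_def using C1 r0 v by (intro mult_right_mono) auto
    finally have A: "3 * D.bias2 l + 2 * (C\<phi> + \<Delta>) * (v_mom c f * sqrt (real l) / n)
        \<le> Q * (((L2_norm c f)\<^sup>2 + v_mom c f) * r)" .
    have "1536 + 1179648 * C\<phi>\<^sup>2 * ?G3 + 200 * C\<phi> * m2 \<le> Q * (?G3 * v_mom c f + max ((L2_norm c f)\<^sup>2) 1 * m2)"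
    proof -
      have G3: "1 \<le> ?G3" by simp
      have Gv: "?G3 * 1 \<le> ?G3 * v_mom c f" using v G3 by (intro mult_left_mono) linarith+
      \<comment> \<open>Absolute constants are absorbed because both the cubed norm factor and
        \<open>v_mom\<close> are at least 1.\<close>
      have "1536 * 1 \<le> 1536 * (?G3 * v_mom c f)" using Gv G3 by linarith
      moreover have "1179648 * C\<phi>\<^sup>2 * ?G3 \<le> 1179648 * C\<phi>\<^sup>2 * (?G3 * v_mom c f)"
        using Gv by (intro mult_left_mono) auto
      ultimately have "1536 + 1179648 * C\<phi>\<^sup>2 * ?G3 \<le> (1536 + 1179648 * C\<phi>\<^sup>2) * (?G3 * v_mom c f)"
        by (simp add: distrib_right)
      also have "\<dots> \<le> Q * (?G3 * v_mom c f)"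
      proof (rule mult_right_mono)
        show "1536 + 1179648 * C\<phi>\<^sup>2 \<le> Q" unfolding Q_def using C1 assms(2) by simp
        show "0 \<le> ?G3 * v_mom c f" using v by (intro mult_nonneg_nonneg) (auto simp: le_max_iff_disj)
      qed
      finally have a: "1536 + 1179648 * C\<phi>\<^sup>2 * ?G3 \<le> Q * (?G3 * v_mom c f)" .
      have "200 * C\<phi> \<le> Q" unfolding Q_def using C1 assms(2) by (simp add: add_nonneg_nonneg)
      moreover have "1 * m2 \<le> max ((L2_norm c f)\<^sup>2) 1 * m2" using m2 by (intro mult_right_mono) auto
      ultimately have "200 * C\<phi> * m2 \<le> Q * (max ((L2_norm c f)\<^sup>2) 1 * m2)"
        using C1 m2 by (intro mult_mono) auto
      then show ?thesis using a by (simp add: distrib_left)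
    qed
    then have B: "(1536 + 1179648 * C\<phi>\<^sup>2 * ?G3 + 200 * C\<phi> * m2) / n
        \<le> Q * ((?G3 * v_mom c f + max ((L2_norm c f)\<^sup>2) 1 * m2) / n)"
      by (simp add: divide_right_mono)
    have "risk c w n f \<le> ennreal (3 * D.bias2 l + 2 * (C\<phi> + \<Delta>) * (v_mom c f * sqrt (real l) / n) +
        (1536 + 1179648 * C\<phi>\<^sup>2 * ?G3 + 200 * C\<phi> * m2) / n)"
      using D.risk_bound[OF assms(2,3,4) _ l] 1 unfolding G m2_def by simp
    also have "\<dots> \<le> ennreal (Q * (((L2_norm c f)\<^sup>2 + v_mom c f) * r +
        (?G3 * v_mom c f + max ((L2_norm c f)\<^sup>2) 1 * m2) / n))"
      unfolding distrib_left[of Q] using A B by (intro ennreal_leI add_mono)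
    finally show ?case unfolding r_def m2_def .
  qed
qed

end
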